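(* Let $p$ be an odd prime. The set of BG-symbols of BG-partitions coincides with the set of Mullineux symbols of self-Mullineux partitions: $\{\mathcal{BG}_p(\lambda) : \lambda \text{ a BG-partition}\} = \{G_p(\mu) : \mu \text{ a self-Mullineux partition}\}$. Consequently the map sending a BG-partition $\lambda$ to the unique $p$-regular partition $\mu$ with $G_p(\mu)=\mathcal{BG}_p(\lambda)$ is a bijection from the set of BG-partitions onto the set of self-Mullineux partitions, and for every $n\in\mathbb{N}$ it restricts to a bijection from the set of BG-partitions of $n$ onto the set of self-Mullineux partitions of $n$.
   Context: Partitions: a partition $\lambda=(\lambda_1\ge\lambda_2\ge\cdots)$ of non-negative integers with finitely many nonzero parts; $|\lambda|=\sum\lambda_i$; $l(\lambda)$ is the number of nonzero parts. Its Young diagram is $[\lambda]=\{(i,j): i\ge 1, 1\le j\le\lambda_i\}$ (elements are nodes; $i$ indexes rows downward, $j$ columns rightward). $\lambda'$ is the conjugate partition ($\lambda'_j=\#\{i:\lambda_i\ge j\}$); $\lambda$ is self-conjugate if $\lambda=\lambda'$. $k(\lambda)=\max\{i:\lambda_i\ge i\}$; the diagonal nodes are $(i,i)$, $1\le i\le k(\lambda)$. The hook length at $(i,j)\in[\lambda]$ is $h_{ij}=\lambda_i+\lambda'_j-i-j+1$. $\lambda$ is $p$-regular if no nonzero part is repeated $p$ or more times. A BG-partition is a self-conjugate partition with $p\nmid h_{ii}$ for all $1\le i\le k(\lambda)$. Rim and $p$-rim: the rim of $\lambda$ is the set of nodes $(i,j)\in[\lambda]$ with $(i+1,j+1)\notin[\lambda]$.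 Label the rim nodes $1,2,3,\dots$ consecutively along the rim path starting at $(1,\lambda_1)$ and going towards $(l(\lambda),1)$ (from top-right to bottom-left, each next node being the node directly below if it lies in the rim path, otherwise the node to the left). The first $p$-segment consists of the rim nodes with labels $1,\dots,p$ (or all if fewer). If the last node $(i,j)$ of a $p$-segment lies in the last row of $[\lambda]$, stop; otherwise, with $l$ the smallest label in row $i+1$, the next $p$-segment consists of the rim nodes with labels $l,\dots,l+p-1$ (or up to the last label). The $p$-rim of $\lambda$ is the union of all $p$-segments. Mullineux symbol and map: for a $p$-regular $\lambda$ put $\lambda^{(0)}=\lambda$ and $\lambda^{(i)}=\lambda^{(i-1)}\setminus\{p\text{-rim of }\lambda^{(i-1)}\}$, with $l$ maximal such that $\lambda^{(l)}\neq\emptyset$. Let $a_i$ be the number of nodes of the $p$-rim of $\lambda^{(i)}$ and $r_i=l(\lambda^{(i)})$. The Mullineux symbol is the array $G_p(\lambda)=\begin{pmatrix}a_0&\cdots&a_l\\ r_0&\cdots&r_l\end{pmatrix}$; distinct $p$-regular partitions have distinct Mullineux symbols. With $\varepsilon_i=0$ if $p\mid a_i$ and $\varepsilon_i=1$ otherwise, and $s_i=a_i+\varepsilon_i-r_i$, the array $\begin{pmatrix}a_0&\cdots&a_l\\ s_0&\cdots&s_l\end{pmatrix}$ is the Mullineux symbol of a unique $p$-regular partition $m(\lambda)$ (the Mullineux map). $\lambda$ is self-Mullineux if it is $p$-regular and $m(\lambda)=\lambda$. $p$-rim* and BG-symbol: for a nonempty self-conjugate $\lambda$ let $U_\lambda=\{(i,j)\in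 p\text{-rim of }\lambda: i\le j\}$, $L_\lambda=\{(j,i):(i,j)\in U_\lambda\}$, and the $p$-rim* $\mathrm{Rim}^*_p(\lambda)=U_\lambda\cup L_\lambda$. Set $a^*_\lambda=\#\mathrm{Rim}^*_p(\lambda)$, $r^*_\lambda=\#U_\lambda$, $\varepsilon^*_\lambda=a^*_\lambda \bmod 2$. Put $\lambda^{(0)*}=\lambda$ and $\lambda^{(i)*}=\lambda^{(i-1)*}\setminus \mathrm{Rim}^*_p(\lambda^{(i-1)*})$ (again self-conjugate), with $l$ maximal such that $\lambda^{(l)*}\ne\emptyset$; write $a^*_i=a^*_{\lambda^{(i)*}}$, $r^*_i=r^*_{\lambda^{(i)*}}$. The BG-symbol is $\mathcal{BG}_p(\lambda)=\begin{pmatrix}a^*_0&\cdots&a^*_l\\ r^*_0&\cdots&r^*_l\end{pmatrix}$. *)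

theory Defs
  imports Main "HOL-Computational_Algebra.Primes"
begin

text \<open>Partitions are represented as lists of positive integers in weakly decreasing order
  (the nonzero parts). Rows and columns are indexed from 1.\<close>

definition is_partition :: "nat list \<Rightarrow> bool" where
  "is_partition lam \<longleftrightarrow> sorted_wrt (\<ge>) lam \<and> (\<forall>x\<in>set lam. 0 < x)"

definition part :: "nat list \<Rightarrow> nat \<Rightarrow> nat" where
  "part lam i = (if 1 \<le> i \<and> i \<le> length lam then lam ! (i - 1) else 0)"

definition diagram :: "nat list \<Rightarrow> (nat \<times> nat) set" where
  "diagram lam = {(i, j). 1 \<le> i \<and> 1 \<le> j \<and> j \<le> part lam i}"

definition conj_part :: "nat list \<Rightarrow> nat list" where
  "conj_part lam = map (\<lambda>j. length (filter (\<lambda>x. j \<le> x) lam)) [1..<part lam 1 + 1]"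

definition self_conjugate :: "nat list \<Rightarrow> bool" where
  "self_conjugate lam \<longleftrightarrow> conj_part lam = lam"

definition kdiag :: "nat list \<Rightarrow> nat" where
  "kdiag lam = card {i. 1 \<le> i \<and> i \<le> part lam i}"

definition hook :: "nat list \<Rightarrow> nat \<Rightarrow> nat \<Rightarrow> nat" where
  "hook lam i j = part lam i + part (conj_part lam) j + 1 - i - j"

definition p_regular :: "nat \<Rightarrow> nat list \<Rightarrow> bool" where
  "p_regular p lam \<longleftrightarrow> is_partition lam \<and> (\<forall>x\<in>set lam. length (filter ((=) x) lam) < p)"

definition BG_partition :: "nat \<Rightarrow> nat list \<Rightarrow> bool" where
  "BG_partition p lam \<longleftrightarrow> is_partition lam \<and> self_conjugate lam \<and>
     (\<forall>i. 1 \<le> i \<and> i \<le> kdiag lam \<longrightarrow> \<not> p dvd hook lam i i)"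

definition row_len :: "(nat \<times> nat) set \<Rightarrow> nat \<Rightarrow> nat" where
  "row_len D i = card {j. (i, j) \<in> D}"

definition of_diagram :: "(nat \<times> nat) set \<Rightarrow> nat list" where
  "of_diagram D = takeWhile (\<lambda>x. 0 < x) (map (row_len D) [1..<card D + 2])"

text \<open>The rim path, listed from (1, lambda_1) to (l(lambda), 1): labels 1,2,... correspond
  to list positions 0,1,....\<close>
definition rim_step :: "(nat \<times> nat) set \<Rightarrow> nat \<times> nat \<Rightarrow> nat \<times> nat" where
  "rim_step D x = (if (Suc (fst x), snd x) \<in> D then (Suc (fst x), snd x) else (fst x, snd x - 1))"

definition rim_list :: "nat list \<Rightarrow> (nat \<times> nat) list" where
  "rim_list lam = map (\<lambda>k. (rim_step (diagram lam) ^^ k) (1, part lam 1))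
                     [0..<part lam 1 + length lam - 1]"

definition rim :: "nat list \<Rightarrow> (nat \<times> nat) set" where
  "rim lam = {(i, j) \<in> diagram lam. (Suc i, Suc j) \<notin> diagram lam}"

text \<open>Positions (labels minus one) in the rim list belonging to the p-segments, starting a
  segment at position s; r is the number of the last row; the first argument is fuel.\<close>
primrec psegs :: "nat \<Rightarrow> nat \<Rightarrow> nat \<Rightarrow> (nat \<times> nat) list \<Rightarrow> nat \<Rightarrow> nat set" where
  "psegs 0 p r R s = {}"
| "psegs (Suc f) p r R s =
     (let e = min (s + p) (length R); i = fst (R ! (e - 1)) in
      if i = r then {s..<e}
      else {s..<e} \<union> psegs f p r R (LEAST k. k < length R \<and> fst (R ! k) = Suc i))"

definition p_rim :: "nat \<Rightarrow> nat list \<Rightarrow> (nat \<times> nat) set" where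
  "p_rim p lam = (\<lambda>k. rim_list lam ! k) `
      psegs (length (rim_list lam)) p (length lam) (rim_list lam) 0"

definition remove_p_rim :: "nat \<Rightarrow> nat list \<Rightarrow> nat list" where
  "remove_p_rim p lam = of_diagram (diagram lam - p_rim p lam)"

text \<open>Mullineux symbol, as the list of columns (a_i, r_i), i = 0..l.\<close>
definition mull_symbol :: "nat \<Rightarrow> nat list \<Rightarrow> (nat \<times> nat) list" where
  "mull_symbol p lam =
     map (\<lambda>i. let mu = (remove_p_rim p ^^ i) lam in (card (p_rim p mu), length mu))
         [0..<(LEAST i. (remove_p_rim p ^^ i) lam = [])]"

definition mull_eps :: "nat \<Rightarrow> nat \<Rightarrow> nat" where
  "mull_eps p a = (if p dvd a then 0 else 1)"

definition mullineux_map :: "nat \<Rightarrow> nat list \<Rightarrow> nat list" where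
  "mullineux_map p lam = (THE mu. p_regular p mu \<and>
      mull_symbol p mu = map (\<lambda>(a, r). (a, a + mull_eps p a - r)) (mull_symbol p lam))"

definition self_mullineux :: "nat \<Rightarrow> nat list \<Rightarrow> bool" where
  "self_mullineux p lam \<longleftrightarrow> p_regular p lam \<and> mullineux_map p lam = lam"

definition U_set :: "nat \<Rightarrow> nat list \<Rightarrow> (nat \<times> nat) set" where
  "U_set p lam = {(i, j) \<in> p_rim p lam. i \<le> j}"

definition p_rim_star :: "nat \<Rightarrow> nat list \<Rightarrow> (nat \<times> nat) set" where
  "p_rim_star p lam = U_set p lam \<union> (\<lambda>(i, j). (j, i)) ` U_set p lam"

definition remove_p_rim_star :: "nat \<Rightarrow> nat list \<Rightarrow> nat list" where
  "remove_p_rim_star p lam = of_diagram (diagram lam - p_rim_star p lam)"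

definition BG_symbol :: "nat \<Rightarrow> nat list \<Rightarrow> (nat \<times> nat) list" where
  "BG_symbol p lam =
     map (\<lambda>i. let mu = (remove_p_rim_star p ^^ i) lam in (card (p_rim_star p mu), card (U_set p mu)))
         [0..<(LEAST i. (remove_p_rim_star p ^^ i) lam = [])]"

definition BG_to_mull :: "nat \<Rightarrow> nat list \<Rightarrow> nat list" where
  "BG_to_mull p lam = (THE mu. p_regular p mu \<and> mull_symbol p mu = BG_symbol p lam)"

end

theory Submission
  imports Defs
begin

text \<open>
  Encode a partition \<open>\<lambda>\<close> by its beads \<open>\<lambda>\<^sub>i - i\<close>. The rim nodes of row \<open>i\<close> have contents from
  \<open>\<lambda>\<^sub>i - i\<close> down to one more than the next bead, so the \<open>p\<close>-segments start at a greedily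
  chosen, \<open>p\<close>-separated set \<open>S\<close> of beads, and removing the \<open>p\<close>-rim replaces every \<open>s \<in> S\<close> by
  \<open>s - p\<close>, truncated at the bottom. The \<open>p\<close>-rim* of a self-conjugate partition is the same
  operation on the nonnegative beads (the arms of the diagonal hooks), where a bead that becomes
  negative is discarded. Up to truncation the operation is inverted by its own mirror image, and
  what truncation forgets is recovered from the node count modulo \<open>p\<close> (modulo \<open>2 * p\<close> for the
  \<open>p\<close>-rim*). Comparing the starts before and after one removal confines the difference of
  consecutive node counts to an interval of length \<open>p\<close> (respectively \<open>2 * p\<close>), so symbols are
  exactly the arrays whose consecutive columns satisfy explicit inequalities. For Mullineux symbols
  these are stable under the Mullineux involution, and on its fixed arrays they become the
  inequalities that characterise BG-symbols.
\<close>

section \<open>Greedy chains and their shifts\<close>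

text \<open>Truncation can affect only the least start: every other start is at least
  \<open>Min S + p\<close> and moves to at least \<open>Min S\<close>. A removal therefore forgets a
  single integer, \<open>Min S\<close>. All segments but the last have exactly \<open>p\<close>
  nodes, so in a beta-set the node count is \<open>p * (card S - 1) + min p (Min S)\<close>, and its
  residue reveals \<open>Min S\<close> whenever truncation occurs. In the p-rim* the last
  contribution is \<open>2 * Min S + 1\<close> when \<open>Min S < p\<close>, the length of a
  diagonal hook, whence the modulus \<open>2 * p\<close>. The BG condition keeps \<open>p\<close>
  from dividing this number, so that parity and divisibility by \<open>p\<close> of the node count
  carry the same information. The intervals arise because a shift preserves the number of starts:
  consecutive node counts differ by one full segment for each start lost to truncation, corrected by
  the lengths of the two last segments. p-regularity enters as the absence of \<open>p\<close>
  consecutive beads, a property that has to be carried through a shift in both directions.\<close>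

text \<open>\<open>chain p X S\<close>: the starts of the \<open>p\<close>-segments when \<open>X\<close> is scanned from its maximum downwards,
  each next start being the largest element of \<open>X\<close> that is at least \<open>p\<close> below the previous one. These three
  conditions determine \<open>S\<close> and, unlike the greedy recursion, are symmetric enough to be reflected.\<close>

definition chain :: "int \<Rightarrow> int set \<Rightarrow> int set \<Rightarrow> bool" where
  "chain p X S \<longleftrightarrow> S \<subseteq> X \<and> (\<forall>s\<in>S. \<forall>s'\<in>S. s < s' \<longrightarrow> s + p \<le> s') \<and>
     (\<forall>x\<in>X. \<exists>s\<in>S. x \<le> s \<and> s < x + p)"

definition up_chain :: "int \<Rightarrow> int set \<Rightarrow> int set \<Rightarrow> bool" where
  "up_chain p Y U \<longleftrightarrow> U \<subseteq> Y \<and> (\<forall>s\<in>U. \<forall>s'\<in>U. s < s' \<longrightarrow> s + p \<le> s') \<and>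
     (\<forall>y\<in>Y. \<exists>u\<in>U. u \<le> y \<and> y < u + p)"

definition shift :: "int \<Rightarrow> int set \<Rightarrow> int set \<Rightarrow> int set" where
  "shift p X S = (X - S) \<union> (\<lambda>s. s - p) ` S"

lemma chain_sub: "chain p X S \<Longrightarrow> s \<in> S \<Longrightarrow> s \<in> X"
  by (auto simp: chain_def)

lemma chain_sep: "chain p X S \<Longrightarrow> s \<in> S \<Longrightarrow> s' \<in> S \<Longrightarrow> s < s' \<Longrightarrow> s + p \<le> s'"
  by (auto simp: chain_def)

lemma chain_cover:
  assumes "chain p X S" "x \<in> X"
  obtains s where "s \<in> S" "x \<le> s" "s < x + p"
  using assms by (auto simp: chain_def)

lemma chain_finite: "chain p X S \<Longrightarrow> finite X \<Longrightarrow> finite S"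
  by (auto simp: chain_def intro: finite_subset)

text \<open>Negation reverses the scanning direction, so each fact about chains has a reflected
  version at no cost.\<close>

lemma up_chain_iff: "up_chain p Y U \<longleftrightarrow> chain p (uminus ` Y) (uminus ` U)"
proof -
  have "(\<forall>y\<in>Y. \<exists>u\<in>U. u \<le> y \<and> y < u + p) \<longleftrightarrow> (\<forall>x\<in>uminus ` Y. \<exists>s\<in>uminus ` U. x \<le> s \<and> s < x + p)"
    by (auto simp: algebra_simps)
  moreover have "(\<forall>s\<in>U. \<forall>s'\<in>U. s < s' \<longrightarrow> s + p \<le> s') \<longleftrightarrow>
      (\<forall>s\<in>uminus ` U. \<forall>s'\<in>uminus ` U. s < s' \<longrightarrow> s + p \<le> s')"
    by (auto simp: algebra_simps)
  moreover have "U \<subseteq> Y \<longleftrightarrow> uminus ` U \<subseteq> uminus ` Y"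
    by (simp add: inj_image_subset_iff)
  ultimately show ?thesis unfolding up_chain_def chain_def by (simp only:)
qed

lemma chain_exists:
  assumes "finite X" "0 < p" shows "\<exists>S. chain p X S"
  using assms(1)
proof (induction X rule: finite_psubset_induct)
  case (psubset X)
  show ?case
  proof (cases "X = {}")
    case True
    then show ?thesis by (intro exI[of _ "{}"]) (simp add: chain_def)
  next
    case False
    define M where "M = Max X"
    have M: "M \<in> X" "\<And>x. x \<in> X \<Longrightarrow> x \<le> M" using False psubset.hyps by (auto simp: M_def)
    define X2 where "X2 = {x\<in>X. x \<le> M - p}"
    have "M \<notin> X2" "X2 \<subseteq> X" using assms(2) by (auto simp: X2_def)
    then have "X2 \<subset> X" using M(1) by blast
    then obtain S where S: "chain p X2 S" using psubset.IH by blast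
    have "S \<subseteq> X2" using S by (auto simp: chain_def)
    have "chain p X (insert M S)"
      unfolding chain_def
    proof (intro conjI ballI impI)
      show "insert M S \<subseteq> X" using \<open>S \<subseteq> X2\<close> M by (auto simp: X2_def)
    next
      fix s s' assume "s \<in> insert M S" "s' \<in> insert M S" "s < s'"
      then show "s + p \<le> s'" using \<open>S \<subseteq> X2\<close> chain_sep[OF S] M(2) assms(2)
        by (auto simp: X2_def)
    next
      fix x assume "x \<in> X"
      show "\<exists>s\<in>insert M S. x \<le> s \<and> s < x + p"
      proof (cases "x \<le> M - p")
        case True
        then show ?thesis using \<open>x \<in> X\<close> S by (auto simp: X2_def elim: chain_cover)
      next
        case False
        then show ?thesis using M(2)[OF \<open>x \<in> X\<close>] by auto
      qed
    qed
    then show ?thesis by blast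
  qed
qed

text \<open>Take the largest element \<open>t\<close> on which the two chains disagree. The chain
  that misses \<open>t\<close> covers it by a start strictly between \<open>t\<close> and
  \<open>t + p\<close>. That start is common to both chains, and so violates separation in the chain
  that contains \<open>t\<close>.\<close>

lemma chain_unique_aux:
  assumes "chain p X S" "chain p X S'" "finite X" "s \<in> S" shows "s \<in> S'"
proof (rule ccontr)
  assume "s \<notin> S'"
  define t where "t = Max {x \<in> X. (x \<in> S) \<noteq> (x \<in> S')}"
  have ne: "{x \<in> X. (x \<in> S) \<noteq> (x \<in> S')} \<noteq> {}"
    using assms \<open>s \<notin> S'\<close> chain_sub by blast
  have t: "t \<in> X" "(t \<in> S) \<noteq> (t \<in> S')" using Max_in[OF _ ne] assms(3) by (auto simp: t_def)
  have big: "x \<in> S \<longleftrightarrow> x \<in> S'" if "t < x" for x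
  proof (cases "x \<in> X")
    case True
    show ?thesis
    proof (rule ccontr)
      assume "(x \<in> S) \<noteq> (x \<in> S')"
      then have "x \<le> t" using True assms(3) by (auto simp: t_def)
      with that show False by simp
    qed
  next
    case False
    then show ?thesis using assms chain_sub by blast
  qed
  obtain a where a: "a \<in> S" "t \<le> a" "a < t + p" using chain_cover[OF assms(1) t(1)] .
  obtain b where b: "b \<in> S'" "t \<le> b" "b < t + p" using chain_cover[OF assms(2) t(1)] .
  show False
  proof (cases "t \<in> S")
    case True
    then have "b \<in> S" "t < b" using b t big[of b] by (cases "t = b", auto)+
    then show False using chain_sep[OF assms(1) True] b by fastforce
  next
    case False
    then have "t \<in> S'" "a \<in> S'" "t < a" using a t big[of a] by (cases "t = a", auto)+
    then show False using chain_sep[OF assms(2)] a by fastforce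
  qed
qed

lemma chain_unique: "chain p X S \<Longrightarrow> chain p X S' \<Longrightarrow> finite X \<Longrightarrow> S = S'"
  using chain_unique_aux by blast

lemma up_chain_exists: "finite Y \<Longrightarrow> 0 < p \<Longrightarrow> \<exists>U. up_chain p Y U"
proof -
  assume "finite Y" "0 < p"
  then obtain S where "chain p (uminus ` Y) S" using chain_exists by blast
  then have "up_chain p Y (uminus ` S)" by (simp add: up_chain_iff image_image)
  then show ?thesis by blast
qed

lemma up_chain_unique: "up_chain p Y U \<Longrightarrow> up_chain p Y U' \<Longrightarrow> finite Y \<Longrightarrow> U = U'"
  unfolding up_chain_iff by (drule chain_unique, assumption, simp) (simp add: inj_image_eq_iff)

text \<open>The start covering an element lies at or above it, so cutting off the bottom leaves all
  choices above the cut unchanged.\<close>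

lemma chain_restrict_above: "chain p X S \<Longrightarrow> chain p {x\<in>X. c < x} {x\<in>S. c < x}"
  unfolding chain_def by fastforce

lemma chain_translate: "chain p X S \<Longrightarrow> chain p ((\<lambda>x. x + c) ` X) ((\<lambda>x. x + c) ` S)"
  unfolding chain_def by (force simp: algebra_simps)

text \<open>A shifted bead never collides with a resting one: if \<open>s - p\<close> is occupied,
  its covering start is less than \<open>p\<close> below \<open>s\<close> unless it is
  \<open>s - p\<close> itself, and then that place is being vacated.\<close>

lemma shift_disjoint:
  assumes "chain p X S" "s \<in> S" "s - p \<in> X" shows "s - p \<in> S"
proof -
  obtain t where t: "t \<in> S" "s - p \<le> t" "t < s - p + p" using chain_cover[OF assms(1,3)] .
  then have "t + p \<le> s" using chain_sep[OF assms(1) t(1) assms(2)] by simp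
  with t have "t = s - p" by simp
  with t show ?thesis by simp
qed

lemma card_shift:
  assumes "chain p X S" "finite X" shows "card (shift p X S) = card X"
proof -
  have fS: "finite S" "S \<subseteq> X" using assms chain_finite chain_sub by blast+
  have "(X - S) \<inter> (\<lambda>s. s - p) ` S = {}" using shift_disjoint[OF assms(1)] by auto
  then have "card (shift p X S) = card (X - S) + card ((\<lambda>s. s - p) ` S)"
    unfolding shift_def using assms fS by (intro card_Un_disjoint) auto
  also have "card ((\<lambda>s. s - p) ` S) = card S" by (intro card_image) (auto simp: inj_on_def)
  also have "card (X - S) + card S = card X"
    using fS assms(2) card_mono[OF assms(2) fS(2)] by (simp add: card_Diff_subset)
  finally show ?thesis .
qed

text \<open>After the shift every bead sits in the segment window of some start. This yields both
  the lower bound \<open>Min S - p\<close> and the covering condition of the mirrored chain.\<close>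

lemma shift_window:
  assumes "chain p X S" "0 < p" "y \<in> shift p X S"
  obtains s where "s \<in> S" "s - p \<le> y" "y < s"
proof (cases "y \<in> (\<lambda>s. s - p) ` S")
  case True
  then show thesis using that assms(2) by auto
next
  case False
  then have "y \<in> X" "y \<notin> S" using assms(3) by (auto simp: shift_def)
  obtain s where "s \<in> S" "y \<le> s" "s < y + p" using chain_cover[OF assms(1) \<open>y \<in> X\<close>] .
  then show thesis using that[of s] \<open>y \<notin> S\<close> by (cases "y = s") auto
qed

text \<open>The landing places form the mirrored chain of the shifted set. As mirrored chains are
  unique, the shifted set alone tells which beads were moved.\<close>

lemma up_chain_shift:
  assumes "chain p X S" "0 < p" shows "up_chain p (shift p X S) ((\<lambda>s. s - p) ` S)"
  unfolding up_chain_def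
proof (intro conjI ballI impI)
  show "(\<lambda>s. s - p) ` S \<subseteq> shift p X S" by (auto simp: shift_def)
next
  fix s s' assume "s \<in> (\<lambda>s. s - p) ` S" "s' \<in> (\<lambda>s. s - p) ` S" "s < s'"
  then show "s + p \<le> s'" using chain_sep[OF assms(1)] by fastforce
next
  fix y assume "y \<in> shift p X S"
  then obtain s where "s \<in> S" "s - p \<le> y" "y < s" using shift_window[OF assms] by blast
  then show "\<exists>u\<in>(\<lambda>s. s - p) ` S. u \<le> y \<and> y < u + p" by (intro bexI[of _ "s - p"]) auto
qed

lemma shift_inverse:
  assumes "chain p X S"
  shows "(shift p X S - (\<lambda>s. s - p) ` S) \<union> (\<lambda>u. u + p) ` (\<lambda>s. s - p) ` S = X"
  using shift_disjoint[OF assms] chain_sub[OF assms] by (auto simp: shift_def image_image)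

lemma chain_inj:
  assumes "chain p X S" "chain p X' S'" "finite X" "finite X'" "0 < p" "shift p X S = shift p X' S'"
  shows "X = X'"
proof -
  have "finite (shift p X S)" using assms chain_finite by (auto simp: shift_def)
  then have "(\<lambda>s. s - p) ` S = (\<lambda>s. s - p) ` S'"
    using up_chain_unique up_chain_shift assms by metis
  then show ?thesis using shift_inverse assms by metis
qed

text \<open>The reflection of \<open>up_chain_shift\<close> and \<open>shift_inverse\<close>: it
  makes every finite set the shift of some set, which drives both existence proofs below.\<close>

lemma chain_of_up_chain:
  assumes "up_chain p Y U" "0 < p"
  defines "X \<equiv> (Y - U) \<union> (\<lambda>u. u + p) ` U" and "S \<equiv> (\<lambda>u. u + p) ` U"
  shows "chain p X S" "shift p X S = Y"
proof -
  let ?Y = "uminus ` Y" and ?U = "uminus ` U"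
  have c: "chain p ?Y ?U" using assms(1) by (simp add: up_chain_iff)
  have e: "uminus ` X = shift p ?Y ?U"
    by (auto simp: X_def shift_def image_Un image_image image_set_diff[OF inj_uminus])
  have e2: "uminus ` S = (\<lambda>s. s - p) ` ?U" by (auto simp: S_def image_image)
  have "up_chain p (uminus ` X) (uminus ` S)" unfolding e e2 by (rule up_chain_shift[OF c assms(2)])
  then show "chain p X S" by (simp add: up_chain_iff image_image)
  have "uminus ` shift p X S = (uminus ` X - uminus ` S) \<union> (\<lambda>u. u + p) ` uminus ` S"
    by (auto simp: shift_def image_Un image_image image_set_diff[OF inj_uminus])
  also have "\<dots> = ?Y" unfolding e e2 by (rule shift_inverse[OF c])
  finally show "shift p X S = Y" by (simp add: inj_image_eq_iff)
qed

text \<open>By separation at most one bead of a window of length \<open>p\<close> has just arrived.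
  If it arrived at the bottom of the window, it came from the place just above the top, and the run
  moves up by one; otherwise its place was already occupied.\<close>

lemma run_shift:
  assumes "chain p X S" "2 \<le> p" "{x..<x+p} \<subseteq> shift p X S"
  shows "{x..<x+p} \<subseteq> X \<or> {x+1..<x+1+p} \<subseteq> X"
proof (cases "\<exists>s\<in>S. s - p \<in> {x..<x+p}")
  case False
  show ?thesis
  proof (intro disjI1 subsetI)
    fix y assume y: "y \<in> {x..<x+p}"
    then have "y \<notin> (\<lambda>s. s - p) ` S" using False by blast
    then show "y \<in> X" using y assms(3) by (auto simp: shift_def)
  qed
next
  case True
  then obtain s where s: "s \<in> S" "s - p \<in> {x..<x+p}" by blast
  have rest: "y \<in> X \<and> y \<notin> S" if "y \<in> {x..<x+p}" "y \<noteq> s - p" for y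
  proof -
    have "y \<notin> (\<lambda>s. s - p) ` S"
    proof
      assume "y \<in> (\<lambda>s. s - p) ` S"
      then obtain s' where "s' \<in> S" "y = s' - p" by blast
      then show False using chain_sep[OF assms(1) s(1)] chain_sep[OF assms(1) _ s(1)] that s(2)
        by (cases "s < s'") fastforce+
    qed
    then show ?thesis using that assms(3) by (auto simp: shift_def)
  qed
  have sX: "s \<in> X" using s assms(1) chain_sub by blast
  show ?thesis
  proof (cases "s - p = x")
    case True
    have "y \<in> X" if "y \<in> {x+1..<x+1+p}" for y
      using rest[of y] that sX True by (cases "y = s") auto
    then show ?thesis by blast
  next
    case False
    \<comment> \<open>The bead just below the new one rests and is no start. Its covering start is
      less than \<open>p\<close> above it, and separation from \<open>s\<close> leaves only
      \<open>s - p\<close>.\<close>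
    then have y: "s - p - 1 \<in> X" "s - p - 1 \<notin> S" using rest[of "s - p - 1"] s(2) by auto
    obtain t where t: "t \<in> S" "s - p - 1 \<le> t" "t < s - p - 1 + p" using chain_cover[OF assms(1) y(1)] .
    have "t \<noteq> s - p - 1" using y t by auto
    then have "t = s - p" using chain_sep[OF assms(1) t(1) s(1)] t by simp
    then have "s - p \<in> X" using t assms(1) chain_sub by blast
    then show ?thesis using rest by blast
  qed
qed

text \<open>The reflection of \<open>run_shift\<close>; negation turns the upward displacement of
  the run into a downward one.\<close>

lemma run_unshift:
  assumes "chain p X S" "2 \<le> p" "{x..<x+p} \<subseteq> X"
  shows "{x..<x+p} \<subseteq> shift p X S \<or> {x-1..<x-1+p} \<subseteq> shift p X S"
proof -
  let ?Y = "shift p X S" and ?U = "(\<lambda>s. s - p) ` S"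
  have c: "chain p (uminus ` ?Y) (uminus ` ?U)"
    using up_chain_shift[OF assms(1)] assms(2) by (simp add: up_chain_iff)
  have "uminus ` X = (uminus ` ?Y - uminus ` ?U) \<union> uminus ` (\<lambda>u. u + p) ` ?U"
    by (subst shift_inverse[OF assms(1), symmetric]) (simp add: image_Un image_set_diff[OF inj_uminus])
  also have "\<dots> = shift p (uminus ` ?Y) (uminus ` ?U)"
    unfolding shift_def image_image by simp
  finally have e: "uminus ` X = shift p (uminus ` ?Y) (uminus ` ?U)" .
  have neg: "{-x-p+1..<-x-p+1+p} = uminus ` {x..<x+p}" for x
    by (auto simp: image_iff intro!: bexI[of _ "- y" for y])
  have "uminus ` {x..<x+p} \<subseteq> shift p (uminus ` ?Y) (uminus ` ?U)"
    using assms(3) unfolding e[symmetric] by (rule image_mono)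
  from run_shift[OF c assms(2) this[unfolded neg[symmetric]]]
  have "{-x-p+1..<-x-p+1+p} \<subseteq> uminus ` ?Y \<or> {-(x-1)-p+1..<-(x-1)-p+1+p} \<subseteq> uminus ` ?Y"
    by (simp add: algebra_simps)
  then show ?thesis unfolding neg inj_image_subset_iff[OF inj_uminus] .
qed

text \<open>Starts before and after a shift interlace: the window from \<open>s - p\<close> up to
  but excluding \<open>s\<close> contains a new start, since the bead at \<open>s - p\<close> must
  be covered, and every new start lies in such a window. Windows are disjoint and new starts are
  separated, so both assignments are injective.\<close>

lemma card_chain_shift:
  assumes "chain p X S" "chain p (shift p X S) T" "finite X" "0 < p"
  shows "card T = card S"
proof -
  have fin: "finite S" "finite T"
    using assms chain_finite by (auto simp: shift_def intro: chain_finite)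
  have "\<forall>s\<in>S. \<exists>t\<in>T. s - p \<le> t \<and> t < s"
  proof
    fix s assume "s \<in> S"
    then have "s - p \<in> shift p X S" by (auto simp: shift_def)
    then show "\<exists>t\<in>T. s - p \<le> t \<and> t < s" using chain_cover[OF assms(2)] by (metis diff_add_cancel)
  qed
  then obtain f where f: "\<And>s. s \<in> S \<Longrightarrow> f s \<in> T \<and> s - p \<le> f s \<and> f s < s" by metis
  have "inj_on f S"
  proof (rule inj_onI, rule ccontr)
    fix s s' assume h: "s \<in> S" "s' \<in> S" "f s = f s'" "s \<noteq> s'"
    then show False using f[of s] f[of s'] chain_sep[OF assms(1), of s s'] chain_sep[OF assms(1), of s' s]
      by (cases "s < s'") auto
  qed
  then have "card S \<le> card T" using f fin by (intro card_inj_on_le[of f]) auto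
  have "\<forall>t\<in>T. \<exists>s\<in>S. s - p \<le> t \<and> t < s"
    using shift_window[OF assms(1,4)] chain_sub[OF assms(2)] by metis
  then obtain g where g: "\<And>t. t \<in> T \<Longrightarrow> g t \<in> S \<and> g t - p \<le> t \<and> t < g t" by metis
  have "inj_on g T"
  proof (rule inj_onI, rule ccontr)
    fix s s' assume h: "s \<in> T" "s' \<in> T" "g s = g s'" "s \<noteq> s'"
    then show False using g[of s] g[of s'] chain_sep[OF assms(2), of s s'] chain_sep[OF assms(2), of s' s]
      by (cases "s < s'") auto
  qed
  then have "card T \<le> card S" using g fin by (intro card_inj_on_le[of g]) auto
  with \<open>card S \<le> card T\<close> show ?thesis by simp
qed

text \<open>All elements but the least exceed \<open>c\<close> by at least \<open>p\<close>, so only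
  one summand can be smaller than \<open>p\<close>.\<close>

lemma sum_min_sep:
  fixes p c :: int
  assumes "finite Q" "Q \<noteq> {}" "\<And>s s'. s \<in> Q \<Longrightarrow> s' \<in> Q \<Longrightarrow> s < s' \<Longrightarrow> s + p \<le> s'" "\<And>s. s \<in> Q \<Longrightarrow> c \<le> s"
  shows "(\<Sum>s\<in>Q. min p (s - c)) = p * (int (card Q) - 1) + min p (Min Q - c)"
proof -
  have m: "Min Q \<in> Q" using assms by simp
  have "(\<Sum>s\<in>Q. min p (s - c)) = min p (Min Q - c) + (\<Sum>s\<in>Q - {Min Q}. min p (s - c))"
    using assms(1) m by (rule sum.remove)
  also have "(\<Sum>s\<in>Q - {Min Q}. min p (s - c)) = (\<Sum>s\<in>Q - {Min Q}. p)"
  proof (rule sum.cong)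
    fix s assume s: "s \<in> Q - {Min Q}"
    then have "Min Q < s" using assms(1) by (metis DiffD1 DiffD2 Min_le insertI1 order_le_less)
    then have "Min Q + p \<le> s" using assms(3) m s by blast
    then show "min p (s - c) = p" using assms(4)[OF m] by simp
  qed simp
  also have "\<dots> = (int (card Q) - 1) * p" using assms(1,2) m
    by (simp add: card_Diff_singleton of_nat_diff Suc_leI card_gt_0_iff)
  finally show ?thesis by (simp add: algebra_simps)
qed

section \<open>Effect of a \<open>p\<close>-rim removal on beta-sets\<close>

text \<open>The form that p-regularity takes on beads: \<open>p\<close> equal parts are
  \<open>p\<close> consecutive beads (see \<open>p_regular_iff\<close>).\<close>

definition run_free :: "int \<Rightarrow> int set \<Rightarrow> bool" where
  "run_free p X \<longleftrightarrow> (\<forall>x. \<not> {x..<x+p} \<subseteq> X)"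

text \<open>Integer counterpart of \<open>mull_eps\<close>, linked to it by
  \<open>chain_eps_nat\<close>.\<close>

definition chain_eps :: "int \<Rightarrow> int \<Rightarrow> int" where
  "chain_eps p a = (if p dvd a then 0 else 1)"

text \<open>Used with \<open>b\<close> the length of the last segment: the node count is a multiple
  of \<open>p\<close> exactly when that segment is full.\<close>

lemma dvd_full_windows: "1 \<le> b \<Longrightarrow> b \<le> p \<Longrightarrow> (p::int) dvd p * k + b \<longleftrightarrow> b = p"
  using zdvd_imp_le[of p b] by (auto simp: dvd_add_right_iff)

locale removal =
  fixes p :: int and X S :: "int set"
  assumes p2: "2 \<le> p" and finX: "finite X" and neX: "X \<noteq> {}" and chainS: "chain p X S"
begin

lemma finS: "finite S" using chain_finite[OF chainS finX] .

lemma neS: "S \<noteq> {}" using neX chainS by (auto elim: chain_cover)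

lemma Min_in_S: "Min S \<in> S" using finS neS by simp

lemma above_Min: "s \<in> S \<Longrightarrow> s \<noteq> Min S \<Longrightarrow> Min S + p \<le> s"
  using chain_sep[OF chainS Min_in_S] Min_le[OF finS] by (metis order_le_less)

lemma shift_lower: "y \<in> shift p X S \<Longrightarrow> Min S - p \<le> y"
  using shift_window[OF chainS] Min_le[OF finS] p2 by (smt (verit))

lemma Min_shift_in: "Min S - p \<in> shift p X S"
  using Min_in_S by (auto simp: shift_def)

lemma fin_shift: "finite (shift p X S)" using finX finS by (auto simp: shift_def)

text \<open>A start other than the least one is at least \<open>Min S + p\<close>, so it cannot fall
  below \<open>Min S\<close>. Hence at most one bead is ever truncated.\<close>

lemma shift_above_lower:
  assumes "\<And>x. x \<in> X \<Longrightarrow> c \<le> x" "y \<in> shift p X S" "y \<noteq> Min S - p"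
  shows "c \<le> y"
proof (cases "y \<in> X")
  case False
  then obtain s where s: "s \<in> S" "y = s - p" using assms(2) by (auto simp: shift_def)
  then have "Min S + p \<le> s" using assms(3) by (intro above_Min) auto
  moreover have "c \<le> Min S" using assms(1) Min_in_S chain_sub[OF chainS] by blast
  ultimately show ?thesis using s by simp
qed (use assms in blast)

lemma window_sum:
  assumes "\<And>x. x \<in> X \<Longrightarrow> c \<le> x"
  shows "(\<Sum>s\<in>S. min p (s - c)) = p * (int (card S) - 1) + min p (Min S - c)"
  using sum_min_sep[OF finS neS chain_sep[OF chainS]] assms chain_sub[OF chainS] by blast

lemma next_chain:
  assumes "chain p (shift p X S) T"
  shows "finite T" "card T = card S" "\<And>t. t \<in> T \<Longrightarrow> Min S - p \<le> t" "\<exists>t\<in>T. t < Min S"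
proof -
  show "finite T" using chain_finite[OF assms fin_shift] .
  show "card T = card S" using card_chain_shift[OF chainS assms finX] p2 by simp
  show "\<And>t. t \<in> T \<Longrightarrow> Min S - p \<le> t" using shift_lower chain_sub[OF assms] by blast
  show "\<exists>t\<in>T. t < Min S" using chain_cover[OF assms Min_shift_in] by (metis diff_add_cancel)
qed

end

text \<open>\<open>X\<close> and \<open>Z\<close> are the beta-sets \<open>{\<lambda>\<^sub>i - i + l(\<lambda>)}\<close> of a partition before and after removing its \<open>p\<close>-rim.
  Beads pushed below 0 stop at 0; the result has an initial run of length \<open>m\<close>, which accounts
  for the rows lost.\<close>

locale mullineux_step = removal +
  fixes m :: int and Z :: "int set"
  assumes posX: "\<And>x. x \<in> X \<Longrightarrow> 1 \<le> x" and posZ: "\<And>z. z \<in> Z \<Longrightarrow> 1 \<le> z" and m0: "0 \<le> m"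
    and step: "max 0 ` shift p X S = {0..<m} \<union> (\<lambda>z. z + m) ` Z"
begin

lemma Min_pos: "1 \<le> Min S" using posX Min_in_S chain_sub[OF chainS] by blast

text \<open>The elements of \<open>Z\<close> are positive, so after truncation 0 can be occupied
  only by a lost row. A bead landing exactly on 0 counts too: for \<open>Min S = p\<close> a row is
  lost although the last segment is full, whereas \<open>eps_eq\<close> switches only at
  \<open>Min S < p\<close>.\<close>

lemma m_pos_iff: "1 \<le> m \<longleftrightarrow> Min S \<le> p"
proof
  assume "1 \<le> m"
  then have "0 \<in> max 0 ` shift p X S" unfolding step by simp
  then obtain y where "y \<in> shift p X S" "y \<le> 0" by (auto simp: max_def split: if_splits)
  then show "Min S \<le> p" using shift_above_lower[of 1 y] posX by force
next
  assume "Min S \<le> p"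
  then have "0 \<in> max 0 ` shift p X S" using Min_shift_in by (auto simp: image_iff max_def intro!: bexI[of _ "Min S - p"])
  then show "1 \<le> m" using posZ m0 unfolding step by fastforce
qed

text \<open>Undoes the truncation: the only information missing from \<open>m\<close> and
  \<open>Z\<close> is the true position \<open>Min S - p\<close> of the bead that was stopped at
  0.\<close>

lemma shift_eq:
  "shift p X S = (\<lambda>z. z + m) ` Z \<union> {1..<m} \<union> (if 1 \<le> m then {Min S - p} else {})" (is "_ = ?R")
proof (rule set_eqI)
  fix y
  show "y \<in> shift p X S \<longleftrightarrow> y \<in> ?R"
  proof (cases "1 \<le> y")
    case True
    then have "y \<in> shift p X S \<longleftrightarrow> y \<in> max 0 ` shift p X S"
      by (auto simp: image_iff max_def)
    also have "\<dots> \<longleftrightarrow> y \<in> ?R" using True m_pos_iff by (auto simp: step)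
    finally show ?thesis .
  next
    case False
    have "y \<in> shift p X S \<longleftrightarrow> y = Min S - p \<and> Min S \<le> p"
      using shift_above_lower[of 1 y] posX Min_shift_in False by force
    also have "\<dots> \<longleftrightarrow> y \<in> ?R" using False m_pos_iff posZ m0 by fastforce
    finally show ?thesis .
  qed
qed

lemma shift_above: "{y \<in> shift p X S. m < y} = (\<lambda>z. z + m) ` Z"
  unfolding shift_eq using posZ m_pos_iff m0 by (fastforce split: if_splits)

lemma window_sum_pos: "sum (min p) S = p * (int (card S) - 1) + min p (Min S)"
  using window_sum[of 0] posX by fastforce

lemma eps_eq: "chain_eps p (sum (min p) S) = (if p \<le> Min S then 0 else 1)"
  using dvd_full_windows[of "min p (Min S)" p "int (card S) - 1"] Min_pos p2
  by (auto simp: chain_eps_def window_sum_pos)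

text \<open>\<open>Z\<close> sits in the shifted set up to translation, so a run in it would come
  from a run in \<open>X\<close> by \<open>run_shift\<close>.\<close>

lemma run_free_next: "run_free p X \<Longrightarrow> run_free p Z"
  unfolding run_free_def
proof (rule allI, rule notI)
  fix x assume X: "\<forall>x. \<not> {x..<x+p} \<subseteq> X" and Z: "{x..<x+p} \<subseteq> Z"
  have "(\<lambda>z. z + m) ` Z \<subseteq> shift p X S" using shift_above by blast
  then have "(\<lambda>z. z + m) ` {x..<x+p} \<subseteq> shift p X S" using Z by blast
  moreover have "(\<lambda>z. z + m) ` {x..<x+p} = {x+m..<x+m+p}" by (simp add: algebra_simps)
  ultimately show False using run_shift[OF chainS p2, of "x + m"] X by auto
qed

lemma length_drop_bounds:
  assumes "run_free p X"
  shows "chain_eps p (sum (min p) S) \<le> m" "m < p + chain_eps p (sum (min p) S)"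
proof -
  show "chain_eps p (sum (min p) S) \<le> m" using eps_eq m_pos_iff m0 by auto
  show "m < p + chain_eps p (sum (min p) S)"
  proof (rule ccontr)
    assume "\<not> m < p + chain_eps p (sum (min p) S)"
    then have m: "p \<le> m" "Min S < p \<Longrightarrow> p + 1 \<le> m" using eps_eq p2 by (auto split: if_splits)
    then have sp: "Min S \<le> p" using m_pos_iff p2 by simp
    \<comment> \<open>a drop that is too large would force \<open>p\<close> equal parts\<close>
    have "y \<in> X" if y: "1 \<le> y" "y \<le> p" for y
    proof (cases "y = Min S")
      case True
      then show ?thesis using Min_in_S chain_sub[OF chainS] by blast
    next
      case False
      then have "y < m" using y m sp by (cases "Min S = p") auto
      then have yY: "y \<in> shift p X S" using y shift_eq by simp
      \<comment> \<open>If \<open>y\<close> came from the start \<open>y + p\<close>, then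
        \<open>Min S < y\<close>, so the vacated place \<open>Min S\<close> lies in the initial run
        and was refilled from \<open>Min S + p\<close>. But the starts \<open>Min S + p\<close> and
        \<open>y + p\<close> are less than \<open>p\<close> apart.\<close>
      have "y \<notin> (\<lambda>s. s - p) ` S"
      proof
        assume "y \<in> (\<lambda>s. s - p) ` S"
        then obtain s where s: "s \<in> S" "s = y + p" by auto
        then have "Min S + p \<le> s" using above_Min[of s] sp y by auto
        then have lt: "Min S < y" using s False by auto
        then have "Min S \<in> shift p X S" using Min_pos \<open>y < m\<close> shift_eq by simp
        then obtain s' where "s' \<in> S" "s' = Min S + p" using Min_in_S by (auto simp: shift_def)
        then show False using chain_sep[OF chainS, of s' s] s lt y Min_pos by auto
      qed
      then show ?thesis using yY by (auto simp: shift_def)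
    qed
    then have "{1..<1+p} \<subseteq> X" by auto
    then show False using assms by (auto simp: run_free_def)
  qed
qed

text \<open>\<open>R\<close> is, up to translation by \<open>m\<close>, the part above
  \<open>m\<close> of the chain \<open>T\<close> of the untruncated shift, and \<open>T\<close> has
  as many elements as \<open>S\<close>. Hence \<open>a - a'\<close> equals
  \<open>p * card T0 + min p (Min S) - b'\<close>, with \<open>T0\<close> the starts lost and
  \<open>b'\<close> the length of the last segment of \<open>Z\<close>; it remains to bound
  \<open>Min S\<close> and \<open>b'\<close> against \<open>m\<close>.\<close>

lemma size_drop_bounds:
  assumes "run_free p X" "chain p Z R"
  defines "a \<equiv> sum (min p) S" and "a' \<equiv> sum (min p) R"
  shows "m + chain_eps p a' \<le> a - a'" "a - a' < p + m + chain_eps p a'"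
proof -
  have mp: "m \<le> p" using length_drop_bounds[OF assms(1)] by (auto simp: chain_eps_def split: if_splits)
  obtain T where T: "chain p (shift p X S) T" using chain_exists[OF fin_shift] p2 by fastforce
  note T' = next_chain[OF T]
  define Q where "Q = {x\<in>T. m < x}"
  define T0 where "T0 = {x\<in>T. x \<le> m}"
  have Q: "chain p ((\<lambda>z. z + m) ` Z) Q" using chain_restrict_above[OF T, of m] unfolding shift_above Q_def .
  have finZ: "finite ((\<lambda>z. z + m) ` Z)" using fin_shift unfolding shift_eq by simp
  have QR: "Q = (\<lambda>z. z + m) ` R" using chain_unique[OF Q chain_translate[OF assms(2)] finZ] .
  have a': "a' = (\<Sum>x\<in>Q. min p (x - m))" unfolding QR a'_def by (subst sum.reindex) (auto simp: inj_on_def)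
  have finQ: "finite Q" using T' by (simp add: Q_def)
  \<comment> \<open>As \<open>T\<close> lies above \<open>Min S - p\<close> and is \<open>p\<close>-separated, at most two of its elements are lost below \<open>m\<close>;
    the cases below are \<open>card T0 = 0, 1, 2\<close>.\<close>
  have cT: "card S = card T0 + card Q"
  proof -
    have "T = T0 \<union> Q" "T0 \<inter> Q = {}" by (auto simp: T0_def Q_def)
    then show ?thesis using card_Un_disjoint[of T0 Q] T' finQ by (metis finite_Un)
  qed
  \<comment> \<open>For empty \<open>Q\<close> the value \<open>p\<close> makes
    \<open>p * (card Q - 1) + b'\<close> equal to 0, so that one formula for \<open>a'\<close>
    serves both cases.\<close>
  define b' where "b' = (if Q = {} then p else min p (Min Q - m))"
  have MinQ: "Min Q \<in> T" "m < Min Q" if "Q \<noteq> {}" using Min_in[OF finQ that] by (auto simp: Q_def)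
  have b'1: "1 \<le> b'" "b' \<le> p" using MinQ(2) p2 by (fastforce simp: b'_def)+
  have a'b: "a' = p * (int (card Q) - 1) + b'"
  proof (cases "Q = {}")
    case False
    then show ?thesis using sum_min_sep[OF finQ False chain_sep[OF Q], of m] a'
      by (auto simp: b'_def Q_def)
  qed (simp add: a' b'_def)
  have eps': "chain_eps p a' = (if b' = p then 0 else 1)"
    unfolding a'b chain_eps_def using dvd_full_windows[OF b'1] by simp
  have D: "a - a' = p * int (card T0) + min p (Min S) - b'"
    unfolding a'b a_def window_sum_pos cT by (simp add: algebra_simps)
  have T_pos: "1 \<le> t" if "t \<in> T" "t \<noteq> Min S - p" for t
    using shift_above_lower[of 1 t] posX that chain_sub[OF T] by blast
  have T0_small: "1 \<le> m \<and> t < m" if "t \<in> T0" for t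
  proof -
    have t: "t \<in> shift p X S" "t \<le> m" using that chain_sub[OF T] by (auto simp: T0_def)
    then show ?thesis using m_pos_iff posZ m0 p2 unfolding shift_eq by (fastforce split: if_splits)
  qed
  have sepT: "s + p \<le> t" if "s \<in> T" "t \<in> T" "s < t" for s t using chain_sep[OF T that] .
  have "m + chain_eps p a' \<le> a - a' \<and> a - a' < p + m + chain_eps p a'"
  proof (cases "T0 = {}")
    case True
    then have "T = Q" by (auto simp: T0_def Q_def)
    then have "Q \<noteq> {}" "Min Q < Min S" using T'(4) finQ by auto (metis Min_le order_le_less_trans)
    then show ?thesis using D eps' b'1 MinQ m_pos_iff True m0 mp by (auto simp: b'_def)
  next
    case False
    have finT0: "finite T0" using T' by (simp add: T0_def)
    define t0 where "t0 = Min T0"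
    have t0: "t0 \<in> T0" "t0 \<in> T" "\<And>t. t \<in> T0 \<Longrightarrow> t0 \<le> t"
      using finT0 False Min_in[OF finT0 False] by (auto simp: t0_def T0_def)
    have m1: "1 \<le> m" "t0 < m" using T0_small[OF t0(1)] by auto
    then have sp: "Min S \<le> p" using m_pos_iff by simp
    have t0s: "t0 < Min S" "Min S - p \<le> t0" using T'(3)[OF t0(2)] T'(4) t0(3) m1
      by (auto simp: T0_def) (metis order_le_less_trans linorder_not_le order_less_trans order_less_imp_le)
    have inY: "y \<in> shift p X S" if "1 \<le> y" "y < m" for y using that by (simp add: shift_eq)
    show ?thesis
    proof (cases "T0 = {t0}")
      case True
      \<comment> \<open>A bead of the initial run that no start in \<open>Q\<close> can cover must
        be covered by \<open>t0\<close>, the only other start, and \<open>t0 < Min S\<close>. It is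
        applied to the top \<open>m - 1\<close> of the run and to \<open>Min S\<close>.\<close>
      have only: "y < Min S" if "1 \<le> y" "y < m" "Q = {} \<or> y + p \<le> Min Q" for y
      proof -
        have "y \<in> shift p X S" using inY that by blast
        then obtain t where t: "t \<in> T" "y \<le> t" "t < y + p" using chain_cover[OF T] by blast
        have "t \<notin> Q" using that(3) t(3) Min_le[OF finQ, of t] by (cases "t \<in> Q") auto
        then have "t \<in> T0" using t(1) by (simp add: T0_def Q_def)
        then have "t = t0" using True by blast
        then show ?thesis using t t0s by simp
      qed
      have only': "Q = {} \<or> m - 1 + p \<le> Min Q \<Longrightarrow> m \<le> Min S" using only[of "m - 1"] m1 Min_pos by (cases "m = 1") auto
      show ?thesis
      proof (cases "Q = {}")
        case Q0: True
        then show ?thesis using D eps' True sp m1 only' by (simp add: b'_def)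
      next
        case False
        have q: "Min S \<le> Min Q" using sepT[OF t0(2) MinQ(1)[OF False]] MinQ(2)[OF False] m1 t0s by auto
        \<comment> \<open>Otherwise \<open>Min S\<close> would itself be a bead of the initial run
          out of reach of \<open>Q\<close>, and \<open>only\<close> would give
          \<open>Min S < Min S\<close>.\<close>
        have "Min Q + 1 \<le> p + Min S" if "Min Q < m + p"
          using only[of "Min S"] that Min_pos by linarith
        then show ?thesis using D eps' True sp m1 only' q False MinQ(2)[OF False] by (auto simp: b'_def min_def)
      qed
    next
      case F2: False
      define t1 where "t1 = Min (T0 - {t0})"
      have ne: "T0 - {t0} \<noteq> {}" using F2 t0 by blast
      have t1: "t1 \<in> T0" "t1 \<noteq> t0" "\<And>t. t \<in> T0 \<Longrightarrow> t \<noteq> t0 \<Longrightarrow> t1 \<le> t"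
        using finT0 Min_in[OF _ ne] by (auto simp: t1_def)
      have t01: "t0 < t1" using t0(3)[OF t1(1)] t1(2) by simp
      have t1T: "t1 \<in> T" using t1 by (simp add: T0_def)
      have t1s: "Min S \<le> t1" using sepT[OF t0(2) t1T t01] t0s by simp
      have t1m: "t1 < m" using T0_small[OF t1(1)] by simp
      have "T0 = {t0, t1}"
      proof (rule ccontr)
        assume "T0 \<noteq> {t0, t1}"
        then obtain t2 where t2: "t2 \<in> T0" "t2 \<noteq> t0" "t2 \<noteq> t1" using t0(1) t1(1) by blast
        then have "t1 < t2" using t1(3) by force
        moreover have "t2 \<in> T" using t2 by (simp add: T0_def)
        ultimately have "t1 + p \<le> t2" using sepT t1T by blast
        then show False using T0_small[OF t2(1)] t1s mp Min_pos by simp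
      qed
      then have c2: "card T0 = 2" using t01 by simp
      show ?thesis
      proof (cases "Q = {}")
        case True
        then show ?thesis using D eps' c2 sp mp t1s t1m p2 Min_pos by (simp add: b'_def)
      next
        case False
        have "t1 + p \<le> Min Q" using sepT[OF t1T MinQ(1)[OF False]] MinQ(2)[OF False] t1m by auto
        then show ?thesis using D eps' c2 sp mp t1s t1m p2 b'1 Min_pos False by (auto simp: b'_def min_def split: if_splits)
      qed
    qed
  qed
  then show "m + chain_eps p a' \<le> a - a'" "a - a' < p + m + chain_eps p a'" by auto
qed

end

text \<open>For \<open>m = 0\<close> nothing was truncated. For positive \<open>m\<close> the least
  start lies between 1 and \<open>p\<close>, so the node count modulo \<open>p\<close> determines
  it. Then the untruncated shifts agree.\<close>

lemma mullineux_step_inj: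
  assumes "mullineux_step p X S m Z" "mullineux_step p X' S' m Z"
    and "sum (min p) S mod p = sum (min p) S' mod p"
  shows "X = X'"
proof -
  interpret A: mullineux_step p X S m Z by fact
  interpret B: mullineux_step p X' S' m Z by fact
  have "Min S = Min S'" if "1 \<le> m"
  proof -
    have l: "1 \<le> Min S" "Min S \<le> p" "1 \<le> Min S'" "Min S' \<le> p"
      using that A.m_pos_iff B.m_pos_iff A.Min_pos B.Min_pos by auto
    have "p dvd (sum (min p) S - sum (min p) S')" using assms(3) by (simp add: mod_eq_dvd_iff)
    then have "p dvd p * (int (card S) - int (card S')) + (Min S - Min S')"
      using l by (simp add: A.window_sum_pos B.window_sum_pos algebra_simps)
    then have "p dvd Min S - Min S'" by (simp add: dvd_add_right_iff)
    then show ?thesis using l zdvd_not_zless[of "Min S - Min S'" p] zdvd_not_zless[of "Min S' - Min S" p]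
      by (metis diff_gt_0_iff_gt dvd_diff_commute linorder_neqE_linordered_idom diff_less_eq less_add_one
          order_less_le_trans zle_add1_eq_le add.commute add_strict_mono)
  qed
  then have "shift p X S = shift p X' S'" unfolding A.shift_eq B.shift_eq by auto
  then show ?thesis using chain_inj[OF A.chainS B.chainS A.finX B.finX] A.p2 by simp
qed

text \<open>Reconstruct the untruncated shift, guided by \<open>shift_eq\<close>, and raise its
  mirrored chain by \<open>p\<close>. The bounds on \<open>m\<close> are what keeps the result free
  of runs, so they are exactly the admissible row drops.\<close>

lemma mullineux_step_exists:
  assumes p: "2 \<le> p" and Z: "finite Z" "\<And>z. z \<in> Z \<Longrightarrow> 1 \<le> z" "run_free p Z"
    and m: "chain_eps p a \<le> m" "m < p + chain_eps p a" "1 \<le> m \<or> Z \<noteq> {}"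
  obtains X S where "mullineux_step p X S m Z" "run_free p X" "sum (min p) S mod p = a mod p"
    "int (card X) = m + int (card Z)"
proof -
  have m0: "0 \<le> m" using m(1) by (auto simp: chain_eps_def split: if_splits)
  \<comment> \<open>The representative of \<open>a\<close> modulo \<open>p\<close> between 1 and
    \<open>p\<close>: the intended value of \<open>Min S\<close> when a bead was truncated.\<close>
  define b where "b = (if p dvd a then p else a mod p)"
  have b: "1 \<le> b" "b \<le> p" "b mod p = a mod p" "b = p \<longleftrightarrow> p dvd a"
  proof -
    have "0 \<le> a mod p" and lt: "a mod p < p" using p by auto
    moreover have "0 < a mod p" if "\<not> p dvd a"
      using that p by (simp add: dvd_eq_mod_eq_0 order_less_le)
    ultimately have "b = p \<and> p dvd a \<or> b = a mod p \<and> 0 < b \<and> b < p \<and> \<not> p dvd a"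
      using lt unfolding b_def by presburger
    then show "1 \<le> b" "b \<le> p" "b mod p = a mod p" "b = p \<longleftrightarrow> p dvd a" using p by auto
  qed
  define Y where "Y = (\<lambda>z. z + m) ` Z \<union> {1..<m} \<union> (if 1 \<le> m then {b - p} else {})"
  have finY: "finite Y" using Z by (simp add: Y_def)
  obtain U where U: "up_chain p Y U" using up_chain_exists[OF finY] p by fastforce
  define X where "X = (Y - U) \<union> (\<lambda>u. u + p) ` U"
  define S where "S = (\<lambda>u. u + p) ` U"
  have c: "chain p X S" and sh: "shift p X S = Y"
    using chain_of_up_chain[OF U] p by (auto simp: X_def S_def)
  have finU: "finite U" using U finY finite_subset by (auto simp: up_chain_def)
  have finX: "finite X" using finU finY by (simp add: X_def)
  have neY: "Y \<noteq> {}" using m(3) by (auto simp: Y_def)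
  have neX: "X \<noteq> {}" using sh neY c by (auto simp: shift_def chain_def)
  interpret removal p X S using p finX neX c by unfold_locales
  have MinY: "Min S - p = Min Y"
    using Min_shift_in shift_lower finY unfolding sh by (intro Min_eqI[symmetric]) auto
  have lowY: "1 \<le> m \<Longrightarrow> Min Y = b - p"
    using b Z m0 finY by (intro Min_eqI) (fastforce simp: Y_def)+
  have posX: "1 \<le> x" if "x \<in> X" for x
  proof (cases "x \<in> S")
    case True
    then have "Min S \<le> x" using Min_le[OF finS] by simp
    moreover have "1 \<le> Min S"
    proof (cases "1 \<le> m")
      case True
      then show ?thesis using MinY lowY b by simp
    next
      case False
      then have "\<And>y. y \<in> Y \<Longrightarrow> 1 \<le> y" using Z m0 by (fastforce simp: Y_def)
      then show ?thesis using MinY Min_in[OF finY neY] p by force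
    qed
    ultimately show ?thesis by simp
  next
    case False
    then have x: "x \<in> Y" "x \<notin> U" using that by (auto simp: X_def S_def)
    have "x \<noteq> Min Y" using x Min_in_S MinY by (auto simp: S_def)
    then show ?thesis using x lowY Z m0 by (fastforce simp: Y_def split: if_splits)
  qed
  have step: "max 0 ` shift p X S = {0..<m} \<union> (\<lambda>z. z + m) ` Z"
  proof -
    have 1: "max 0 ` (\<lambda>z. z + m) ` Z = (\<lambda>z. z + m) ` Z"
      unfolding image_image using Z m0 by (intro image_cong) (auto simp: max_def, fastforce)
    have 2: "max 0 ` {1..<m} = {1..<m}" by (force simp: max_def image_iff)
    have 3: "1 \<le> m \<Longrightarrow> insert 0 {1..<m} = {0..<m}" by auto
    show ?thesis unfolding sh Y_def image_Un 1 2 using b(2) m0 3 by (auto simp: max_def)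
  qed
  have ms: "mullineux_step p X S m Z"
    using posX Z m0 step by unfold_locales auto
  interpret M: mullineux_step p X S m Z by fact
  have rf: "run_free p X"
    unfolding run_free_def
  proof (rule allI, rule notI)
    fix x assume x: "{x..<x+p} \<subseteq> X"
    have x1: "1 \<le> x" using p by (intro posX subsetD[OF x]) simp
    \<comment> \<open>Place \<open>m\<close> is vacant in \<open>Y\<close>, so a run at positive
      places lies either inside the initial run, which is shorter than \<open>p\<close>, or above
      \<open>m\<close>, where it would be a run of \<open>Z\<close>.\<close>
    have no: False if sub: "{y..<y+p} \<subseteq> Y" and y: "1 \<le> y" for y
    proof (cases "y + p \<le> m")
      case True
      then show ?thesis using m(2) y by (auto simp: chain_eps_def split: if_splits)
    next
      case False
      have "m \<notin> {y..<y+p}"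
      proof
        assume "m \<in> {y..<y+p}"
        then have "m \<in> Y" using sub by blast
        then show False using Z(2)[of 0] b(2) by (auto simp: Y_def split: if_splits)
      qed
      then have my: "m < y" using False by auto
      have "z \<in> Z" if "z \<in> {y-m..<y-m+p}" for z
      proof -
        have "z + m \<in> Y" using that sub by auto
        then show ?thesis using that my b(2) by (auto simp: Y_def split: if_splits)
      qed
      then show False using Z(3) unfolding run_free_def by blast
    qed
    consider "{x..<x+p} \<subseteq> Y" | "{x-1..<x-1+p} \<subseteq> Y"
      using run_unshift[OF c p x] unfolding sh by blast
    then show False
    proof cases
      case 1
      then show False using no x1 by blast
    next
      case 2
      show False
      proof (cases "x = 1")
        case True
        \<comment> \<open>The run obtained by unshifting may start at 0, which is occupied only if
          \<open>b = p\<close>. Then \<open>p\<close> divides \<open>a\<close>, so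
          \<open>m < p\<close>, and the vacant place \<open>m\<close> falls into the run.\<close>
        have "0 \<in> Y" using 2 True p by auto
        then have "1 \<le> m" "b = p" using Z m0 by (auto simp: Y_def split: if_splits) fastforce+
        then have mp: "m < p" using m(2) b(4) by (simp add: chain_eps_def)
        moreover have "m \<in> {x-1..<x-1+p}" using True mp m0 by simp
        then have "m \<in> Y" using 2 by blast
        then show False using Z(2)[of 0] \<open>1 \<le> m\<close> \<open>b = p\<close> by (auto simp: Y_def split: if_splits)
      next
        case False
        then show False using no[of "x - 1"] 2 x1 by simp
      qed
    qed
  qed
  have "sum (min p) S mod p = min p (Min S) mod p"
    by (simp add: M.window_sum_pos)
  also have "min p (Min S) mod p = b mod p"
  proof (cases "1 \<le> m")
    case True
    then show ?thesis using MinY lowY b by simp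
  next
    case False
    then have "p dvd a" using m(1) by (auto simp: chain_eps_def split: if_splits)
    then show ?thesis using False M.m_pos_iff b by simp
  qed
  also note b(3)
  finally have cg: "sum (min p) S mod p = a mod p" .
  have "card X = card Y" using card_shift[OF c finX] by (simp add: sh)
  also have "int (card Y) = m + int (card Z)"
  proof -
    have "card Y = card ((\<lambda>z. z + m) ` Z \<union> {1..<m}) + card (if 1 \<le> m then {b - p} else {})"
      unfolding Y_def using Z b(2) m0 by (intro card_Un_disjoint) (fastforce split: if_splits)+
    also have "card ((\<lambda>z. z + m) ` Z \<union> {1..<m}) = card ((\<lambda>z. z + m) ` Z) + card {1..<m}"
      using Z m0 by (intro card_Un_disjoint) force+
    also have "card ((\<lambda>z. z + m) ` Z) = card Z" by (intro card_image) (auto simp: inj_on_def)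
    finally show ?thesis using m0 by (cases "1 \<le> m") auto
  qed
  finally have "int (card X) = m + int (card Z)" .
  then show thesis using that ms rf cg by blast
qed

section \<open>Effect of a \<open>p\<close>-rim* removal on arm sets\<close>

text \<open>\<open>S\<close> is a chain of arms. A start below \<open>p\<close> is one whose segment reaches the diagonal; the diagonal
  node is then shared by the two halves of the \<open>p\<close>-rim*.\<close>

definition star_eps :: "int \<Rightarrow> int set \<Rightarrow> int" where
  "star_eps p S = (if \<exists>s\<in>S. s < p then 1 else 0)"

definition star_size :: "int \<Rightarrow> int set \<Rightarrow> int" where
  "star_size p S = 2 * (\<Sum>s\<in>S. min p (s + 1)) - star_eps p S"

text \<open>The diagonal hook with arm \<open>x\<close> has length \<open>2 * x + 1\<close>.\<close>

definition bg_free :: "int \<Rightarrow> int set \<Rightarrow> bool" where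
  "bg_free p X \<longleftrightarrow> (\<forall>x\<in>X. \<not> p dvd 2 * x + 1)"

lemma star_size_empty [simp]: "star_size p {} = 0" "star_eps p {} = 0"
  by (simp_all add: star_size_def star_eps_def)

text \<open>\<open>sum_min_sep\<close> with \<open>c = -1\<close>. If the last segment reaches the
  diagonal, its two halves of \<open>Min S + 1\<close> nodes share one node. This already happens at
  \<open>Min S = p - 1\<close>, where the segment is full.\<close>

lemma star_size_chain:
  assumes "chain p X S" "finite X" "S \<noteq> {}" "\<And>x. x \<in> X \<Longrightarrow> 0 \<le> x"
  shows "star_size p S = (if p \<le> Min S then 2 * p * int (card S) else 2 * p * (int (card S) - 1) + 2 * Min S + 1)"
    and "star_eps p S = (if p \<le> Min S then 0 else 1)"
proof -
  have finS: "finite S" using chain_finite assms by blast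
  show e: "star_eps p S = (if p \<le> Min S then 0 else 1)"
    using Min_in[OF finS assms(3)] Min_le[OF finS] unfolding star_eps_def
    by (smt (verit) bexE)
  have "(\<Sum>s\<in>S. min p (s - (-1))) = p * (int (card S) - 1) + min p (Min S - (-1))"
    using sum_min_sep[OF finS assms(3) chain_sep[OF assms(1)], of "-1"] assms(4) chain_sub[OF assms(1)]
    by fastforce
  then have "(\<Sum>s\<in>S. min p (s + 1)) = p * (int (card S) - 1) + min p (Min S + 1)" by simp
  then show "star_size p S = (if p \<le> Min S then 2 * p * int (card S) else 2 * p * (int (card S) - 1) + 2 * Min S + 1)"
    unfolding star_size_def e by (auto simp: algebra_simps)
qed

text \<open>This is where the BG condition acts: the size is either a multiple of
  \<open>2 * p\<close>, or odd and congruent modulo \<open>p\<close> to the hook length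
  \<open>2 * Min S + 1\<close>, which \<open>p\<close> does not divide.\<close>

lemma star_eps_eq:
  assumes "chain p X S" "finite X" "\<And>x. x \<in> X \<Longrightarrow> 0 \<le> x" "bg_free p X"
  shows "chain_eps p (star_size p S) = star_eps p S" "even (star_size p S) \<longleftrightarrow> p dvd star_size p S"
proof -
  have "chain_eps p (star_size p S) = star_eps p S \<and> (even (star_size p S) \<longleftrightarrow> p dvd star_size p S)"
  proof (cases "S = {}")
    case False
    have "Min S \<in> X" using chain_finite[OF assms(1,2)] False chain_sub[OF assms(1)] by simp
    then have "\<not> p dvd 2 * Min S + 1" using assms(4) by (simp add: bg_free_def)
    moreover have "p dvd 2 * p * (int (card S) - 1) + (2 * Min S + 1) \<longleftrightarrow> p dvd 2 * Min S + 1"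
      by (rule dvd_add_right_iff) simp
    ultimately show ?thesis using star_size_chain[OF assms(1,2) False assms(3)]
      by (auto simp: chain_eps_def add.assoc)
  qed (simp add: chain_eps_def)
  then show "chain_eps p (star_size p S) = star_eps p S" "even (star_size p S) \<longleftrightarrow> p dvd star_size p S" by auto
qed

locale star_step = removal +
  fixes Z :: "int set"
  assumes nonnegX: "\<And>x. x \<in> X \<Longrightarrow> 0 \<le> x" and Z: "{y \<in> shift p X S. 0 \<le> y} = Z"
begin

lemma Min_nonneg: "0 \<le> Min S" using nonnegX Min_in_S chain_sub[OF chainS] by blast

lemma shift_eq: "shift p X S = Z \<union> (if Min S < p then {Min S - p} else {})"
proof (rule set_eqI)
  fix y
  show "y \<in> shift p X S \<longleftrightarrow> y \<in> Z \<union> (if Min S < p then {Min S - p} else {})"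
    using shift_above_lower[of 0 y] nonnegX Min_shift_in Z by (cases "y = Min S - p") auto
qed

text \<open>Moving an arm by \<open>p\<close> changes its hook length by
  \<open>2 * p\<close>.\<close>

lemma bg_free_next: "bg_free p X \<Longrightarrow> bg_free p Z"
proof -
  assume h: "bg_free p X"
  have "\<not> p dvd 2 * (s - p) + 1" if "s \<in> X" for s
  proof -
    have "p dvd - 2 * p + (2 * s + 1) \<longleftrightarrow> p dvd 2 * s + 1" by (rule dvd_add_right_iff) simp
    then show ?thesis using h that by (simp add: bg_free_def algebra_simps)
  qed
  then show ?thesis using h chain_sub[OF chainS] unfolding Z[symmetric] bg_free_def shift_def by auto
qed

lemma size_pos: "1 \<le> star_size p S"
  using star_size_chain[OF chainS finX neS nonnegX] Min_nonneg p2 neS finS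
  by (simp add: card_gt_0_iff Suc_le_eq) (smt (verit) card_gt_0_iff mult_less_0_iff mult_pos_pos of_nat_0_less_iff zero_less_mult_iff)

text \<open>At most one start of the next chain is discarded: a negative start is at least
  \<open>Min S - p\<close>, so every later one is at least \<open>Min S\<close>. The two cases are
  settled by comparing \<open>Min S\<close> with \<open>Min R\<close>.\<close>

lemma size_drop_bounds:
  assumes "chain p Z R"
  shows "star_eps p S + star_eps p R \<le> star_size p S - star_size p R"
    "star_size p S - star_size p R < 2 * p + star_eps p S + star_eps p R"
proof -
  obtain T where T: "chain p (shift p X S) T" using chain_exists[OF fin_shift] p2 by fastforce
  note T' = next_chain[OF T]
  have finZ: "finite Z" using fin_shift Z by auto
  have "{y \<in> shift p X S. -1 < y} = Z" using Z by auto
  then have "R = {t\<in>T. -1 < t}"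
    using chain_unique[OF assms _ finZ] chain_restrict_above[OF T, of "-1"] by metis
  then have R: "R = {t\<in>T. 0 \<le> t}" by auto
  have posZ: "z \<in> Z \<Longrightarrow> 0 \<le> z" for z using Z by auto
  define T0 where "T0 = {t\<in>T. t < 0}"
  have finR: "finite R" using T' by (simp add: R)
  have cT: "card S = card T0 + card R"
  proof -
    have "T = T0 \<union> R" "T0 \<inter> R = {}" by (auto simp: T0_def R)
    then show ?thesis using card_Un_disjoint[of T0 R] T' finR by (metis finite_Un)
  qed
  have MinR: "Min R \<in> T" "0 \<le> Min R" if "R \<noteq> {}" using Min_in[OF finR that] by (auto simp: R)
  have sepT: "s + p \<le> t" if "s \<in> T" "t \<in> T" "s < t" for s t using chain_sep[OF T that] .
  note sz = star_size_chain[OF chainS finX neS nonnegX] and szR = star_size_chain[OF assms finZ _ posZ]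
  have "star_eps p S + star_eps p R \<le> star_size p S - star_size p R \<and>
    star_size p S - star_size p R < 2 * p + star_eps p S + star_eps p R"
  proof (cases "T0 = {}")
    case True
    then have RT: "R = T" by (auto simp: T0_def R)
    then have ne: "R \<noteq> {}" "Min R < Min S" using T'(4) finR by auto (metis Min_le order_le_less_trans)
    then show ?thesis using sz szR[OF ne(1)] MinR[OF ne(1)] cT True p2
      by (auto simp: algebra_simps)
  next
    case False
    then obtain t0 where t0: "t0 \<in> T" "t0 < 0" by (auto simp: T0_def)
    have later: "Min S \<le> t" if "t \<in> T" "t0 < t" for t
      using sepT[OF t0(1) that] T'(3)[OF t0(1)] by simp
    have "T0 = {t0}"
    proof -
      have "t = t0" if "t \<in> T0" for t
      proof (rule ccontr)
        assume "t \<noteq> t0"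
        then consider "t < t0" | "t0 < t" by linarith
        then show False
        proof cases
          case 1
          then show ?thesis using sepT[of t t0] T'(3)[of t] t0 that Min_nonneg by (auto simp: T0_def)
        next
          case 2
          then show ?thesis using later[of t] that Min_nonneg by (auto simp: T0_def)
        qed
      qed
      then show ?thesis using False by blast
    qed
    then have c1: "int (card S) = 1 + int (card R)" using cT by simp
    have sp: "Min S < p" using T'(3)[OF t0(1)] t0(2) by simp
    show ?thesis
    proof (cases "R = {}")
      case True
      then show ?thesis using sz c1 sp Min_nonneg by simp
    next
      case False
      have "Min S \<le> Min R" using later[OF MinR(1)[OF False]] MinR(2)[OF False] t0 by simp
      then show ?thesis using sz szR[OF False] c1 sp Min_nonneg MinR[OF False]
        by (auto simp: algebra_simps)
    qed
  qed
  then show "star_eps p S + star_eps p R \<le> star_size p S - star_size p R"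
    "star_size p S - star_size p R < 2 * p + star_eps p S + star_eps p R" by auto
qed

lemma size_mod:
  "star_size p S mod (2 * p) = (if p \<le> Min S then 0 else 2 * Min S + 1)"
  using star_size_chain[OF chainS finX neS nonnegX] Min_nonneg
  by (auto simp: add.assoc)

end

text \<open>The residue modulo \<open>2 * p\<close> is 0 if nothing is discarded, and otherwise the
  odd number \<open>2 * Min S + 1\<close>, which is below \<open>2 * p\<close> and reveals the
  discarded bead.\<close>

lemma star_step_inj:
  assumes "star_step p X S Z" "star_step p X' S' Z"
    and "star_size p S mod (2 * p) = star_size p S' mod (2 * p)"
  shows "X = X'"
proof -
  interpret A: star_step p X S Z by fact
  interpret B: star_step p X' S' Z by fact
  have "p \<le> Min S \<and> p \<le> Min S' \<or> Min S = Min S'"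
    using assms(3) A.Min_nonneg B.Min_nonneg unfolding A.size_mod B.size_mod by (smt (verit))
  then have "shift p X S = shift p X' S'" unfolding A.shift_eq B.shift_eq by auto
  then show ?thesis using chain_inj[OF A.chainS B.chainS A.finX B.finX] A.p2 by simp
qed

lemma star_step_exists:
  assumes p: "2 \<le> p" "odd p" and Z: "finite Z" "\<And>z. z \<in> Z \<Longrightarrow> 0 \<le> z" "bg_free p Z"
    and a: "even a \<longleftrightarrow> p dvd a" "even a \<Longrightarrow> Z \<noteq> {}"
  obtains X S where "star_step p X S Z" "bg_free p X" "star_size p S mod (2 * p) = a mod (2 * p)"
proof -
  define b where "b = (a mod (2 * p)) div 2"
  have b: "0 \<le> b" "b < p" "2 * b + 1 = a mod (2 * p)" "\<not> p dvd 2 * b + 1" if "odd a"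
  proof -
    have m: "0 \<le> a mod (2 * p)" "a mod (2 * p) < 2 * p" using p by auto
    have o: "odd (a mod (2 * p))" using that by (metis dvd_mod_iff dvd_triv_left)
    show "0 \<le> b" "b < p" "2 * b + 1 = a mod (2 * p)" using m o by (auto simp: b_def)
    then show "\<not> p dvd 2 * b + 1" using that a(1) by (metis dvd_mod_iff dvd_triv_right)
  qed
  \<comment> \<open>For odd \<open>a\<close> one bead was discarded: the arm \<open>b\<close> with
    \<open>2 * b + 1\<close> congruent to \<open>a\<close>, pushed to \<open>b - p\<close>. For even
    \<open>a\<close> nothing was lost.\<close>
  define Y where "Y = Z \<union> (if odd a then {b - p} else {})"
  have finY: "finite Y" using Z by (simp add: Y_def)
  obtain U where U: "up_chain p Y U" using up_chain_exists[OF finY] p by fastforce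
  define X where "X = (Y - U) \<union> (\<lambda>u. u + p) ` U"
  define S where "S = (\<lambda>u. u + p) ` U"
  have c: "chain p X S" and sh: "shift p X S = Y"
    using chain_of_up_chain[OF U] p by (auto simp: X_def S_def)
  have finU: "finite U" using U finY finite_subset by (auto simp: up_chain_def)
  have finX: "finite X" using finU finY by (simp add: X_def)
  have neY: "Y \<noteq> {}" using a(2) by (auto simp: Y_def)
  have neX: "X \<noteq> {}" using sh neY c by (auto simp: shift_def chain_def)
  interpret removal p X S using p finX neX c by unfold_locales
  have MinY: "Min S - p = Min Y"
    using Min_shift_in shift_lower finY unfolding sh by (intro Min_eqI[symmetric]) auto
  have lowY: "odd a \<Longrightarrow> Min Y = b - p"
    using b Z finY by (intro Min_eqI) (fastforce simp: Y_def)+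
  have lowY': "even a \<Longrightarrow> 0 \<le> Min Y"
    using Min_in[OF finY neY] Z by (auto simp: Y_def)
  have MinS: "0 \<le> Min S" using MinY lowY lowY' b p by (cases "odd a") auto
  have posX: "0 \<le> x" if "x \<in> X" for x
  proof (cases "x \<in> S")
    case True
    then show ?thesis using Min_le[OF finS] MinS by fastforce
  next
    case False
    then have x: "x \<in> Y" "x \<notin> U" using that by (auto simp: X_def S_def)
    have "x \<noteq> Min Y" using x Min_in_S MinY by (auto simp: S_def)
    then show ?thesis using x lowY Z by (fastforce simp: Y_def split: if_splits)
  qed
  have "{y \<in> shift p X S. 0 \<le> y} = Z" unfolding sh using Z b(2) by (auto simp: Y_def)
  then have ss: "star_step p X S Z" using posX by unfold_locales auto
  interpret M: star_step p X S Z by fact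
  have add_p: "p dvd 2 * (y + p) + 1 \<longleftrightarrow> p dvd 2 * y + 1" for y
  proof -
    have "p dvd 2 * p + (2 * y + 1) \<longleftrightarrow> p dvd 2 * y + 1" by (rule dvd_add_right_iff) simp
    then show ?thesis by (simp add: algebra_simps)
  qed
  have "\<not> p dvd 2 * y + 1" if "y \<in> Y" for y
    using that Z(3) b(4) add_p[of "b - p"] by (auto simp: Y_def bg_free_def split: if_splits)
  moreover have "U \<subseteq> Y" using U by (simp add: up_chain_def)
  ultimately have bg: "bg_free p X" unfolding bg_free_def X_def using add_p by auto
  have "star_size p S mod (2 * p) = a mod (2 * p)"
  proof (cases "odd a")
    case True
    then show ?thesis unfolding M.size_mod using MinY lowY b by simp
  next
    case False
    then have "2 * p dvd a" using a(1) p(2) by (intro divides_mult) auto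
    then show ?thesis unfolding M.size_mod using False MinY lowY' by auto
  qed
  then show thesis using that ss bg by blast
qed

section \<open>Diagrams, rims and segments\<close>

lemma part_antimono: "is_partition lam \<Longrightarrow> 1 \<le> i \<Longrightarrow> i \<le> j \<Longrightarrow> part lam j \<le> part lam i"
  unfolding is_partition_def part_def
  by (cases "i = j") (auto simp: sorted_wrt_iff_nth_less)

lemma part_pos_iff: "is_partition lam \<Longrightarrow> 0 < part lam i \<longleftrightarrow> 1 \<le> i \<and> i \<le> length lam"
  by (auto simp: is_partition_def part_def)

lemma mem_diagram: "(i, j) \<in> diagram lam \<longleftrightarrow> 1 \<le> i \<and> 1 \<le> j \<and> j \<le> part lam i"
  by (simp add: diagram_def)

lemma part_eq_card: "1 \<le> i \<Longrightarrow> part lam i = card {j. (i, j) \<in> diagram lam}"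
proof -
  assume "1 \<le> i"
  then have "{j. (i, j) \<in> diagram lam} = {1..part lam i}" by (auto simp: mem_diagram)
  then show ?thesis by simp
qed

lemma diagram_inj:
  assumes "is_partition lam" "is_partition mu" "diagram lam = diagram mu"
  shows "lam = mu"
proof -
  have p: "part lam i = part mu i" if "1 \<le> i" for i using part_eq_card assms(3) that by metis
  have "i \<le> length lam \<longleftrightarrow> i \<le> length mu" if "1 \<le> i" for i
    using p[OF that] part_pos_iff[OF assms(1), of i] part_pos_iff[OF assms(2), of i] that by simp
  then have len: "length lam = length mu"
    by (metis Suc_leI le_antisym le_refl length_0_conv length_greater_0_conv linorder_not_le nat_le_linear not_less_eq_eq One_nat_def zero_less_Suc)
  show ?thesis
  proof (rule nth_equalityI[OF len])
    fix i assume "i < length lam"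
    then show "lam ! i = mu ! i" using p[of "Suc i"] len by (simp add: part_def)
  qed
qed

lemma part_1_pos: "is_partition lam \<Longrightarrow> lam \<noteq> [] \<Longrightarrow> 1 \<le> part lam 1"
  using part_pos_iff[of lam 1] by (simp add: Suc_le_eq)

lemma initial_segment:
  assumes "finite A" "\<And>i. i \<in> A \<Longrightarrow> 1 \<le> i" "\<And>i j. i \<in> A \<Longrightarrow> 1 \<le> j \<Longrightarrow> j \<le> i \<Longrightarrow> j \<in> A"
  shows "i \<in> A \<longleftrightarrow> 1 \<le> (i::nat) \<and> i \<le> card A"
proof (cases "A = {}")
  case False
  have M: "Max A \<in> A" using assms(1) False by simp
  have "A = {1..Max A}"
  proof (intro equalityI subsetI)
    fix i assume "i \<in> A"
    then show "i \<in> {1..Max A}" using assms(1,2) by simp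
  next
    fix i assume "i \<in> {1..Max A}"
    then show "i \<in> A" using assms(3)[OF M] by simp
  qed
  moreover from this have "card A = Max A" by (metis card_atLeastAtMost diff_Suc_1 One_nat_def)
  ultimately show ?thesis by (metis atLeastAtMost_iff)
qed simp

definition young :: "(nat \<times> nat) set \<Rightarrow> bool" where
  "young D \<longleftrightarrow> finite D \<and> (\<forall>i j. (i, j) \<in> D \<longrightarrow> 1 \<le> i \<and> 1 \<le> j) \<and>
     (\<forall>i j. 1 \<le> i \<longrightarrow> (Suc i, j) \<in> D \<longrightarrow> (i, j) \<in> D) \<and>
     (\<forall>i j. 1 \<le> j \<longrightarrow> (i, Suc j) \<in> D \<longrightarrow> (i, j) \<in> D)"

lemma youngD:
  assumes "young D"
  shows "finite D" "(i, j) \<in> D \<Longrightarrow> 1 \<le> i" "(i, j) \<in> D \<Longrightarrow> 1 \<le> j"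
    "(Suc i, j) \<in> D \<Longrightarrow> 1 \<le> i \<Longrightarrow> (i, j) \<in> D" "(i, Suc j) \<in> D \<Longrightarrow> 1 \<le> j \<Longrightarrow> (i, j) \<in> D"
  using assms unfolding young_def by blast+

lemma young_le:
  assumes "young D" "(i, j) \<in> D" "1 \<le> i'" "i' \<le> i" "1 \<le> j'" "j' \<le> j"
  shows "(i', j') \<in> D"
proof -
  have 1: "(i', j) \<in> D" using assms(4,2,3)
  proof (induction rule: inc_induct)
    case (step n)
    then show ?case using youngD(4)[OF assms(1), of n j] by simp
  qed
  show ?thesis using assms(6) 1 assms(5)
  proof (induction rule: inc_induct)
    case (step n)
    then show ?case using youngD(5)[OF assms(1), of i' n] by simp
  qed
qed

lemma young_diagram:
  assumes "is_partition lam" shows "young (diagram lam)"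
proof -
  have "diagram lam \<subseteq> {1..length lam} \<times> {1..part lam 1}"
    using part_pos_iff[OF assms] part_antimono[OF assms, of 1]
    by (auto simp: mem_diagram) (metis One_nat_def Suc_le_eq le_trans order_less_le_trans)+
  then have "finite (diagram lam)" by (rule finite_subset) simp
  moreover have "part lam (Suc i) \<le> part lam i" if "1 \<le> i" for i
    using part_antimono[OF assms that, of "Suc i"] by simp
  ultimately show ?thesis unfolding young_def mem_diagram by fastforce
qed

lemma young_row:
  assumes "young D" shows "(i, j) \<in> D \<longleftrightarrow> 1 \<le> i \<and> 1 \<le> j \<and> j \<le> row_len D i"
proof (cases "1 \<le> i")
  case True
  have "finite {j. (i, j) \<in> D}"
    by (rule finite_surj[OF youngD(1)[OF assms], of _ snd]) force
  then have "j \<in> {j. (i, j) \<in> D} \<longleftrightarrow> 1 \<le> j \<and> j \<le> card {j. (i, j) \<in> D}"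
    using youngD(3)[OF assms] young_le[OF assms] True by (intro initial_segment) blast+
  then show ?thesis using True by (simp add: row_len_def)
next
  case False
  then show ?thesis using youngD(2)[OF assms] by blast
qed

lemma row_len_antimono: "young D \<Longrightarrow> 1 \<le> i \<Longrightarrow> i \<le> j \<Longrightarrow> row_len D j \<le> row_len D i"
proof (cases "row_len D j = 0")
  case False
  assume h: "young D" "1 \<le> i" "i \<le> j"
  then have "(j, row_len D j) \<in> D" using young_row[OF h(1), of j "row_len D j"] False by simp
  then have "(i, row_len D j) \<in> D" using young_le[OF h(1)] h False by simp
  then show ?thesis using young_row[OF h(1)] by simp
qed simp

lemma row_len_0:
  assumes "young D" "card D < i" shows "row_len D i = 0"
proof (rule ccontr)
  assume "row_len D i \<noteq> 0"
  then have "(i, 1) \<in> D" using young_row[OF assms(1)] assms(2) by auto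
  then have "(\<lambda>k. (k, 1)) ` {1..i} \<subseteq> D" using young_le[OF assms(1)] by auto
  then have "card ((\<lambda>k. (k, 1::nat)) ` {1..i}) \<le> card D" using youngD(1)[OF assms(1)] by (intro card_mono)
  then show False using assms(2) by (subst (asm) card_image) (auto simp: inj_on_def)
qed

text \<open>The row lengths are listed up to row \<open>card D + 1\<close>, which is empty by
  \<open>row_len_0\<close>. So \<open>takeWhile\<close> stops at a zero row inside the list, and all
  later rows are empty by monotonicity.\<close>

lemma of_diagram_young:
  assumes "young D" shows "is_partition (of_diagram D)" "diagram (of_diagram D) = D"
proof -
  define L where "L = map (row_len D) [1..<card D + 2]"
  define l where "l = length (of_diagram D)"
  have tw: "of_diagram D = take l L" unfolding l_def of_diagram_def L_def by (metis takeWhile_eq_take)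
  have L: "length L = card D + 1" "\<And>k. k < card D + 1 \<Longrightarrow> L ! k = row_len D (Suc k)"
    by (simp_all add: L_def del: upt_Suc)
  have pos: "\<forall>x\<in>set (of_diagram D). 0 < x" unfolding of_diagram_def by (auto dest: set_takeWhileD)
  have ll: "l < length L"
  proof (rule ccontr)
    assume "\<not> l < length L"
    then have "of_diagram D = L" using tw by simp
    then have "0 < L ! card D" using pos L by (metis less_add_one nth_mem)
    then show False using L(2)[of "card D"] row_len_0[OF assms] by simp
  qed
  then have "L ! l = 0" using nth_length_takeWhile[of "\<lambda>x. 0 < x" L] by (simp add: l_def of_diagram_def L_def)
  then have z: "row_len D (Suc l) = 0" using L ll by simp
  have nth: "of_diagram D ! k = row_len D (Suc k)" if "k < l" for k using that tw L ll by simp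
  have "sorted_wrt (\<ge>) (of_diagram D)"
    unfolding sorted_wrt_iff_nth_less using nth row_len_antimono[OF assms] by (auto simp: l_def[symmetric])
  then show "is_partition (of_diagram D)" using pos by (simp add: is_partition_def)
  have part: "part (of_diagram D) i = row_len D i" if "1 \<le> i" for i
  proof (cases "i \<le> l")
    case True
    then show ?thesis using nth[of "i - 1"] that by (simp add: part_def l_def)
  next
    case False
    then have "row_len D i = 0" using z row_len_antimono[OF assms, of "Suc l" i] by simp
    then show ?thesis using False by (simp add: part_def l_def)
  qed
  show "diagram (of_diagram D) = D"
    using young_row[OF assms] part by (auto simp: diagram_def)
qed

section \<open>Contents, beads and the rim path\<close>

definition content :: "nat \<times> nat \<Rightarrow> int" where
  "content x = int (snd x) - int (fst x)"

definition bead :: "nat list \<Rightarrow> nat \<Rightarrow> int" where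
  "bead lam i = int (part lam i) - int i"

definition beads :: "nat list \<Rightarrow> int set" where
  "beads lam = bead lam ` {1..length lam}"

lemma content_pair [simp]: "content (i, j) = int j - int i"
  by (simp add: content_def)

lemma bead_less: "is_partition lam \<Longrightarrow> 1 \<le> i \<Longrightarrow> i < j \<Longrightarrow> bead lam j < bead lam i"
  using part_antimono[of lam i j] by (simp add: bead_def)

lemma bead_le: "is_partition lam \<Longrightarrow> 1 \<le> i \<Longrightarrow> i \<le> j \<Longrightarrow> bead lam j \<le> bead lam i"
  using part_antimono[of lam i j] by (simp add: bead_def)

lemma bead_less_iff: "is_partition lam \<Longrightarrow> 1 \<le> i \<Longrightarrow> 1 \<le> j \<Longrightarrow> bead lam j < bead lam i \<longleftrightarrow> i < j"
  using bead_less[of lam i j] bead_le[of lam j i] by force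

lemma finite_beads [simp]: "finite (beads lam)" by (simp add: beads_def)

lemma mem_rim: "(i, j) \<in> rim lam \<longleftrightarrow> (i, j) \<in> diagram lam \<and> (Suc i, Suc j) \<notin> diagram lam"
  by (auto simp: rim_def)

text \<open>Of two diagram nodes on one diagonal, the upper one has its lower right neighbour in the
  diagram. Rim nodes may therefore be named by their contents.\<close>

lemma rim_unique:
  assumes "is_partition lam" "x \<in> rim lam" "y \<in> rim lam" "content x = content y"
  shows "x = y"
proof -
  have no: False if h: "(i, j) \<in> rim lam" "(i', j') \<in> rim lam" "int j - int i = int j' - int i'" "i < i'" for i j i' j'
  proof -
    have "(i', j') \<in> diagram lam" "Suc i \<le> i'" "Suc j \<le> j'" using h by (auto simp: mem_rim)
    then have "(Suc i, Suc j) \<in> diagram lam" using young_le[OF young_diagram[OF assms(1)]] by simp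
    then show False using h(1) by (simp add: mem_rim)
  qed
  obtain i j i' j' where "x = (i, j)" "y = (i', j')" by fastforce
  then show ?thesis using no[of i j i' j'] no[of i' j' i j] assms by (cases i i' rule: linorder_cases) auto
qed

lemma rim_content:
  assumes "is_partition lam" "x \<in> rim lam"
  shows "1 - int (length lam) \<le> content x" "content x \<le> int (part lam 1) - 1"
proof -
  obtain i j where x: "x = (i, j)" by fastforce
  then have d: "1 \<le> i" "1 \<le> j" "j \<le> part lam i" using assms(2) by (auto simp: mem_rim mem_diagram)
  then have "i \<le> length lam" using part_pos_iff[OF assms(1), of i] by simp
  moreover have "part lam i \<le> part lam 1" using part_antimono assms(1) d(1) by simp
  ultimately show "1 - int (length lam) \<le> content x" "content x \<le> int (part lam 1) - 1" using d x by auto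
qed

lemma row_end_rim:
  assumes "is_partition lam" "1 \<le> i" "i \<le> length lam"
  shows "(i, part lam i) \<in> rim lam"
  using part_antimono[OF assms(1,2), of "Suc i"] part_pos_iff[OF assms(1), of i] assms
  by (simp add: mem_rim mem_diagram)

lemma length_rim_list [simp]: "length (rim_list lam) = part lam 1 + length lam - 1"
  by (simp add: rim_list_def)

lemma rim_list_nth:
  assumes lam: "is_partition lam" "lam \<noteq> []" and "k < length (rim_list lam)"
  shows "rim_list lam ! k \<in> rim lam" "content (rim_list lam ! k) = int (part lam 1) - 1 - int k"
proof -
  let ?f = "\<lambda>k. (rim_step (diagram lam) ^^ k) (1, part lam 1)"
  have "?f k \<in> rim lam \<and> content (?f k) = int (part lam 1) - 1 - int k"
    using assms(3)
  proof (induction k)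
    case 0
    have "(1, part lam 1) \<in> rim lam" using lam by (intro row_end_rim) (simp_all add: Suc_le_eq)
    then show ?case by simp
  next
    case (Suc k)
    obtain i j where x: "?f k = (i, j)" by fastforce
    then have r: "(i, j) \<in> rim lam" "int j - int i = int (part lam 1) - 1 - int k" using Suc by auto
    have step: "?f (Suc k) = rim_step (diagram lam) (i, j)" using x by simp
    have "rim_step (diagram lam) (i, j) \<in> rim lam \<and>
        content (rim_step (diagram lam) (i, j)) = int (part lam 1) - 1 - int (Suc k)"
    proof (cases "(Suc i, j) \<in> diagram lam")
      case True
      have "(Suc (Suc i), Suc j) \<notin> diagram lam"
      proof
        assume "(Suc (Suc i), Suc j) \<in> diagram lam"
        then have "(Suc i, Suc j) \<in> diagram lam" using young_le[OF young_diagram[OF lam(1)]] by simp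
        then show False using r by (simp add: mem_rim)
      qed
      then show ?thesis using True r unfolding rim_step_def by (simp add: mem_rim)
    next
      case False
      have d: "1 \<le> i" "1 \<le> j" "j \<le> part lam i" using r by (auto simp: mem_rim mem_diagram)
      \<comment> \<open>In column 1 with nothing below, the path has reached its end, contrary to
        the bound on \<open>k\<close>; hence \<open>j - 1\<close> is not truncated to a column
        0.\<close>
      have "j \<noteq> 1"
      proof
        assume "j = 1"
        then have "part lam (Suc i) = 0" using False by (simp add: mem_diagram)
        then have "length lam \<le> i" using part_pos_iff[OF lam(1), of "Suc i"] by simp
        moreover have "i \<le> length lam" using d part_pos_iff[OF lam(1), of i] by simp
        ultimately show False using r(2) \<open>j = 1\<close> Suc.prems by simp
      qed
      then have "(i, j - 1) \<in> rim lam" using d False by (auto simp: mem_rim mem_diagram)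
      then show ?thesis using False r d unfolding rim_step_def by (simp add: of_nat_diff)
    qed
    then show ?case unfolding step .
  qed
  then show "rim_list lam ! k \<in> rim lam" "content (rim_list lam ! k) = int (part lam 1) - 1 - int k"
    using assms(3) by (simp_all add: rim_list_def)
qed

lemma rim_list_index:
  assumes lam: "is_partition lam" "lam \<noteq> []" and "x \<in> rim lam"
  defines "k \<equiv> nat (int (part lam 1) - 1 - content x)"
  shows "k < length (rim_list lam)" "rim_list lam ! k = x"
proof -
  have k: "int k = int (part lam 1) - 1 - content x" using rim_content[OF lam(1) assms(3)] by (simp add: k_def)
  show lt: "k < length (rim_list lam)" using k rim_content[OF lam(1) assms(3)] lam(2) part_1_pos[OF lam]
    by simp
  show "rim_list lam ! k = x"
    using rim_unique[OF lam(1) _ assms(3)] rim_list_nth[OF lam lt] k by simp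
qed

lemma rim_exists:
  assumes lam: "is_partition lam" "lam \<noteq> []" and "1 - int (length lam) \<le> c" "c \<le> int (part lam 1) - 1"
  obtains x where "x \<in> rim lam" "content x = c"
proof -
  have "nat (int (part lam 1) - 1 - c) < length (rim_list lam)" using assms part_1_pos[OF lam] by simp
  from rim_list_nth[OF lam this] that show thesis using assms by simp
qed

text \<open>Labels are translated into contents, label \<open>k\<close> having content
  \<open>part lam 1 - 1 - k\<close>. The point is that the row rule of the p-segments selects the
  next start of the greedy chain. The label \<open>s\<close> grows strictly, so fuel covering the
  remaining labels suffices.\<close>

lemma psegs_eq:
  assumes lam: "is_partition lam" "lam \<noteq> []" and p: "0 < p" and S: "chain (int p) (beads lam) S"
  shows "s < length (rim_list lam) \<Longrightarrow> int (part lam 1) - 1 - int s \<in> S \<Longrightarrow> length (rim_list lam) \<le> f + s \<Longrightarrow>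
    psegs f p (length lam) (rim_list lam) s =
    {k. k < length (rim_list lam) \<and> (\<exists>t\<in>S. t \<le> int (part lam 1) - 1 - int s \<and>
          t - int p < int (part lam 1) - 1 - int k \<and> int (part lam 1) - 1 - int k \<le> t)}"
proof (induction f arbitrary: s)
  case 0
  then show ?case by simp
next
  case (Suc f)
  let ?R = "rim_list lam"
  let ?n = "length ?R"
  let ?c = "\<lambda>k::nat. int (part lam 1) - 1 - int k"
  define e where "e = min (s + p) ?n"
  have e: "s < e" "e \<le> ?n" "e \<le> s + p" using Suc.prems p by (auto simp: e_def)
  obtain i j where x: "?R ! (e - 1) = (i, j)" by fastforce
  have r: "(i, j) \<in> rim lam" "int j - int i = ?c (e - 1)"
    using rim_list_nth[OF lam, of "e - 1"] e x by auto
  have d: "1 \<le> i" "1 \<le> j" "j \<le> part lam i" "i \<le> length lam"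
    using r part_pos_iff[OF lam(1), of i] by (auto simp: mem_rim mem_diagram)
  have ci: "?c (e - 1) \<le> bead lam i" using d r by (simp add: bead_def)
  have ce: "?c (e - 1) = ?c e + 1" using e by (simp add: of_nat_diff)
  have first: "k \<in> {s..<e} \<longleftrightarrow> k < ?n \<and> ?c s - int p < ?c k \<and> ?c k \<le> ?c s" for k
    by (auto simp: e_def)
  \<comment> \<open>A later start is at least \<open>p\<close> lower, hence below the last content
    of the current segment, which is at most the bead of row \<open>i\<close>.\<close>
  have below: "\<exists>i'>i. i' \<le> length lam \<and> t = bead lam i'" if "t \<in> S" "t < ?c s" for t
  proof -
    have "t + int p \<le> ?c s" using chain_sep[OF S that(1) Suc.prems(2) that(2)] .
    then have tc: "t < ?c (e - 1)" using ce e by simp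
    have "t \<in> beads lam" using chain_sub[OF S that(1)] .
    then obtain i' where i': "1 \<le> i'" "i' \<le> length lam" "t = bead lam i'"
      by (auto simp: beads_def)
    then have "i < i'" using bead_less_iff[OF lam(1) d(1) i'(1)] tc ci by simp
    then show ?thesis using i' by blast
  qed
  show ?case
  proof (cases "i = length lam")
    case True
    have "psegs (Suc f) p (length lam) ?R s = {s..<e}"
      using x True by (simp add: Let_def e_def del: length_rim_list)
    also have "\<dots> = {k. k < ?n \<and> (\<exists>t\<in>S. t \<le> ?c s \<and> t - int p < ?c k \<and> ?c k \<le> t)}" (is "?A = ?B")
    proof (rule set_eqI)
      fix k
      have "t \<le> ?c s \<longleftrightarrow> t = ?c s" if "t \<in> S" for t
        using below[OF that] True by (cases "t < ?c s") auto
      then show "k \<in> ?A \<longleftrightarrow> k \<in> ?B" using first[of k] Suc.prems(2) by blast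
    qed
    finally show ?thesis .
  next
    case False
    then have il: "Suc i \<le> length lam" using d by simp
    \<comment> \<open>A segment that exhausts the rim ends at the least content, whose node lies in
      the last row.\<close>
    have "e \<noteq> ?n"
    proof
      assume "e = ?n"
      then have "int j - int i = 1 - int (length lam)" using r ce part_1_pos[OF lam] lam(2)
        by (simp add: of_nat_diff)
      then show False using il d by simp
    qed
    then have ee: "e = s + p" "e < ?n" using e by (auto simp: e_def)
    define b where "b = bead lam (Suc i)"
    \<comment> \<open>The rim node \<open>(i, j)\<close> has no lower right neighbour, so row
      \<open>i + 1\<close> has at most \<open>j\<close> nodes and its bead clears the window of the
      current segment.\<close>
    have bl: "b \<le> ?c s - int p"
    proof -
      have "part lam (Suc i) \<le> j" using r d by (simp add: mem_rim mem_diagram)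
      then show ?thesis using r ee p by (simp add: b_def bead_def)
    qed
    have tb: "t \<le> b" if "t \<in> S" "t < ?c s" for t
      using below[OF that] bead_le[OF lam(1), of "Suc i"] by (auto simp: b_def Suc_le_eq)
    \<comment> \<open>No later start exceeds \<open>b\<close>, and the current start is too far
      above to cover it, so \<open>b\<close> can only be covered by itself.\<close>
    have bS: "b \<in> S"
    proof -
      have "b \<in> beads lam" using il by (auto simp: b_def beads_def)
      then obtain t where t: "t \<in> S" "b \<le> t" "t < b + int p" using chain_cover[OF S] by blast
      then have "t = b" using tb[OF t(1)] bl by simp
      then show ?thesis using t by simp
    qed
    define s' where "s' = nat (?c 0 - b)"
    have re: "(Suc i, part lam (Suc i)) \<in> rim lam" using row_end_rim[OF lam(1) _ il] by simp
    then have s': "s' < ?n" "?R ! s' = (Suc i, part lam (Suc i))"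
      using rim_list_index[OF lam re] by (auto simp: s'_def b_def bead_def)
    have cs': "?c s' = b" using rim_content[OF lam(1) re] by (simp add: s'_def b_def bead_def)
    have L: "(LEAST k. k < ?n \<and> fst (?R ! k) = Suc i) = s'"
    proof (rule Least_equality)
      show "s' < ?n \<and> fst (?R ! s') = Suc i" using s' by simp
    next
      fix k assume k: "k < ?n \<and> fst (?R ! k) = Suc i"
      then obtain j' where j': "?R ! k = (Suc i, j')" by (metis prod.collapse)
      then have "(Suc i, j') \<in> rim lam" "int j' - int (Suc i) = ?c k" using rim_list_nth[OF lam, of k] k by auto
      then have "?c k \<le> b" by (auto simp: mem_rim mem_diagram b_def bead_def)
      then show "s' \<le> k" using cs' by simp
    qed
    have "psegs (Suc f) p (length lam) ?R s = {s..<e} \<union> psegs f p (length lam) ?R s'"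
      using x False L by (simp add: Let_def e_def del: length_rim_list)
    also have "psegs f p (length lam) ?R s' = {k. k < ?n \<and> (\<exists>t\<in>S. t \<le> ?c s' \<and> t - int p < ?c k \<and> ?c k \<le> t)}"
      using s' bS cs' bl p Suc.prems(3) by (intro Suc.IH) auto
    also have "{s..<e} \<union> \<dots> = {k. k < ?n \<and> (\<exists>t\<in>S. t \<le> ?c s \<and> t - int p < ?c k \<and> ?c k \<le> t)}" (is "?A = ?B")
    proof (rule set_eqI)
      fix k
      have "t \<le> ?c s \<longleftrightarrow> t = ?c s \<or> t \<le> ?c s'" if "t \<in> S" for t
        using tb[OF that] bl p cs' by linarith
      then show "k \<in> ?A \<longleftrightarrow> k \<in> ?B" using first[of k] Suc.prems(2) by blast
    qed
    finally show ?thesis .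
  qed
qed

text \<open>The largest bead \<open>part lam 1 - 1\<close> is the content of label 0 and is
  necessarily a start, so \<open>psegs_eq\<close> applies from label 0 and all starts are
  counted.\<close>

lemma p_rim_eq:
  assumes lam: "is_partition lam" "lam \<noteq> []" and p: "0 < p" and S: "chain (int p) (beads lam) S"
  shows "p_rim p lam = {x \<in> rim lam. \<exists>t\<in>S. t - int p < content x \<and> content x \<le> t}"
proof -
  let ?R = "rim_list lam"
  let ?n = "length ?R"
  let ?c = "\<lambda>k::nat. int (part lam 1) - 1 - int k"
  have top: "t \<le> ?c 0" if "t \<in> beads lam" for t
    using that bead_le[OF lam(1), of 1] by (auto simp: beads_def bead_def)
  have l1: "1 \<le> length lam" using lam(2) by (simp add: Suc_le_eq)
  then have "?c 0 \<in> beads lam" by (auto simp: beads_def bead_def intro!: image_eqI[of _ _ 1])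
  then obtain t where "t \<in> S" "?c 0 \<le> t" using chain_cover[OF S] by blast
  moreover from this have "t = ?c 0" using top[OF chain_sub[OF S]] by (intro antisym)
  ultimately have topS: "?c 0 \<in> S" by blast
  have ps: "psegs ?n p (length lam) ?R 0 = {k. k < ?n \<and> (\<exists>t\<in>S. t \<le> ?c 0 \<and> t - int p < ?c k \<and> ?c k \<le> t)}"
    using psegs_eq[OF lam p S, of 0 ?n] topS l1 part_1_pos[OF lam] by simp
  show ?thesis
  proof (rule set_eqI)
    fix x
    show "x \<in> p_rim p lam \<longleftrightarrow> x \<in> {x \<in> rim lam. \<exists>t\<in>S. t - int p < content x \<and> content x \<le> t}"
    proof
      assume "x \<in> p_rim p lam"
      then obtain k where "k < ?n" "x = ?R ! k" "\<exists>t\<in>S. t - int p < ?c k \<and> ?c k \<le> t"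
        unfolding p_rim_def ps by blast
      then show "x \<in> {x \<in> rim lam. \<exists>t\<in>S. t - int p < content x \<and> content x \<le> t}"
        using rim_list_nth[OF lam, of k] by simp
    next
      assume "x \<in> {x \<in> rim lam. \<exists>t\<in>S. t - int p < content x \<and> content x \<le> t}"
      then obtain t where x: "x \<in> rim lam" and t: "t \<in> S" "t - int p < content x" "content x \<le> t" by blast
      define k where "k = nat (?c 0 - content x)"
      have k: "k < ?n" "?R ! k = x" using rim_list_index[OF lam x] by (auto simp: k_def)
      then have "?c k = content x" using rim_list_nth[OF lam k(1)] by simp
      then have "k \<in> psegs ?n p (length lam) ?R 0" unfolding ps using k t top[OF chain_sub[OF S t(1)]] by auto
      then show "x \<in> p_rim p lam" unfolding p_rim_def using k(2) by blast
    qed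
  qed
qed

section \<open>Removing the \<open>p\<close>-rim\<close>

text \<open>The rim has one node of each content and the windows of distinct starts are disjoint.
  The cut \<open>lo\<close> is the least content for the whole p-rim and 0 for the half on and above
  the diagonal.\<close>

lemma rim_window_card:
  assumes lam: "is_partition lam" "lam \<noteq> []" and p: "0 < p" and S: "chain p (beads lam) S"
    and lo: "1 - int (length lam) \<le> lo"
  shows "int (card {x \<in> rim lam. lo \<le> content x \<and> (\<exists>t\<in>S. t - p < content x \<and> content x \<le> t)})
    = (\<Sum>t\<in>{t\<in>S. lo \<le> t}. min p (t - lo + 1))" (is "int (card ?C) = _")
proof -
  have inj: "inj_on content ?C" using rim_unique[OF lam(1)] by (auto intro!: inj_onI)
  have finS: "finite S" using chain_finite[OF S] by simp
  have top: "t \<le> int (part lam 1) - 1" if "t \<in> S" for t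
    using chain_sub[OF S that] bead_le[OF lam(1), of 1] by (auto simp: beads_def bead_def)
  let ?W = "\<lambda>t. {max (t - p + 1) lo..t}"
  have im: "content ` ?C = (\<Union>t\<in>{t\<in>S. lo \<le> t}. ?W t)"
  proof (intro equalityI subsetI)
    fix c assume "c \<in> (\<Union>t\<in>{t\<in>S. lo \<le> t}. ?W t)"
    then obtain t where t: "t \<in> S" "t - p < c" "lo \<le> c" "c \<le> t" by auto
    then obtain x where "x \<in> rim lam" "content x = c" using rim_exists[OF lam, of c] lo top[OF t(1)] by auto
    then show "c \<in> content ` ?C" using t by blast
  qed auto
  have "int (card ?C) = int (card (content ` ?C))" using inj by (simp add: card_image)
  also have "card (content ` ?C) = (\<Sum>t\<in>{t\<in>S. lo \<le> t}. card (?W t))"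
    unfolding im
  proof (rule card_UN_disjoint)
    show "\<forall>i\<in>{t\<in>S. lo \<le> t}. \<forall>j\<in>{t\<in>S. lo \<le> t}. i \<noteq> j \<longrightarrow> ?W i \<inter> ?W j = {}"
    proof (intro ballI impI)
      fix i j assume "i \<in> {t\<in>S. lo \<le> t}" "j \<in> {t\<in>S. lo \<le> t}" "i \<noteq> j"
      then show "?W i \<inter> ?W j = {}"
        using chain_sep[OF S, of i j] chain_sep[OF S, of j i] by (cases "i < j") auto
    qed
  qed (use finS in auto)
  also have "int (\<Sum>t\<in>{t\<in>S. lo \<le> t}. card (?W t)) = (\<Sum>t\<in>{t\<in>S. lo \<le> t}. min p (t - lo + 1))"
    unfolding of_nat_sum using p by (intro sum.cong) auto
  finally show ?thesis .
qed

locale p_rim_removal =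
  fixes p :: nat and lam :: "nat list" and S :: "int set"
  assumes p2: "2 \<le> p" and lam: "is_partition lam" and ne: "lam \<noteq> []"
    and S: "chain (int p) (beads lam) S"
begin

lemma p_rim_mem: "x \<in> p_rim p lam \<longleftrightarrow> x \<in> rim lam \<and> (\<exists>t\<in>S. t - int p < content x \<and> content x \<le> t)"
  using p_rim_eq[OF lam ne _ S] p2 by simp

lemma chain_bead:
  assumes "1 \<le> i" "i \<le> length lam"
  obtains s where "s \<in> S" "bead lam i \<le> s" "s < bead lam i + int p"
  using chain_cover[OF S, of "bead lam i"] assms by (auto simp: beads_def)

lemma card_p_rim: "int (card (p_rim p lam)) = (\<Sum>t\<in>S. min (int p) (t + int (length lam)))"
proof -
  let ?lo = "1 - int (length lam)"
  have lo: "?lo \<le> t" if "t \<in> S" for t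
  proof -
    have "t \<in> beads lam" using chain_sub[OF S that] .
    then obtain i where i: "1 \<le> i" "i \<le> length lam" "t = bead lam i" by (auto simp: beads_def)
    then have "0 < part lam i" using part_pos_iff[OF lam] by simp
    then show ?thesis using i by (simp add: bead_def)
  qed
  have "p_rim p lam = {x \<in> rim lam. ?lo \<le> content x \<and> (\<exists>t\<in>S. t - int p < content x \<and> content x \<le> t)}"
    using p_rim_mem rim_content[OF lam] by blast
  then have "int (card (p_rim p lam)) = (\<Sum>t\<in>{t\<in>S. ?lo \<le> t}. min (int p) (t - ?lo + 1))"
    using rim_window_card[OF lam ne _ S, of ?lo] p2 by simp
  also have "\<dots> = (\<Sum>t\<in>S. min (int p) (t + int (length lam)))"
    using lo by (intro sum.cong) auto
  finally show ?thesis .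
qed

text \<open>A start that covers a rim node of row \<open>i\<close> is at least the bead of that row,
  hence at least \<open>s\<close>. So the window of \<open>s\<close> alone decides what the row
  loses.\<close>

lemma removed_row:
  assumes i: "1 \<le> i" "i \<le> length lam" and s: "s \<in> S" "bead lam i \<le> s" "s < bead lam i + int p"
  shows "(i, j) \<in> diagram lam - p_rim p lam \<longleftrightarrow>
    1 \<le> j \<and> int j - int i \<le> max (bead lam (Suc i)) (s - int p)"
proof (cases "1 \<le> j \<and> int j - int i \<le> bead lam i")
  case True
  then have d: "(i, j) \<in> diagram lam" using i by (simp add: mem_diagram bead_def)
  have r: "(i, j) \<in> rim lam \<longleftrightarrow> bead lam (Suc i) < int j - int i"
    using d by (auto simp: mem_rim mem_diagram bead_def)
  have cov: "(\<exists>t\<in>S. t - int p < int j - int i \<and> int j - int i \<le> t) \<longleftrightarrow> s - int p < int j - int i"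
    if c: "bead lam (Suc i) < int j - int i"
  proof
    assume "\<exists>t\<in>S. t - int p < int j - int i \<and> int j - int i \<le> t"
    then obtain t where t: "t \<in> S" "t - int p < int j - int i" "int j - int i \<le> t" by blast
    obtain k where k: "1 \<le> k" "t = bead lam k" using chain_sub[OF S t(1)] by (auto simp: beads_def)
    have "bead lam (Suc i) < bead lam k" using c t k by simp
    then have "k < Suc i" using bead_less_iff[OF lam k(1), of "Suc i"] by simp
    then have "bead lam i \<le> t" using bead_le[OF lam k(1), of i] k by simp
    then have "s \<le> t" using chain_sep[OF S t(1) s(1)] s(3) by force
    then show "s - int p < int j - int i" using t by simp
  next
    assume "s - int p < int j - int i"
    then show "\<exists>t\<in>S. t - int p < int j - int i \<and> int j - int i \<le> t" using True s by force
  qed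
  show ?thesis using d r cov True p_rim_mem[of "(i, j)"] by (auto simp: le_max_iff_disj not_less)
next
  case False
  moreover have "bead lam (Suc i) < bead lam i" using bead_less[OF lam i(1)] by simp
  ultimately show ?thesis using s i by (auto simp: mem_diagram bead_def)
qed

lemma young_removed: "young (diagram lam - p_rim p lam)"
proof -
  let ?D = "diagram lam - p_rim p lam"
  note yd = youngD[OF young_diagram[OF lam]]
  have len: "i \<le> length lam" if "(i, j) \<in> diagram lam" for i j
    using that part_pos_iff[OF lam, of i] by (simp add: mem_diagram)
  \<comment> \<open>If \<open>(i, j)\<close> is removed, then a node below it ends its row. Row ends
    always belong to the p-rim, because every bead is covered by a start.\<close>
  have up: "(i, j) \<in> ?D" if h: "1 \<le> i" "(Suc i, j) \<in> ?D" for i j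
  proof (rule ccontr)
    assume "(i, j) \<notin> ?D"
    moreover have d: "(i, j) \<in> diagram lam" using yd(4) h by blast
    ultimately have "(i, j) \<in> p_rim p lam" by blast
    then have "(Suc i, Suc j) \<notin> diagram lam" by (simp add: p_rim_mem mem_rim)
    then have b: "bead lam (Suc i) = int j - int (Suc i)" using h by (auto simp: mem_diagram bead_def)
    moreover have "(Suc i, j) \<in> rim lam" using h \<open>(Suc i, Suc j) \<notin> diagram lam\<close> yd(4)[of "Suc i" "Suc j"]
      by (auto simp: mem_rim)
    moreover have "Suc i \<le> length lam" using h len by blast
    then obtain s where "s \<in> S" "bead lam (Suc i) \<le> s" "s < bead lam (Suc i) + int p"
      using chain_bead[of "Suc i"] by auto
    ultimately have "(Suc i, j) \<in> p_rim p lam" unfolding p_rim_mem by force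
    then show False using h by blast
  qed
  have left: "(i, j) \<in> ?D" if h: "1 \<le> j" "(i, Suc j) \<in> ?D" for i j
  proof -
    have i: "1 \<le> i" "i \<le> length lam" using h yd(2) len by blast+
    obtain s where s: "s \<in> S" "bead lam i \<le> s" "s < bead lam i + int p" using chain_bead[OF i] .
    show ?thesis using h unfolding removed_row[OF i s] by auto
  qed
  show ?thesis unfolding young_def
  proof (intro conjI allI impI)
    show "finite ?D" using yd(1) by simp
    fix i j assume "(i, j) \<in> ?D"
    then have "(i, j) \<in> diagram lam" by blast
    then show "1 \<le> i" "1 \<le> j" by (simp_all add: mem_diagram)
  qed (use up left in blast)+
qed

lemma remove_partition: "is_partition (remove_p_rim p lam)"
  and diagram_remove: "diagram (remove_p_rim p lam) = diagram lam - p_rim p lam"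
  unfolding remove_p_rim_def using of_diagram_young[OF young_removed] by auto

lemma length_remove: "length (remove_p_rim p lam) \<le> length lam"
proof (rule ccontr)
  let ?l = "length (remove_p_rim p lam)"
  assume h: "\<not> ?l \<le> length lam"
  then have "0 < part (remove_p_rim p lam) ?l" using part_pos_iff[OF remove_partition, of ?l] by simp
  then have "(?l, 1) \<in> diagram (remove_p_rim p lam)" using h by (auto simp: mem_diagram Suc_le_eq)
  then have "(?l, 1) \<in> diagram lam" unfolding diagram_remove by blast
  then show False using h part_pos_iff[OF lam, of ?l] by (simp add: mem_diagram)
qed

lemma bead_remove:
  assumes i: "1 \<le> i" "i \<le> length lam" and s: "s \<in> S" "bead lam i \<le> s" "s < bead lam i + int p"
  shows "bead (remove_p_rim p lam) i = max (- int i) (max (bead lam (Suc i)) (s - int p))"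
proof -
  let ?b = "max (- int i) (max (bead lam (Suc i)) (s - int p))"
  have "{j. (i, j) \<in> diagram (remove_p_rim p lam)} = {1..nat (?b + int i)}"
    unfolding diagram_remove removed_row[OF i s] by auto
  then have "part (remove_p_rim p lam) i = nat (?b + int i)" using part_eq_card[OF i(1)] by simp
  then show ?thesis by (simp add: bead_def)
qed

text \<open>Row \<open>i\<close> receives the larger of the next bead and \<open>s - p\<close>; if
  the next bead is a start, separation makes \<open>s - p\<close> the larger. Only inclusion is
  checked: the left side has \<open>length lam\<close> elements and the right side at most as many,
  by \<open>card_shift\<close>.\<close>

lemma beads_remove:
  "bead (remove_p_rim p lam) ` {1..length lam} = max (- int (length lam)) ` shift (int p) (beads lam) S" (is "?L = ?R")
proof (rule card_subset_eq)
  let ?l = "length lam"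
  have finS: "finite S" using chain_finite[OF S] by simp
  then show finR: "finite ?R" by (simp add: shift_def)
  show "?L \<subseteq> ?R"
  proof
    fix b assume "b \<in> ?L"
    then obtain i where i: "1 \<le> i" "i \<le> length lam" and b: "b = bead (remove_p_rim p lam) i" by auto
    obtain s where s: "s \<in> S" "bead lam i \<le> s" "s < bead lam i + int p" using chain_bead[OF i] .
    have b: "b = max (- int i) (max (bead lam (Suc i)) (s - int p))" using b bead_remove[OF i s] by simp
    have sh: "s - int p \<in> shift (int p) (beads lam) S" using s by (auto simp: shift_def)
    show "b \<in> ?R"
    proof (cases "i = ?l")
      case True
      then have "part lam (Suc i) = 0" by (simp add: part_def)
      then have "b = max (- int ?l) (s - int p)" using b True by (simp add: bead_def)
      then show ?thesis using sh by blast
    next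
      case False
      then have i': "1 \<le> Suc i" "Suc i \<le> ?l" using i by auto
      have pos: "- int i \<le> bead lam (Suc i)" using part_pos_iff[OF lam, of "Suc i"] i' by (simp add: bead_def)
      then have b: "b = max (bead lam (Suc i)) (s - int p)" using b by simp
      have less: "bead lam (Suc i) < bead lam i" using bead_less[OF lam i(1)] by simp
      have "b \<in> shift (int p) (beads lam) S"
      proof (cases "bead lam (Suc i) \<in> S")
        case True
        then have "bead lam (Suc i) + int p \<le> s" using chain_sep[OF S True s(1)] less s(2) by simp
        then show ?thesis using b sh by simp
      next
        case False
        moreover have "bead lam (Suc i) \<in> beads lam" using i' by (auto simp: beads_def)
        ultimately have "bead lam (Suc i) \<in> shift (int p) (beads lam) S" by (auto simp: shift_def)
        then show ?thesis using b sh by (simp add: max_def)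
      qed
      moreover have "max (- int ?l) b = b" using b pos i by simp
      ultimately show ?thesis by (metis imageI)
    qed
  qed
  have inj: "inj_on (bead (remove_p_rim p lam)) {1..?l}" "inj_on (bead lam) {1..?l}"
    using bead_less[OF remove_partition] bead_less[OF lam] by (auto intro!: linorder_inj_onI) fastforce+
  have "card ?R \<le> card (shift (int p) (beads lam) S)" using finS by (intro card_image_le) (simp add: shift_def)
  also have "\<dots> = ?l" using card_shift[OF S] inj(2) by (simp add: beads_def card_image)
  finally have "card ?R \<le> card ?L" using inj(1) by (simp add: card_image)
  then show "card ?L = card ?R" using card_mono[OF finR \<open>?L \<subseteq> ?R\<close>] by simp
qed

end

section \<open>Beta-sets (first-column hook lengths) as a coding of partitions\<close>

definition bset :: "nat list \<Rightarrow> int set" where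
  "bset lam = (\<lambda>b. b + int (length lam)) ` beads lam"

lemma bset_Nil [simp]: "bset [] = {}" by (simp add: bset_def beads_def)

lemma bset_Cons: "bset (x # xs) = insert (int x + int (length xs)) (bset xs)"
proof -
  have s: "{1..Suc n} = insert 1 (Suc ` {1..n})" for n
    using atLeastAtMost_insertL[of 1 "Suc n"] by (simp add: image_Suc_atLeastAtMost)
  have "bead (x # xs) (Suc i) = bead xs i - 1" if "i \<in> {1..length xs}" for i
    using that by (simp add: bead_def part_def nth_Cons')
  then show ?thesis
    unfolding bset_def beads_def image_image length_Cons s image_insert
    by (intro arg_cong2[of _ _ _ _ insert] image_cong) (simp_all add: bead_def part_def)
qed

lemma finite_bset [simp]: "finite (bset lam)" by (simp add: bset_def)

lemma is_partition_Cons: "is_partition (x # xs) \<longleftrightarrow> 0 < x \<and> (\<forall>y\<in>set xs. y \<le> x) \<and> is_partition xs"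
  by (auto simp: is_partition_def)

lemma bset_bounds:
  "is_partition lam \<Longrightarrow> b \<in> bset lam \<Longrightarrow> 1 \<le> b \<and> b < int (part lam 1) + int (length lam)"
proof (induction lam arbitrary: b)
  case (Cons x xs)
  then have x: "0 < x" "\<And>y. y \<in> set xs \<Longrightarrow> y \<le> x" "is_partition xs" by (auto simp: is_partition_Cons)
  then have "xs \<noteq> [] \<Longrightarrow> part xs 1 \<le> x" by (simp add: part_def)
  then show ?case using Cons.IH[OF x(3)] Cons.prems(2) x(1) unfolding bset_Cons
    by (cases "xs = []") (force simp: part_def)+
qed simp

lemma card_bset: "is_partition lam \<Longrightarrow> card (bset lam) = length lam"
proof (induction lam)
  case (Cons x xs)
  then have x: "\<And>y. y \<in> set xs \<Longrightarrow> y \<le> x" "is_partition xs" by (auto simp: is_partition_Cons)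
  then have "xs \<noteq> [] \<Longrightarrow> part xs 1 \<le> x" by (simp add: part_def)
  then have "int x + int (length xs) \<notin> bset xs" using bset_bounds[OF x(2)] by (cases "xs = []") force+
  then show ?case using Cons.IH x by (simp add: bset_Cons)
qed simp

lemma bset_inj:
  "is_partition lam \<Longrightarrow> is_partition mu \<Longrightarrow> bset lam = bset mu \<Longrightarrow> lam = mu"
proof (induction lam arbitrary: mu)
  case Nil
  then show ?case using card_bset[of mu] by simp
next
  case (Cons x xs)
  then have "length (x # xs) = length mu" using card_bset by metis
  then obtain y ys where mu: "mu = y # ys" "length xs = length ys" by (cases mu) auto
  have top: "int z + int (length zs) \<notin> bset zs \<and> (\<forall>b\<in>bset zs. b < int z + int (length zs))"
    if "is_partition (z # zs)" for z zs
  proof -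
    have z: "\<And>y. y \<in> set zs \<Longrightarrow> y \<le> z" "is_partition zs" using that by (auto simp: is_partition_Cons)
    then have "zs \<noteq> [] \<Longrightarrow> part zs 1 \<le> z" by (simp add: part_def)
    then show ?thesis using bset_bounds[OF z(2)] by (cases "zs = []") force+
  qed
  have eq: "insert (int x + int (length xs)) (bset xs) = insert (int y + int (length ys)) (bset ys)"
    using Cons.prems(3) unfolding mu bset_Cons .
  have tx: "int x + int (length xs) \<notin> bset xs" "\<forall>b\<in>bset xs. b < int x + int (length xs)"
    using top[OF Cons.prems(1)] by auto
  have ty: "int y + int (length ys) \<notin> bset ys" "\<forall>b\<in>bset ys. b < int y + int (length ys)"
    using top[of y ys] Cons.prems(2) mu by auto
  have "int x + int (length xs) = int y + int (length ys)"
    using eq tx(2) ty(2) by (metis insertCI insertE order_less_asym)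
  then have "x = y" "bset xs = bset ys" using mu(2) eq tx(1) ty(1) by (auto simp: insert_ident)
  then show ?case using Cons.IH[of ys] Cons.prems mu by (simp add: is_partition_Cons)
qed

lemma bset_surj: "finite X \<Longrightarrow> (\<And>x. x \<in> X \<Longrightarrow> 1 \<le> x) \<Longrightarrow> \<exists>lam. is_partition lam \<and> bset lam = X"
proof (induction X rule: finite_linorder_max_induct)
  case empty
  show ?case by (intro exI[of _ "[]"]) (simp add: is_partition_def)
next
  case (insert M X)
  then obtain xs where xs: "is_partition xs" "bset xs = X" by auto
  define x where "x = nat (M - int (length xs))"
  have xM: "1 \<le> M - int (length xs) \<and> (\<forall>y\<in>set xs. int y \<le> M - int (length xs))"
  proof (cases xs)
    case Nil
    then show ?thesis using insert.prems[of M] by simp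
  next
    case (Cons z zs)
    then have "int z + int (length zs) \<in> X" using xs bset_Cons by auto
    then have "int z + int (length zs) < M" using insert.hyps by blast
    then show ?thesis using xs(1) Cons by (auto simp: is_partition_Cons)
  qed
  then have x: "int x = M - int (length xs)" by (simp add: x_def)
  then have "is_partition (x # xs)" "bset (x # xs) = insert M X"
    using xM xs x by (force simp: is_partition_Cons bset_Cons)+
  then show ?case by blast
qed

text \<open>The \<open>n - length mu\<close> empty rows have beads \<open>- i\<close>, which after
  translation fill the initial run of a \<open>mullineux_step\<close>.\<close>

lemma bead_shift_image:
  assumes "length mu \<le> n"
  shows "(\<lambda>i. bead mu i + int n) ` {1..n} = {0..<int n - int (length mu)} \<union> (\<lambda>z. z + (int n - int (length mu))) ` bset mu"
proof -
  have s: "{1..n} = {1..length mu} \<union> {length mu + 1..n}" using assms by auto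
  have z: "(\<lambda>i. bead mu i + int n) ` {length mu + 1..n} = {0..<int n - int (length mu)}" (is "?A = ?B")
  proof (intro equalityI subsetI)
    fix y assume "y \<in> ?B"
    then have "nat (int n - y) \<in> {length mu + 1..n}" "bead mu (nat (int n - y)) + int n = y"
      by (auto simp: bead_def part_def)
    then show "y \<in> ?A" by (metis imageI)
  qed (auto simp: bead_def part_def)
  have "(\<lambda>i. bead mu i + int n) ` {1..length mu} = (\<lambda>z. z + (int n - int (length mu))) ` bset mu"
    by (simp add: bset_def beads_def image_image)
  then show ?thesis unfolding s image_Un z by blast
qed

context p_rim_removal
begin

lemma mullineux_step_remove:
  "mullineux_step (int p) (bset lam) ((\<lambda>b. b + int (length lam)) ` S)
     (int (length lam) - int (length (remove_p_rim p lam))) (bset (remove_p_rim p lam))"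
proof
  let ?l = "int (length lam)" and ?mu = "remove_p_rim p lam"
  show "2 \<le> int p" using p2 by simp
  show "chain (int p) (bset lam) ((\<lambda>b. b + ?l) ` S)" unfolding bset_def using S by (rule chain_translate)
  show "bset lam \<noteq> {}" using ne by (simp add: bset_def beads_def Suc_le_eq)
  show "\<And>x. x \<in> bset lam \<Longrightarrow> 1 \<le> x" using bset_bounds[OF lam] by blast
  show "\<And>z. z \<in> bset ?mu \<Longrightarrow> 1 \<le> z" using bset_bounds[OF remove_partition] by blast
  show "0 \<le> ?l - int (length ?mu)" using length_remove by simp
  have "shift (int p) (bset lam) ((\<lambda>b. b + ?l) ` S) = (\<lambda>b. b + ?l) ` shift (int p) (beads lam) S"
    unfolding shift_def bset_def image_Un image_image
    by (subst image_set_diff) (auto simp: inj_def algebra_simps)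
  then have "max 0 ` shift (int p) (bset lam) ((\<lambda>b. b + ?l) ` S)
      = (\<lambda>b. b + ?l) ` max (- ?l) ` shift (int p) (beads lam) S"
    by (simp add: image_image max_add_distrib_left)
  also have "\<dots> = (\<lambda>i. bead ?mu i + ?l) ` {1..length lam}"
    unfolding beads_remove[symmetric] image_image ..
  finally show "max 0 ` shift (int p) (bset lam) ((\<lambda>b. b + ?l) ` S)
      = {0..<?l - int (length ?mu)} \<union> (\<lambda>z. z + (?l - int (length ?mu))) ` bset ?mu"
    using bead_shift_image[OF length_remove] by simp
qed simp

lemma card_p_rim_bset: "int (card (p_rim p lam)) = sum (min (int p)) ((\<lambda>b. b + int (length lam)) ` S)"
  unfolding card_p_rim by (subst sum.reindex) (auto simp: inj_on_def)

end

section \<open>Self-conjugate partitions\<close>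

lemma sum_list_card: "is_partition lam \<Longrightarrow> sum_list lam = card (diagram lam)"
proof -
  assume "is_partition lam"
  then have "diagram lam = Sigma {1..length lam} (\<lambda>i. {1..part lam i})"
    using part_pos_iff[of lam] by (fastforce simp: mem_diagram)
  then have "card (diagram lam) = (\<Sum>i=1..length lam. part lam i)" by simp
  also have "\<dots> = (\<Sum>i=0..<length lam. part lam (Suc i))"
    by (rule sum.reindex_bij_witness[of _ Suc "\<lambda>i. i - 1"]) auto
  also have "\<dots> = (\<Sum>i=0..<length lam. lam ! i)" by (intro sum.cong) (auto simp: part_def)
  finally show ?thesis by (simp add: sum_list_sum_nth)
qed

text \<open>A run of \<open>p\<close> beads needs at least \<open>p\<close> rows. Its two ends
  differ by only \<open>p - 1\<close>, and each row already lowers the bead by one, so nothing is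
  left for the parts to decrease.\<close>

lemma equal_run_iff_run:
  assumes lam: "is_partition lam" and p: "1 \<le> p"
  shows "(\<exists>i. 1 \<le> i \<and> i + (p - 1) \<le> length lam \<and> part lam i = part lam (i + (p - 1))) \<longleftrightarrow>
    (\<exists>x. {x..<x + int p} \<subseteq> beads lam)"
proof
  assume "\<exists>i. 1 \<le> i \<and> i + (p - 1) \<le> length lam \<and> part lam i = part lam (i + (p - 1))"
  then obtain i where i: "1 \<le> i" "i + (p - 1) \<le> length lam" "part lam i = part lam (i + (p - 1))" by blast
  have "y \<in> beads lam" if y: "y \<in> {bead lam i - int p + 1..<bead lam i - int p + 1 + int p}" for y
  proof -
    define k where "k = nat (int i + (bead lam i - y))"
    have k: "i \<le> k" "k \<le> i + (p - 1)" "int k = int i + (bead lam i - y)" using y p by (auto simp: k_def)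
    have "part lam k = part lam i"
      using part_antimono[OF lam i(1) k(1)] part_antimono[OF lam _ k(2)] i k(1) by simp
    then have "bead lam k = y" using k(3) by (simp add: bead_def)
    then show ?thesis using i k by (auto simp: beads_def)
  qed
  then show "\<exists>x. {x..<x + int p} \<subseteq> beads lam" by blast
next
  assume "\<exists>x. {x..<x + int p} \<subseteq> beads lam"
  then obtain x where x: "{x..<x + int p} \<subseteq> beads lam" by blast
  then have "x \<in> beads lam" "x + int p - 1 \<in> beads lam" using p by auto
  then obtain i0 i1 where i0: "1 \<le> i0" "i0 \<le> length lam" "bead lam i0 = x + int p - 1"
    and i1: "1 \<le> i1" "i1 \<le> length lam" "bead lam i1 = x" by (auto simp: beads_def)
  have "{x..<x + int p} \<subseteq> bead lam ` {i0..i1}"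
  proof
    fix y assume y: "y \<in> {x..<x + int p}"
    then have "y \<in> beads lam" using x by blast
    then obtain k where k: "1 \<le> k" "k \<le> length lam" "y = bead lam k" by (auto simp: beads_def)
    have "\<not> k < i0" using bead_less[OF lam k(1), of i0] y k i0 by auto
    moreover have "\<not> i1 < k" using bead_less[OF lam i1(1), of k] y k i1 by auto
    ultimately show "y \<in> bead lam ` {i0..i1}" using k by auto
  qed
  then have "card {x..<x + int p} \<le> card (bead lam ` {i0..i1})" by (intro card_mono) auto
  also have "\<dots> \<le> card {i0..i1}" by (intro card_image_le) simp
  finally have c: "p \<le> Suc i1 - i0" by simp
  then have "i0 \<le> i1" using p by simp
  then have "part lam i1 \<le> part lam i0" using part_antimono[OF lam i0(1)] by simp
  then have "i1 = i0 + (p - 1)" "part lam i0 = part lam i1" using c p i0(3) i1(3) by (auto simp: bead_def)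
  then show "\<exists>i. 1 \<le> i \<and> i + (p - 1) \<le> length lam \<and> part lam i = part lam (i + (p - 1))" using i0 i1 by blast
qed

lemma repeated_part_iff:
  assumes lam: "is_partition lam" and p: "1 \<le> p"
  shows "(\<exists>x\<in>set lam. p \<le> length (filter ((=) x) lam)) \<longleftrightarrow>
    (\<exists>i. 1 \<le> i \<and> i + (p - 1) \<le> length lam \<and> part lam i = part lam (i + (p - 1)))"
proof
  assume "\<exists>x\<in>set lam. p \<le> length (filter ((=) x) lam)"
  then obtain x where x: "p \<le> length (filter ((=) x) lam)" by blast
  define J where "J = {i. i < length lam \<and> x = lam ! i}"
  have J: "finite J" "p \<le> card J" using x by (auto simp: J_def length_filter_conv_card)
  then have "J \<noteq> {}" using p by auto
  then have MJ: "Min J \<in> J" "Max J \<in> J" using J by auto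
  have "J \<subseteq> {Min J..Max J}" using J by auto
  then have "card J \<le> Suc (Max J) - Min J" using card_mono[of "{Min J..Max J}" J] by simp
  then have le: "Min J + (p - 1) \<le> Max J" using J(2) p by simp
  have "part lam (Suc (Min J) + (p - 1)) = x"
  proof (rule antisym)
    have "part lam (Suc (Min J)) = x" "part lam (Suc (Max J)) = x" using MJ by (auto simp: J_def part_def)
    then show "part lam (Suc (Min J) + (p - 1)) \<le> x" "x \<le> part lam (Suc (Min J) + (p - 1))"
      using part_antimono[OF lam, of "Suc (Min J)" "Suc (Min J) + (p - 1)"]
        part_antimono[OF lam, of "Suc (Min J) + (p - 1)" "Suc (Max J)"] le by auto
  qed
  moreover have "part lam (Suc (Min J)) = x" "Suc (Min J) + (p - 1) \<le> length lam"
    using MJ le by (auto simp: J_def part_def)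
  ultimately show "\<exists>i. 1 \<le> i \<and> i + (p - 1) \<le> length lam \<and> part lam i = part lam (i + (p - 1))"
    by (intro exI[of _ "Suc (Min J)"]) simp
next
  assume "\<exists>i. 1 \<le> i \<and> i + (p - 1) \<le> length lam \<and> part lam i = part lam (i + (p - 1))"
  then obtain i where i: "1 \<le> i" "i + (p - 1) \<le> length lam" "part lam i = part lam (i + (p - 1))" by blast
  have il: "i - 1 < length lam" using i by simp
  have "k < length lam \<and> part lam i = lam ! k" if "k \<in> {i - 1..<i - 1 + p}" for k
  proof -
    have "part lam (Suc k) = part lam i"
      using part_antimono[OF lam i(1), of "Suc k"] part_antimono[OF lam, of "Suc k" "i + (p - 1)"] i that by auto
    then show ?thesis using that i p by (auto simp: part_def split: if_splits)
  qed
  then have "{i - 1..<i - 1 + p} \<subseteq> {k. k < length lam \<and> part lam i = lam ! k}" by blast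
  then have "card {i - 1..<i - 1 + p} \<le> card {k. k < length lam \<and> part lam i = lam ! k}" by (intro card_mono) auto
  then have "p \<le> length (filter ((=) (part lam i)) lam)" by (simp add: length_filter_conv_card)
  moreover have "part lam i \<in> set lam" using il i by (simp add: part_def)
  ultimately show "\<exists>x\<in>set lam. p \<le> length (filter ((=) x) lam)" by blast
qed

lemma p_regular_iff:
  assumes "1 \<le> p" shows "p_regular p lam \<longleftrightarrow> is_partition lam \<and> run_free (int p) (bset lam)"
proof (cases "is_partition lam")
  case True
  have "(\<exists>x. {x..<x + int p} \<subseteq> beads lam) \<longleftrightarrow> (\<exists>x. {x..<x + int p} \<subseteq> bset lam)"
  proof -
    have "{x..<x + int p} \<subseteq> bset lam \<longleftrightarrow> {x - int (length lam)..<x - int (length lam) + int p} \<subseteq> beads lam" for x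
    proof -
      have e: "{x..<x + int p} = (\<lambda>b. b + int (length lam)) ` {x - int (length lam)..<x - int (length lam) + int p}"
        by simp
      have "inj (\<lambda>b. b + int (length lam))" by (simp add: inj_def)
      then show ?thesis unfolding bset_def by (subst e) (rule inj_image_subset_iff)
    qed
    then show ?thesis by (metis diff_add_cancel add_diff_cancel_right')
  qed
  then show ?thesis
    using equal_run_iff_run[OF True assms] repeated_part_iff[OF True assms] True
    unfolding p_regular_def run_free_def by (simp add: not_less flip: not_le) (metis not_less)
qed (simp add: p_regular_def)

section \<open>Arms as a coding of self-conjugate partitions\<close>

definition arms :: "nat list \<Rightarrow> int set" where
  "arms lam = {b \<in> beads lam. 0 \<le> b}"

lemma finite_arms [simp]: "finite (arms lam)" by (simp add: arms_def)

lemma arms_nonneg: "a \<in> arms lam \<Longrightarrow> 0 \<le> a" by (simp add: arms_def)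

lemma arms_eq:
  assumes "length lam \<le> n" shows "arms lam = {b \<in> bead lam ` {1..n}. 0 \<le> b}"
proof -
  have "i \<le> length lam" if "1 \<le> i" "0 \<le> bead lam i" for i
    using that by (auto simp: bead_def part_def split: if_splits)
  then show ?thesis using assms unfolding arms_def beads_def
    by (intro set_eqI iffI) (force simp: image_iff)+
qed

lemma arms_iff:
  "c \<in> arms lam \<longleftrightarrow> 0 \<le> c \<and> (\<exists>i\<ge>1. (i, i + nat c) \<in> diagram lam \<and> (i, Suc (i + nat c)) \<notin> diagram lam)"
proof -
  have "c \<in> arms lam \<longleftrightarrow> 0 \<le> c \<and> (\<exists>i\<ge>1. c = bead lam i)"
  proof -
    have "i \<le> length lam" if "1 \<le> i" "0 \<le> bead lam i" for i
      using that by (auto simp: bead_def part_def split: if_splits)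
    then show ?thesis unfolding arms_def beads_def by (force simp: image_iff)
  qed
  moreover have "c = bead lam i \<longleftrightarrow> (i, i + nat c) \<in> diagram lam \<and> (i, Suc (i + nat c)) \<notin> diagram lam"
    if "0 \<le> c" "1 \<le> i" for i
    using that by (auto simp: bead_def mem_diagram)
  ultimately show ?thesis by blast
qed

text \<open>On or above the diagonal, \<open>(i, j)\<close> is a node iff the first \<open>i\<close>
  beads are at least \<open>j - i\<close>. Such beads are nonnegative, so the arms alone determine
  this half of the diagram.\<close>

lemma diagram_upper_iff:
  assumes lam: "is_partition lam" and ij: "1 \<le> i" "i \<le> j"
  shows "(i, j) \<in> diagram lam \<longleftrightarrow> i \<le> card {a \<in> arms lam. int j - int i \<le> a}"
proof -
  let ?c = "int j - int i"
  define I where "I = {k. 1 \<le> k \<and> ?c \<le> bead lam k}"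
  have len: "k \<le> length lam" if "k \<in> I" for k
    using that ij by (auto simp: I_def bead_def part_def split: if_splits)
  then have finI: "finite I" by (intro finite_subset[of I "{..length lam}"]) auto
  have down: "k \<in> I" if "l \<in> I" "1 \<le> k" "k \<le> l" for k l
    using bead_le[OF lam that(2,3)] that by (auto simp: I_def)
  have pos: "1 \<le> k" if "k \<in> I" for k using that by (simp add: I_def)
  have mem: "k \<in> I \<longleftrightarrow> 1 \<le> k \<and> k \<le> card I" for k
    using finI pos down by (rule initial_segment)
  have "bead lam ` I = {a \<in> arms lam. ?c \<le> a}"
  proof (intro equalityI subsetI)
    fix a assume "a \<in> bead lam ` I"
    then obtain k where "k \<in> I" "a = bead lam k" by blast
    then show "a \<in> {a \<in> arms lam. ?c \<le> a}" using len[of k] ij by (auto simp: I_def arms_def beads_def)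
  qed (auto simp: I_def arms_def beads_def)
  moreover have "inj_on (bead lam) I" using bead_less[OF lam] by (auto intro!: linorder_inj_onI simp: I_def) fastforce
  ultimately have "card I = card {a \<in> arms lam. ?c \<le> a}" using card_image by metis
  moreover have "(i, j) \<in> diagram lam \<longleftrightarrow> i \<in> I" using ij by (auto simp: I_def bead_def mem_diagram)
  ultimately show ?thesis using mem[of i] ij by simp
qed

lemma column_card:
  assumes "1 \<le> j" shows "length (filter (\<lambda>x. j \<le> x) lam) = card {i. (i, j) \<in> diagram lam}"
proof -
  have "{i. (i, j) \<in> diagram lam} = Suc ` {i. i < length lam \<and> j \<le> lam ! i}"
  proof (intro equalityI subsetI)
    fix i assume "i \<in> {i. (i, j) \<in> diagram lam}"
    then have "i = Suc (i - 1)" "i - 1 < length lam" "j \<le> lam ! (i - 1)"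
      using assms by (auto simp: mem_diagram part_def split: if_splits)
    then show "i \<in> Suc ` {i. i < length lam \<and> j \<le> lam ! i}" by blast
  qed (use assms in \<open>auto simp: mem_diagram part_def\<close>)
  then show ?thesis by (simp add: length_filter_conv_card card_image)
qed

lemma length_conj_part: "length (conj_part lam) = part lam 1"
  by (simp add: conj_part_def del: upt_Suc)

lemma part_conj_part:
  assumes "is_partition lam" "1 \<le> j" shows "part (conj_part lam) j = card {i. (i, j) \<in> diagram lam}"
proof (cases "j \<le> part lam 1")
  case True
  then have "conj_part lam ! (j - 1) = length (filter (\<lambda>x. j \<le> x) lam)"
    using assms(2) by (simp add: conj_part_def nth_append del: upt_Suc) (subst nth_upt, auto)
  then show ?thesis using True assms column_card[OF assms(2)]
    by (simp add: part_def[of "conj_part lam"] length_conj_part)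
next
  case False
  have "part lam i \<le> part lam 1" if "1 \<le> i" for i using part_antimono[OF assms(1) _ that] by simp
  then have "{i. (i, j) \<in> diagram lam} = {}" using False by (force simp: mem_diagram)
  then show ?thesis using False by (simp add: part_def[of "conj_part lam"] length_conj_part)
qed

lemma column_segment:
  assumes "is_partition lam"
  shows "(i, j) \<in> diagram lam \<longleftrightarrow> 1 \<le> i \<and> i \<le> card {i. (i, j) \<in> diagram lam}"
proof -
  note y = young_diagram[OF assms]
  have "{i. (i, j) \<in> diagram lam} \<subseteq> fst ` diagram lam" by force
  then have "finite {i. (i, j) \<in> diagram lam}" using youngD(1)[OF y] finite_surj by blast
  then show ?thesis using initial_segment[of "{i. (i, j) \<in> diagram lam}" i] young_le[OF y]
    by (auto simp: mem_diagram)
qed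

lemma self_conjugate_iff:
  assumes lam: "is_partition lam"
  shows "self_conjugate lam \<longleftrightarrow> (\<forall>i j. (i, j) \<in> diagram lam \<longleftrightarrow> (j, i) \<in> diagram lam)"
proof
  assume "self_conjugate lam"
  then have "(i, j) \<in> diagram lam \<longleftrightarrow> (j, i) \<in> diagram lam" if "1 \<le> j" for i j
    using part_conj_part[OF lam that] column_segment[OF lam, of i j] that
    by (simp add: self_conjugate_def mem_diagram[of j])
  then show "\<forall>i j. (i, j) \<in> diagram lam \<longleftrightarrow> (j, i) \<in> diagram lam" by (meson mem_diagram)
next
  assume sym: "\<forall>i j. (i, j) \<in> diagram lam \<longleftrightarrow> (j, i) \<in> diagram lam"
  then have row: "card {i. (i, j) \<in> diagram lam} = part lam j" if "1 \<le> j" for j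
    using part_eq_card[OF that, of lam] by simp
  have "(i, 1) \<in> diagram lam \<longleftrightarrow> i \<in> {1..length lam}" for i
    unfolding mem_diagram atLeastAtMost_iff using part_pos_iff[OF lam, of i] by linarith
  then have "{i. (i, 1) \<in> diagram lam} = {1..length lam}" by blast
  then have l: "part lam 1 = length lam" using row[of 1] by simp
  show "self_conjugate lam" unfolding self_conjugate_def
  proof (rule nth_equalityI)
    show "length (conj_part lam) = length lam" using l by (simp add: length_conj_part)
    fix k assume "k < length (conj_part lam)"
    then have "k < length lam" "conj_part lam ! k = part (conj_part lam) (Suc k)"
      using l by (simp_all add: length_conj_part part_def[of "conj_part lam"])
    then show "conj_part lam ! k = lam ! k" using part_conj_part[OF lam, of "Suc k"] row[of "Suc k"] by (simp add: part_def)
  qed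
qed

lemma BG_partition_iff:
  "BG_partition p lam \<longleftrightarrow> is_partition lam \<and> self_conjugate lam \<and> bg_free (int p) (arms lam)"
proof (cases "is_partition lam \<and> self_conjugate lam")
  case True
  then have lam: "is_partition lam" and sc: "conj_part lam = lam" by (auto simp: self_conjugate_def)
  define I where "I = {i. 1 \<le> i \<and> i \<le> part lam i}"
  have len: "k \<le> length lam" if "k \<in> I" for k
    using that by (auto simp: I_def part_def split: if_splits)
  then have finI: "finite I" by (intro finite_subset[of I "{..length lam}"]) auto
  have down: "k \<in> I" if "l \<in> I" "1 \<le> k" "k \<le> l" for k l
    using part_antimono[OF lam that(2,3)] that by (auto simp: I_def)
  have pos: "1 \<le> k" if "k \<in> I" for k using that by (simp add: I_def)
  have "kdiag lam = card I"
    unfolding kdiag_def by (rule arg_cong[of _ _ card]) (auto simp: I_def part_def)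
  then have k: "1 \<le> i \<and> i \<le> kdiag lam \<longleftrightarrow> i \<in> I" for i
    using initial_segment[where i = i, OF finI pos down] by simp
  have hook: "p dvd hook lam i i \<longleftrightarrow> int p dvd 2 * bead lam i + 1" if "i \<in> I" for i
  proof -
    have "int (hook lam i i) = 2 * bead lam i + 1" using that by (simp add: hook_def sc bead_def I_def of_nat_diff)
    then show ?thesis by (metis int_dvd_int_iff)
  qed
  have "arms lam = bead lam ` I" using len by (auto simp: arms_def beads_def I_def bead_def)
  then show ?thesis using True k hook unfolding BG_partition_def bg_free_def by auto
qed (auto simp: BG_partition_def)

lemma arms_inj:
  assumes "is_partition lam" "self_conjugate lam" "is_partition mu" "self_conjugate mu" "arms lam = arms mu"
  shows "lam = mu"
proof (rule diagram_inj[OF assms(1,3)])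
  have up: "(i, j) \<in> diagram lam \<longleftrightarrow> (i, j) \<in> diagram mu" if "i \<le> j" for i j
    using diagram_upper_iff[OF assms(1) _ that] diagram_upper_iff[OF assms(3) _ that] assms(5)
    by (cases "1 \<le> i") (auto simp: mem_diagram)
  have "(i, j) \<in> diagram lam \<longleftrightarrow> (i, j) \<in> diagram mu" for i j
    using up[of i j] up[of j i] assms(2,4) self_conjugate_iff[OF assms(1)] self_conjugate_iff[OF assms(3)]
    by (cases "i \<le> j") auto
  then show "diagram lam = diagram mu" by auto
qed

lemma arms_surj:
  assumes finA: "finite A" and nonneg: "\<And>a. a \<in> A \<Longrightarrow> 0 \<le> a"
  obtains lam where "is_partition lam" "self_conjugate lam" "arms lam = A"
proof -
  define N where "N = (\<lambda>c. card {a \<in> A. c \<le> a})"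
  have N_mono: "N d \<le> N c" if "c \<le> d" for c d
    unfolding N_def using that finA by (intro card_mono) auto
  have N_step: "N c = N (c + 1) + (if c \<in> A then 1 else 0)" for c
  proof -
    have "{a \<in> A. c \<le> a} = {a \<in> A. c + 1 \<le> a} \<union> (if c \<in> A then {c} else {})"
      by (auto simp: le_less)
    then have "N c = card ({a \<in> A. c + 1 \<le> a} \<union> (if c \<in> A then {c} else {}))" unfolding N_def by (rule arg_cong)
    also have "\<dots> = N (c + 1) + card (if c \<in> A then {c} else {})"
      unfolding N_def using finA by (intro card_Un_disjoint) auto
    finally show ?thesis by simp
  qed
  \<comment> \<open>\<open>N c\<close> is the row of the last node of content \<open>c\<close>, cf. \<open>diagram_upper_iff\<close>\<close>
  define D where "D = {(i, j). 1 \<le> i \<and> 1 \<le> j \<and> min i j \<le> N \<bar>int j - int i\<bar>}"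
  have memD: "(i, j) \<in> D \<longleftrightarrow> 1 \<le> i \<and> 1 \<le> j \<and> min i j \<le> N \<bar>int j - int i\<bar>" for i j by (simp add: D_def)
  have sym: "(i, j) \<in> D \<longleftrightarrow> (j, i) \<in> D" for i j by (auto simp: memD min.commute abs_minus_commute)
  \<comment> \<open>On and above the diagonal, closure under columns needs \<open>N\<close> to drop
    by at most one between neighbouring diagonals; below it, monotonicity of \<open>N\<close> is
    enough.\<close>
  have up: "(i, j) \<in> D" if h: "1 \<le> i" "(Suc i, j) \<in> D" for i j
  proof (cases "Suc i \<le> j")
    case True
    have "Suc i \<le> N (int j - int (Suc i))" using h(2) True by (simp add: memD)
    also have "\<dots> \<le> N (int j - int i) + 1" using N_step[of "int j - int (Suc i)"] by simp
    finally show ?thesis using True h by (simp add: memD)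
  next
    case False
    have "j \<le> N (int (Suc i) - int j)" using h(2) False by (simp add: memD min_def split: if_splits)
    also have "\<dots> \<le> N (int i - int j)" by (rule N_mono) simp
    finally show ?thesis using False h by (simp add: memD min_def)
  qed
  have "D \<subseteq> {..card A + nat (Max (insert 0 A))} \<times> {..card A + nat (Max (insert 0 A))}"
  proof
    fix x assume "x \<in> D"
    then obtain i j where x: "x = (i, j)" and h: "1 \<le> min i j" "min i j \<le> N \<bar>int j - int i\<bar>"
      by (cases x) (auto simp: memD)
    have 1: "min i j \<le> card A" using h(2) N_mono card_mono[OF finA, of "{a \<in> A. \<bar>int j - int i\<bar> \<le> a}"]
      by (simp add: N_def)
    have "N \<bar>int j - int i\<bar> \<noteq> 0" using h by linarith
    then have "{a \<in> A. \<bar>int j - int i\<bar> \<le> a} \<noteq> {}" unfolding N_def by (metis card.empty)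
    then have "\<bar>int j - int i\<bar> \<le> Max (insert 0 A)" using finA by (auto intro: order_trans Max_ge)
    then show "x \<in> {..card A + nat (Max (insert 0 A))} \<times> {..card A + nat (Max (insert 0 A))}"
      using 1 unfolding x by auto
  qed
  then have finD: "finite D" by (rule finite_subset) simp
  have "young D" unfolding young_def
  proof (intro conjI allI impI)
    fix i j assume "(i, j) \<in> D"
    then show "1 \<le> i" "1 \<le> j" by (simp_all add: memD)
  next
    fix i j :: nat assume "1 \<le> j" "(i, Suc j) \<in> D"
    then show "(i, j) \<in> D" using up[of j i] sym by blast
  qed (use up finD in blast)+
  then have lam: "is_partition (of_diagram D)" "diagram (of_diagram D) = D" using of_diagram_young by auto
  have "self_conjugate (of_diagram D)" using self_conjugate_iff[OF lam(1)] sym lam(2) by simp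
  moreover have "c \<in> arms (of_diagram D) \<longleftrightarrow> c \<in> A" for c
  proof
    assume "c \<in> arms (of_diagram D)"
    then obtain i where "0 \<le> c" "1 \<le> i" "(i, i + nat c) \<in> D" "(i, Suc (i + nat c)) \<notin> D"
      unfolding arms_iff lam(2) by blast
    then have "i \<le> N c" "\<not> i \<le> N (c + 1)" by (simp_all add: memD add.commute)
    then show "c \<in> A" using N_step[of c] by (auto split: if_splits)
  next
    assume c: "c \<in> A"
    then have "0 \<le> c" "N c = N (c + 1) + 1" using nonneg N_step[of c] by auto
    then have "(N c, N c + nat c) \<in> D" "(N c, Suc (N c + nat c)) \<notin> D" "1 \<le> N c" by (simp_all add: memD add.commute)
    then show "c \<in> arms (of_diagram D)" unfolding arms_iff lam(2) using \<open>0 \<le> c\<close> by blast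
  qed
  ultimately show thesis using that lam(1) by blast
qed

section \<open>The p-rim* of a self-conjugate partition\<close>

locale p_rim_star_removal = p_rim_removal +
  assumes sc: "self_conjugate lam"
begin

definition upper_starts :: "int set" where
  "upper_starts = {s\<in>S. 0 \<le> s}"

lemma sym: "(i, j) \<in> diagram lam \<longleftrightarrow> (j, i) \<in> diagram lam"
  using self_conjugate_iff[OF lam] sc by blast

lemma chain_arms: "chain (int p) (arms lam) upper_starts"
proof -
  have "{x \<in> beads lam. -1 < x} = arms lam" "{s\<in>S. -1 < s} = upper_starts" by (auto simp: arms_def upper_starts_def)
  then show ?thesis using chain_restrict_above[OF S, of "-1"] by simp
qed

lemma U_mem: "x \<in> U_set p lam \<longleftrightarrow> x \<in> p_rim p lam \<and> 0 \<le> content x"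
  by (cases x) (simp add: U_set_def)

lemma card_U: "int (card (U_set p lam)) = (\<Sum>s\<in>upper_starts. min (int p) (s + 1))"
proof -
  have "U_set p lam = {x \<in> rim lam. 0 \<le> content x \<and> (\<exists>t\<in>S. t - int p < content x \<and> content x \<le> t)}"
    unfolding set_eq_iff U_mem p_rim_mem by blast
  then show ?thesis using rim_window_card[OF lam ne _ S, of 0] p2 ne by (simp add: upper_starts_def Suc_le_eq)
qed

lemma p_rim_sub: "p_rim p lam \<subseteq> diagram lam"
  using p_rim_mem by (auto simp: rim_def)

lemma finite_U: "finite (U_set p lam)"
proof (rule finite_subset)
  show "U_set p lam \<subseteq> diagram lam" using p_rim_sub by (auto simp: U_set_def)
qed (rule youngD(1)[OF young_diagram[OF lam]])

text \<open>Inclusion and exclusion for the upper half and its transpose. They meet in the rim node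
  of content 0, which belongs to the p-rim exactly when some start lies in the window from 0 to
  \<open>p - 1\<close>.\<close>

lemma card_star: "int (card (p_rim_star p lam)) = star_size (int p) upper_starts"
proof -
  let ?U = "U_set p lam" and ?s = "\<lambda>(i, j). (j, i)"
  have "inj_on ?s ?U" by (auto simp: inj_on_def)
  then have "card (?s ` ?U) = card ?U" by (rule card_image)
  then have "2 * card ?U = card (p_rim_star p lam) + card (?U \<inter> ?s ` ?U)"
    unfolding p_rim_star_def using card_Un_Int[OF finite_U finite_imageI[OF finite_U], of ?s] by simp
  moreover have diag: "?U \<inter> ?s ` ?U = {x \<in> p_rim p lam. content x = 0}"
    unfolding U_set_def by (auto simp: image_iff)
  have "int (card {x \<in> p_rim p lam. content x = 0}) = star_eps (int p) upper_starts"
  proof (cases "\<exists>s\<in>upper_starts. s < int p")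
    case True
    then obtain s where s: "s \<in> S" "0 \<le> s" "s < int p" by (auto simp: upper_starts_def)
    obtain x where x: "x \<in> rim lam" "content x = 0"
      using rim_exists[OF lam ne, of 0] part_1_pos[OF lam ne] ne by (auto simp: Suc_le_eq)
    have "x \<in> p_rim p lam" unfolding p_rim_mem using x s by (intro conjI bexI[of _ s]) auto
    moreover have "y = x" if "y \<in> p_rim p lam" "content y = 0" for y
      using rim_unique[OF lam _ x(1)] that x(2) unfolding p_rim_mem by auto
    ultimately have "{x \<in> p_rim p lam. content x = 0} = {x}" using x(2) by blast
    then show ?thesis using True by (simp add: star_eps_def)
  next
    case False
    then have e: "{x \<in> p_rim p lam. content x = 0} = {}" unfolding p_rim_mem by (force simp: upper_starts_def)
    show ?thesis unfolding e using False by (simp add: star_eps_def)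
  qed
  ultimately show ?thesis using card_U unfolding star_size_def diag by simp
qed

lemma star_mem: "(i, j) \<in> p_rim_star p lam \<longleftrightarrow> (if i \<le> j then (i, j) \<in> p_rim p lam else (j, i) \<in> p_rim p lam)"
  unfolding p_rim_star_def U_set_def by (auto simp: image_iff)

lemma star_removed_upper:
  "(i, j) \<in> diagram lam - p_rim_star p lam \<longleftrightarrow>
    (if i \<le> j then (i, j) \<in> diagram lam - p_rim p lam else (j, i) \<in> diagram lam - p_rim p lam)"
  using star_mem sym by auto

lemma young_star_removed: "young (diagram lam - p_rim_star p lam)"
proof -
  let ?D = "diagram lam - p_rim_star p lam"
  note y = youngD[OF young_removed]
  have symD: "(i, j) \<in> ?D \<longleftrightarrow> (j, i) \<in> ?D" for i j unfolding star_removed_upper by (auto simp: sym)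
  \<comment> \<open>On and above the diagonal this is column closure of the diagram without its
    p-rim. Below it, transposition turns it into row closure.\<close>
  have up: "(i, j) \<in> ?D" if h: "1 \<le> i" "(Suc i, j) \<in> ?D" for i j
    using h y(4)[of i j] y(5)[of j i] unfolding star_removed_upper
    by (cases "Suc i \<le> j"; cases "i \<le> j") (auto simp: le_antisym not_less_eq_eq dest: y(3) y(4)[of i])
  show ?thesis unfolding young_def
  proof (intro conjI allI impI)
    show "finite ?D" using youngD(1)[OF young_diagram[OF lam]] by simp
    fix i j assume "(i, j) \<in> ?D"
    then have "(i, j) \<in> diagram lam" by blast
    then show "1 \<le> i" "1 \<le> j" by (simp_all add: mem_diagram)
  next
    fix i j :: nat assume "1 \<le> j" "(i, Suc j) \<in> ?D"
    then show "(i, j) \<in> ?D" using up[of j i] symD by blast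
  qed (use up in blast)
qed

lemma remove_star_partition: "is_partition (remove_p_rim_star p lam)"
  and diagram_remove_star: "diagram (remove_p_rim_star p lam) = diagram lam - p_rim_star p lam"
  unfolding remove_p_rim_star_def using of_diagram_young[OF young_star_removed] by auto

lemma self_conjugate_remove_star: "self_conjugate (remove_p_rim_star p lam)"
  unfolding self_conjugate_iff[OF remove_star_partition] diagram_remove_star star_removed_upper
  by (auto simp: sym)

text \<open>Arms see only nodes on and above the diagonal, where removing the p-rim and removing the
  p-rim* agree. Negative starts stay negative, so they do not affect the result.\<close>

lemma arms_remove_star: "arms (remove_p_rim_star p lam) = {y \<in> shift (int p) (arms lam) upper_starts. 0 \<le> y}"
proof -
  have "arms (remove_p_rim_star p lam) = arms (remove_p_rim p lam)"
    unfolding set_eq_iff arms_iff diagram_remove diagram_remove_star star_removed_upper by simp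
  also have "\<dots> = {b \<in> max (- int (length lam)) ` shift (int p) (beads lam) S. 0 \<le> b}"
    unfolding arms_eq[OF length_remove] beads_remove ..
  also have "\<dots> = {b \<in> shift (int p) (beads lam) S. 0 \<le> b}"
    using ne by (auto simp: max_def image_iff split: if_splits)
  also have "\<dots> = {y \<in> shift (int p) (arms lam) upper_starts. 0 \<le> y}"
    by (auto simp: shift_def arms_def upper_starts_def)
  finally show ?thesis .
qed

lemma star_step_remove: "star_step (int p) (arms lam) upper_starts (arms (remove_p_rim_star p lam))"
proof
  show "arms lam \<noteq> {}"
  proof -
    have "1 \<in> {1..length lam}" using ne by (simp add: Suc_le_eq)
    then have "bead lam 1 \<in> beads lam" unfolding beads_def by (rule imageI)
    moreover have "0 \<le> bead lam 1" using part_1_pos[OF lam ne] by (simp add: bead_def)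
    ultimately have "bead lam 1 \<in> arms lam" by (simp add: arms_def)
    then show ?thesis by blast
  qed
qed (use p2 chain_arms arms_nonneg arms_remove_star in auto)

end

section \<open>Symbols\<close>

text \<open>The default \<open>(0, 0)\<close> is the column of the empty partition, so the last
  column of a symbol obeys the same link condition as the others.\<close>

definition symbol_head :: "(nat \<times> nat) list \<Rightarrow> nat \<times> nat" where
  "symbol_head xs = (case xs of [] \<Rightarrow> (0, 0) | x # _ \<Rightarrow> x)"

lemma symbol_head_simps [simp]: "symbol_head [] = (0, 0)" "symbol_head (x # xs) = x"
  by (simp_all add: symbol_head_def)

primrec linked :: "(nat \<times> nat \<Rightarrow> nat \<times> nat \<Rightarrow> bool) \<Rightarrow> (nat \<times> nat) list \<Rightarrow> bool" where
  "linked L [] \<longleftrightarrow> True"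
| "linked L (x # xs) \<longleftrightarrow> linked L xs \<and> L x (symbol_head xs)"

text \<open>Common frame of both symbols: \<open>f\<close> removes a p-rim or p-rim*,
  \<open>g\<close> records the column, and the decrease in size makes the iteration end.\<close>

locale peeling =
  fixes C :: "nat list \<Rightarrow> bool" and f :: "nat list \<Rightarrow> nat list" and g :: "nat list \<Rightarrow> nat \<times> nat"
  assumes C_Nil: "C []" and g_Nil: "g [] = (0, 0)"
    and C_step: "C lam \<Longrightarrow> lam \<noteq> [] \<Longrightarrow> C (f lam)"
    and sum_step: "C lam \<Longrightarrow> lam \<noteq> [] \<Longrightarrow> sum_list lam = fst (g lam) + sum_list (f lam)"
    and g_pos: "C lam \<Longrightarrow> lam \<noteq> [] \<Longrightarrow> 0 < fst (g lam)"
begin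

definition "symbol lam = map (\<lambda>i. g ((f ^^ i) lam)) [0..<(LEAST i. (f ^^ i) lam = [])]"

lemma peel_induct [consumes 1, case_names Nil step]:
  assumes "C lam" "P []" "\<And>lam. C lam \<Longrightarrow> lam \<noteq> [] \<Longrightarrow> P (f lam) \<Longrightarrow> P lam"
  shows "P lam"
  using assms(1)
proof (induction "sum_list lam" arbitrary: lam rule: less_induct)
  case less
  show ?case
  proof (cases "lam = []")
    case False
    then show ?thesis using less assms(3) C_step sum_step[of lam] g_pos[of lam] by simp
  qed (simp add: assms(2))
qed

lemma peel_ends: "C lam \<Longrightarrow> \<exists>i. (f ^^ i) lam = []"
proof (induction rule: peel_induct)
  case Nil
  show ?case by (rule exI[of _ 0]) simp
next
  case (step lam)
  then obtain i where "(f ^^ i) (f lam) = []" by blast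
  then show ?case by (intro exI[of _ "Suc i"]) (simp add: funpow_swap1)
qed

lemma symbol_Nil [simp]: "symbol [] = []"
proof -
  have "(LEAST i. (f ^^ i) [] = []) = 0" by (rule Least_equality) simp_all
  then show ?thesis by (simp add: symbol_def)
qed

lemma symbol_Cons:
  assumes "C lam" "lam \<noteq> []" shows "symbol lam = g lam # symbol (f lam)"
proof -
  obtain i where "(f ^^ i) lam = []" using peel_ends assms by blast
  then have "(LEAST i. (f ^^ i) lam = []) = Suc (LEAST i. (f ^^ Suc i) lam = [])"
    using assms(2) by (intro Least_Suc) auto
  then show ?thesis unfolding symbol_def by (simp add: map_upt_Suc funpow_swap1 del: upt_Suc)
qed

lemma symbol_eq_Nil: "C lam \<Longrightarrow> symbol lam = [] \<longleftrightarrow> lam = []"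
  by (cases "lam = []") (auto simp: symbol_Cons)

lemma head_symbol: "C lam \<Longrightarrow> symbol_head (symbol lam) = g lam"
  by (cases "lam = []") (auto simp: symbol_Cons g_Nil)

lemma sum_symbol: "C lam \<Longrightarrow> sum_list (map fst (symbol lam)) = sum_list lam"
  by (induction rule: peel_induct) (simp_all add: symbol_Cons sum_step)

lemma linked_symbol:
  assumes "\<And>lam. C lam \<Longrightarrow> lam \<noteq> [] \<Longrightarrow> L (g lam) (g (f lam))" "C lam"
  shows "linked L (symbol lam)"
  using assms(2) by (induction rule: peel_induct) (simp_all add: symbol_Cons assms(1) head_symbol C_step)

lemma symbol_inj:
  assumes "\<And>lam mu. C lam \<Longrightarrow> C mu \<Longrightarrow> lam \<noteq> [] \<Longrightarrow> mu \<noteq> [] \<Longrightarrow> g lam = g mu \<Longrightarrow> f lam = f mu \<Longrightarrow> lam = mu"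
  shows "inj_on symbol {lam. C lam}"
proof -
  have "\<forall>mu. C mu \<longrightarrow> symbol lam = symbol mu \<longrightarrow> lam = mu" if "C lam" for lam
    using that
  proof (induction rule: peel_induct)
    case Nil
    show ?case by (metis symbol_Nil symbol_eq_Nil)
  next
    case (step lam)
    show ?case
    proof (intro allI impI)
      fix mu assume mu: "C mu" "symbol lam = symbol mu"
      then have "mu \<noteq> []" using step symbol_eq_Nil by metis
      then have g: "g lam = g mu" and s: "symbol (f lam) = symbol (f mu)"
        using mu symbol_Cons[OF mu(1)] symbol_Cons[OF step(1,2)] by simp_all
      have "f lam = f mu" using step(3) s C_step[OF mu(1) \<open>mu \<noteq> []\<close>] by blast
      then show "lam = mu" using assms[OF step(1) mu(1) step(2)] \<open>mu \<noteq> []\<close> g by simp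
    qed
  qed
  then show ?thesis by (intro inj_onI) simp
qed

lemma symbol_surj:
  assumes "\<And>x mu. C mu \<Longrightarrow> L x (g mu) \<Longrightarrow> \<exists>lam. C lam \<and> lam \<noteq> [] \<and> g lam = x \<and> f lam = mu"
  shows "linked L xs \<Longrightarrow> \<exists>lam. C lam \<and> symbol lam = xs"
proof (induction xs)
  case Nil
  show ?case using C_Nil by (intro exI[of _ "[]"]) simp
next
  case (Cons x xs)
  then obtain mu where mu: "C mu" "symbol mu = xs" by auto
  then have "L x (g mu)" using Cons.prems head_symbol by force
  then obtain lam where "C lam" "lam \<noteq> []" "g lam = x" "f lam = mu" using assms mu by blast
  then show ?case using mu by (intro exI[of _ lam]) (simp add: symbol_Cons)
qed

lemma symbol_bij:
  assumes "\<And>lam. C lam \<Longrightarrow> lam \<noteq> [] \<Longrightarrow> L (g lam) (g (f lam))"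
    and "\<And>lam mu. C lam \<Longrightarrow> C mu \<Longrightarrow> lam \<noteq> [] \<Longrightarrow> mu \<noteq> [] \<Longrightarrow> g lam = g mu \<Longrightarrow> f lam = f mu \<Longrightarrow> lam = mu"
    and "\<And>x mu. C mu \<Longrightarrow> L x (g mu) \<Longrightarrow> \<exists>lam. C lam \<and> lam \<noteq> [] \<and> g lam = x \<and> f lam = mu"
  shows "bij_betw symbol {lam. C lam} {xs. linked L xs}"
  unfolding bij_betw_def
proof
  show "inj_on symbol {lam. C lam}" using assms(2) by (rule symbol_inj)
  show "symbol ` {lam. C lam} = {xs. linked L xs}"
    using linked_symbol[of L, OF assms(1)] symbol_surj[of L, OF assms(3)] by blast
qed

end

section \<open>Columns of Mullineux symbols\<close>

lemma p_rim_Nil [simp]: "p_rim p [] = {}"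
  by (simp add: p_rim_def rim_list_def part_def)

lemma p_rim_star_Nil [simp]: "p_rim_star p [] = {}" "U_set p [] = {}"
  by (simp_all add: p_rim_star_def U_set_def)

lemma is_partition_Nil [simp]: "is_partition []"
  by (simp add: is_partition_def)

lemma p_rim_removal_exists:
  assumes "2 \<le> p" "is_partition lam" "lam \<noteq> []"
  obtains S where "p_rim_removal p lam S"
  using chain_exists[OF finite_beads, of "int p" lam] assms by (auto simp: p_rim_removal_def)

lemma p_rim_chain:
  assumes "2 \<le> p" "is_partition lam"
  obtains R where "chain (int p) (bset lam) R" "int (card (p_rim p lam)) = sum (min (int p)) R"
proof (cases "lam = []")
  case True
  then show thesis using that[of "{}"] by (simp add: chain_def)
next
  case False
  then obtain S where "p_rim_removal p lam S" using p_rim_removal_exists assms by blast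
  then interpret p_rim_removal p lam S .
  interpret M: mullineux_step "int p" "bset lam" "(\<lambda>b. b + int (length lam)) ` S"
    "int (length lam) - int (length (remove_p_rim p lam))" "bset (remove_p_rim p lam)"
    by (rule mullineux_step_remove)
  show thesis using that[OF M.chainS] card_p_rim_bset by simp
qed

lemma mullineux_step_peel:
  assumes "2 \<le> p" "is_partition lam" "lam \<noteq> []"
  obtains R where "mullineux_step (int p) (bset lam) R
      (int (length lam) - int (length (remove_p_rim p lam))) (bset (remove_p_rim p lam))"
    "int (card (p_rim p lam)) = sum (min (int p)) R"
proof -
  obtain S where "p_rim_removal p lam S" using p_rim_removal_exists assms by blast
  then interpret p_rim_removal p lam S .
  show thesis using that mullineux_step_remove card_p_rim_bset by blast
qed

lemma remove_p_rim_partition: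
  assumes "2 \<le> p" "is_partition lam" "lam \<noteq> []"
  shows "is_partition (remove_p_rim p lam)"
    "sum_list lam = card (p_rim p lam) + sum_list (remove_p_rim p lam)"
proof -
  obtain S where "p_rim_removal p lam S" using p_rim_removal_exists assms by blast
  then interpret p_rim_removal p lam S .
  show "is_partition (remove_p_rim p lam)" by (rule remove_partition)
  have fin: "finite (diagram lam)" using youngD(1)[OF young_diagram[OF lam]] .
  have sub: "p_rim p lam \<subseteq> diagram lam" using p_rim_mem by (auto simp: rim_def)
  then have "card (diagram lam - p_rim p lam) = card (diagram lam) - card (p_rim p lam)"
    using fin finite_subset by (intro card_Diff_subset) blast+
  then show "sum_list lam = card (p_rim p lam) + sum_list (remove_p_rim p lam)"
    using card_mono[OF fin sub] sum_list_card[OF lam] sum_list_card[OF remove_partition]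
    by (simp add: diagram_remove)
qed

text \<open>The first pair of inequalities comes from \<open>length_drop_bounds\<close>, the second
  from \<open>mullineux_step.size_drop_bounds\<close>. The value of \<open>a - a'\<close> ranges
  over an interval of length \<open>p\<close>, so a residue modulo \<open>p\<close> determines
  it.\<close>

fun mull_link :: "nat \<Rightarrow> nat \<times> nat \<Rightarrow> nat \<times> nat \<Rightarrow> bool" where
  "mull_link p (a, r) (a', r') \<longleftrightarrow> 1 \<le> r \<and>
     int (mull_eps p a) \<le> int r - int r' \<and> int r - int r' < int p + int (mull_eps p a) \<and>
     int r - int r' + int (mull_eps p a') \<le> int a - int a' \<and>
     int a - int a' < int p + (int r - int r') + int (mull_eps p a')"

text \<open>The row entry is determined by \<open>a\<close>. The interval for \<open>a - a'\<close>
  has length \<open>2 * p\<close>, matching what a residue modulo \<open>2 * p\<close> can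
  determine.\<close>

fun star_link :: "nat \<Rightarrow> nat \<times> nat \<Rightarrow> nat \<times> nat \<Rightarrow> bool" where
  "star_link p (a, r) (a', r') \<longleftrightarrow> 1 \<le> a \<and> (even a \<longleftrightarrow> p dvd a) \<and> 2 * r = a + mull_eps p a \<and>
     int (mull_eps p a) + int (mull_eps p a') \<le> int a - int a' \<and>
     int a - int a' < 2 * int p + int (mull_eps p a) + int (mull_eps p a')"

lemma chain_eps_nat: "chain_eps (int p) (int a) = int (mull_eps p a)"
  by (simp add: chain_eps_def mull_eps_def)

lemma p_regular_remove:
  assumes "2 \<le> p" "p_regular p lam" "lam \<noteq> []"
  shows "p_regular p (remove_p_rim p lam)"
proof -
  have r: "1 \<le> p" "is_partition lam" "run_free (int p) (bset lam)" using assms p_regular_iff[of p lam] by auto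
  obtain R where "mullineux_step (int p) (bset lam) R
      (int (length lam) - int (length (remove_p_rim p lam))) (bset (remove_p_rim p lam))"
    using mullineux_step_peel[OF assms(1) r(2) assms(3)] .
  then show ?thesis
    using mullineux_step.run_free_next r(3) p_regular_iff[OF r(1)] remove_p_rim_partition(1)[OF assms(1) r(2) assms(3)]
    by blast
qed

lemma card_p_rim_pos:
  assumes "2 \<le> p" "is_partition lam" "lam \<noteq> []" shows "0 < card (p_rim p lam)"
proof -
  obtain R where R: "mullineux_step (int p) (bset lam) R
      (int (length lam) - int (length (remove_p_rim p lam))) (bset (remove_p_rim p lam))"
    "int (card (p_rim p lam)) = sum (min (int p)) R"
    using mullineux_step_peel[OF assms] .
  interpret mullineux_step "int p" "bset lam" R
    "int (length lam) - int (length (remove_p_rim p lam))" "bset (remove_p_rim p lam)" by (rule R(1))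
  have "0 < sum (min (int p)) R"
  proof (rule sum_pos)
    fix s assume "s \<in> R"
    then show "0 < min (int p) s" using chain_sub[OF chainS] posX[of s] assms(1) by auto
  qed (fact finS neS)+
  then show ?thesis using R(2) by simp
qed

lemma mod_eq_window:
  fixes a b :: int
  assumes "a mod p = b mod p" "c \<le> a" "a < c + p" "c \<le> b" "b < c + p"
  shows "a = b"
proof -
  have "p dvd a - b" using assms(1) by (simp add: mod_eq_dvd_iff)
  then show ?thesis using dvd_imp_le_int[of "a - b" p] assms by (cases "a = b") auto
qed

text \<open>\<open>m\<close> is the least nonnegative integer missing from the set, because the
  elements of \<open>Z\<close> are positive.\<close>

lemma prefix_decompose:
  fixes m m' :: int
  assumes eq: "{0..<m} \<union> (\<lambda>z. z + m) ` Z = {0..<m'} \<union> (\<lambda>z. z + m') ` Z'"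
    and "0 \<le> m" "0 \<le> m'" "\<And>z. z \<in> Z \<Longrightarrow> 1 \<le> z" "\<And>z. z \<in> Z' \<Longrightarrow> 1 \<le> z"
  shows "m = m'" "Z = Z'"
proof -
  have "m \<notin> {0..<m} \<union> (\<lambda>z. z + m) ` Z" "m' \<notin> {0..<m'} \<union> (\<lambda>z. z + m') ` Z'"
    using assms(4,5) by fastforce+
  then have "m \<notin> {0..<m'}" "m' \<notin> {0..<m}" using eq by blast+
  then show mm: "m = m'" using assms(2,3) by auto
  have "(\<lambda>z. z + m) ` Z = {y \<in> {0..<m} \<union> (\<lambda>z. z + m) ` Z. m < y}" using assms(4) by fastforce
  also have "\<dots> = {y \<in> {0..<m'} \<union> (\<lambda>z. z + m') ` Z'. m' < y}" unfolding eq unfolding mm ..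
  also have "\<dots> = (\<lambda>z. z + m') ` Z'" using assms(5) by fastforce
  finally show "Z = Z'" unfolding mm by (simp add: inj_image_eq_iff inj_def)
qed

lemma mull_link_remove:
  assumes p: "2 \<le> p" and lam: "p_regular p lam" "lam \<noteq> []"
  shows "mull_link p (card (p_rim p lam), length lam)
    (card (p_rim p (remove_p_rim p lam)), length (remove_p_rim p lam))"
proof -
  have r: "is_partition lam" "run_free (int p) (bset lam)" using assms p_regular_iff[of p lam] by auto
  obtain S where S: "mullineux_step (int p) (bset lam) S
      (int (length lam) - int (length (remove_p_rim p lam))) (bset (remove_p_rim p lam))"
    "int (card (p_rim p lam)) = sum (min (int p)) S"
    using mullineux_step_peel[OF p r(1) lam(2)] .
  obtain R where R: "chain (int p) (bset (remove_p_rim p lam)) R"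
    "int (card (p_rim p (remove_p_rim p lam))) = sum (min (int p)) R"
    using p_rim_chain[OF p remove_p_rim_partition(1)[OF p r(1) lam(2)]] .
  note b = mullineux_step.length_drop_bounds[OF S(1) r(2)] mullineux_step.size_drop_bounds[OF S(1) r(2) R(1)]
  show ?thesis using b lam(2) unfolding S(2)[symmetric] R(2)[symmetric] chain_eps_nat
    by (simp add: Suc_le_eq)
qed

lemma remove_p_rim_inj:
  assumes p: "2 \<le> p" and lam: "is_partition lam" "lam \<noteq> []" and mu: "is_partition mu" "mu \<noteq> []"
    and eq: "card (p_rim p lam) = card (p_rim p mu)" "length lam = length mu"
      "remove_p_rim p lam = remove_p_rim p mu"
  shows "lam = mu"
proof -
  obtain S where S: "mullineux_step (int p) (bset lam) S
      (int (length lam) - int (length (remove_p_rim p lam))) (bset (remove_p_rim p lam))"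
    "int (card (p_rim p lam)) = sum (min (int p)) S"
    using mullineux_step_peel[OF p lam] .
  obtain R where R: "mullineux_step (int p) (bset mu) R
      (int (length mu) - int (length (remove_p_rim p mu))) (bset (remove_p_rim p mu))"
    "int (card (p_rim p mu)) = sum (min (int p)) R"
    using mullineux_step_peel[OF p mu] .
  have "bset lam = bset mu" using mullineux_step_inj[OF S(1)] R S(2) eq by metis
  then show ?thesis using bset_inj lam mu by blast
qed

text \<open>\<open>mullineux_step_exists\<close> yields a beta-set whose node count is right only
  modulo \<open>p\<close>. The true count obeys \<open>mull_link_remove\<close>, so it lies in the
  same interval of length \<open>p\<close> as \<open>a\<close>, and the two are equal.\<close>

lemma remove_p_rim_surj:
  assumes p: "2 \<le> p" and mu: "p_regular p mu" and link: "mull_link p (a, r) (card (p_rim p mu), length mu)"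
  shows "\<exists>lam. p_regular p lam \<and> lam \<noteq> [] \<and> (card (p_rim p lam), length lam) = (a, r) \<and> remove_p_rim p lam = mu"
proof -
  let ?m = "int r - int (length mu)"
  have m: "is_partition mu" "run_free (int p) (bset mu)" using mu p p_regular_iff[of p mu] by auto
  have pos: "\<And>z. z \<in> bset mu \<Longrightarrow> 1 \<le> z" using bset_bounds[OF m(1)] by blast
  have ne: "1 \<le> ?m \<or> bset mu \<noteq> {}" using link card_bset[OF m(1)] by (cases "bset mu = {}") auto
  obtain X S where XS: "mullineux_step (int p) X S ?m (bset mu)" "run_free (int p) X"
    "sum (min (int p)) S mod int p = int a mod int p" "int (card X) = ?m + int (card (bset mu))"
    using mullineux_step_exists[of "int p" "bset mu" "int a" ?m] p pos m(2) link ne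
    unfolding chain_eps_nat by (metis finite_bset mull_link.simps of_nat_le_iff of_nat_numeral)
  interpret M: mullineux_step "int p" X S ?m "bset mu" by (rule XS(1))
  obtain lam where lam: "is_partition lam" "bset lam = X" using bset_surj[OF M.finX M.posX] by blast
  have len: "length lam = r" using card_bset[OF lam(1)] lam(2) XS(4) card_bset[OF m(1)] by simp
  have lne: "lam \<noteq> []" using lam(2) M.neX by auto
  have reg: "p_regular p lam" using p_regular_iff[of p lam] p lam XS(2) by simp
  obtain S' where S': "mullineux_step (int p) (bset lam) S'
      (int (length lam) - int (length (remove_p_rim p lam))) (bset (remove_p_rim p lam))"
    "int (card (p_rim p lam)) = sum (min (int p)) S'"
    using mullineux_step_peel[OF p lam(1) lne] .
  interpret N: mullineux_step "int p" "bset lam" S'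
    "int (length lam) - int (length (remove_p_rim p lam))" "bset (remove_p_rim p lam)" by (rule S'(1))
  have SS: "S' = S" using chain_unique[OF N.chainS _ finite_bset] M.chainS lam(2) by simp
  have "bset (remove_p_rim p lam) = bset mu"
    using prefix_decompose(2)[OF _ N.m0 M.m0 N.posZ M.posZ] N.step M.step SS lam(2) by metis
  then have rem: "remove_p_rim p lam = mu"
    using bset_inj remove_p_rim_partition(1)[OF p lam(1) lne] m(1) by blast
  have "int (card (p_rim p lam)) - int (card (p_rim p mu)) = int a - int (card (p_rim p mu))"
  proof (rule mod_eq_window)
    show "(int (card (p_rim p lam)) - int (card (p_rim p mu))) mod int p = (int a - int (card (p_rim p mu))) mod int p"
      using XS(3) S'(2) SS by (metis mod_diff_left_eq)
  next
    let ?c = "?m + int (mull_eps p (card (p_rim p mu)))"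
    show "?c \<le> int (card (p_rim p lam)) - int (card (p_rim p mu))"
      "int (card (p_rim p lam)) - int (card (p_rim p mu)) < ?c + int p"
      using mull_link_remove[OF p reg lne] unfolding rem len by auto
    show "?c \<le> int a - int (card (p_rim p mu))" "int a - int (card (p_rim p mu)) < ?c + int p"
      using link by auto
  qed
  then show ?thesis using reg lne len rem by (intro exI[of _ lam]) simp
qed

lemma mull_peeling:
  assumes "2 \<le> p"
  shows "peeling (p_regular p) (remove_p_rim p) (\<lambda>mu. (card (p_rim p mu), length mu))"
proof
  show "p_regular p []" by (simp add: p_regular_def)
  fix lam assume lam: "p_regular p lam" "lam \<noteq> []"
  then have pt: "is_partition lam" by (simp add: p_regular_def)
  show "p_regular p (remove_p_rim p lam)" using p_regular_remove[OF assms lam] .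
  show "sum_list lam = fst (card (p_rim p lam), length lam) + sum_list (remove_p_rim p lam)"
    "0 < fst (card (p_rim p lam), length lam)"
    using remove_p_rim_partition[OF assms pt lam(2)] card_p_rim_pos[OF assms pt lam(2)] by auto
qed simp

lemma mull_symbol_peeling:
  assumes "2 \<le> p"
  shows "mull_symbol p = peeling.symbol (remove_p_rim p) (\<lambda>mu. (card (p_rim p mu), length mu))"
  unfolding peeling.symbol_def[OF mull_peeling[OF assms]] mull_symbol_def Let_def ..

lemma mull_symbol_bij:
  assumes "2 \<le> p"
  shows "bij_betw (mull_symbol p) {lam. p_regular p lam} {xs. linked (mull_link p) xs}"
  unfolding mull_symbol_peeling[OF assms]
proof (rule peeling.symbol_bij[OF mull_peeling[OF assms]])
  fix lam mu assume "p_regular p lam" "p_regular p mu" "lam \<noteq> []" "mu \<noteq> []"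
    "(card (p_rim p lam), length lam) = (card (p_rim p mu), length mu)" "remove_p_rim p lam = remove_p_rim p mu"
  then show "lam = mu" using remove_p_rim_inj[OF assms, of lam mu] by (simp add: p_regular_def)
next
  fix x mu assume "p_regular p mu" "mull_link p x (card (p_rim p mu), length mu)"
  then show "\<exists>lam. p_regular p lam \<and> lam \<noteq> [] \<and> (card (p_rim p lam), length lam) = x \<and> remove_p_rim p lam = mu"
    using remove_p_rim_surj[OF assms, of mu "fst x" "snd x"] by simp
qed (rule mull_link_remove[OF assms])

lemma sum_mull_symbol:
  assumes "2 \<le> p" "p_regular p lam" shows "sum_list (map fst (mull_symbol p lam)) = sum_list lam"
  unfolding mull_symbol_peeling[OF assms(1)] using peeling.sum_symbol[OF mull_peeling] assms by blast

section \<open>Columns of BG-symbols\<close>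

lemma star_chain:
  assumes "2 \<le> p" "is_partition lam" "self_conjugate lam"
  obtains R where "chain (int p) (arms lam) R" "int (card (p_rim_star p lam)) = star_size (int p) R"
    "2 * int (card (U_set p lam)) = star_size (int p) R + star_eps (int p) R"
    "lam \<noteq> [] \<Longrightarrow> star_step (int p) (arms lam) R (arms (remove_p_rim_star p lam))"
proof (cases "lam = []")
  case True
  then have "arms lam = {}" by (simp add: arms_def beads_def)
  then show thesis using that[of "{}"] True by (simp add: chain_def)
next
  case False
  then obtain S where "p_rim_removal p lam S" using p_rim_removal_exists assms by blast
  then interpret p_rim_star_removal p lam S
    using assms(3) by (simp add: p_rim_star_removal_def p_rim_star_removal_axioms_def)
  show thesis
    using that[OF chain_arms card_star] card_U star_step_remove by (simp add: star_size_def)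
qed

lemma remove_p_rim_star_partition:
  assumes "2 \<le> p" "is_partition lam" "self_conjugate lam" "lam \<noteq> []"
  shows "is_partition (remove_p_rim_star p lam)" "self_conjugate (remove_p_rim_star p lam)"
    "sum_list lam = card (p_rim_star p lam) + sum_list (remove_p_rim_star p lam)"
proof -
  obtain S where "p_rim_removal p lam S" using p_rim_removal_exists assms by blast
  then interpret p_rim_star_removal p lam S
    using assms(3) by (simp add: p_rim_star_removal_def p_rim_star_removal_axioms_def)
  show "is_partition (remove_p_rim_star p lam)" "self_conjugate (remove_p_rim_star p lam)"
    by (rule remove_star_partition self_conjugate_remove_star)+
  have fin: "finite (diagram lam)" using youngD(1)[OF young_diagram[OF lam]] .
  have sub: "p_rim_star p lam \<subseteq> diagram lam"
    using p_rim_sub sym unfolding p_rim_star_def U_set_def by auto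
  then have "card (diagram lam - p_rim_star p lam) = card (diagram lam) - card (p_rim_star p lam)"
    using fin finite_subset by (intro card_Diff_subset) blast+
  then show "sum_list lam = card (p_rim_star p lam) + sum_list (remove_p_rim_star p lam)"
    using card_mono[OF fin sub] sum_list_card[OF lam] sum_list_card[OF remove_star_partition]
    by (simp add: diagram_remove_star)
qed

lemma BG_star_chain:
  assumes "2 \<le> p" "BG_partition p lam"
  obtains R where "chain (int p) (arms lam) R" "int (card (p_rim_star p lam)) = star_size (int p) R"
    "2 * card (U_set p lam) = card (p_rim_star p lam) + mull_eps p (card (p_rim_star p lam))"
    "star_eps (int p) R = int (mull_eps p (card (p_rim_star p lam)))"
    "even (card (p_rim_star p lam)) \<longleftrightarrow> p dvd card (p_rim_star p lam)"
    "lam \<noteq> [] \<Longrightarrow> star_step (int p) (arms lam) R (arms (remove_p_rim_star p lam))"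
proof -
  have b: "is_partition lam" "self_conjugate lam" "bg_free (int p) (arms lam)"
    using assms(2) unfolding BG_partition_iff by auto
  obtain R where R: "chain (int p) (arms lam) R" "int (card (p_rim_star p lam)) = star_size (int p) R"
    "2 * int (card (U_set p lam)) = star_size (int p) R + star_eps (int p) R"
    "lam \<noteq> [] \<Longrightarrow> star_step (int p) (arms lam) R (arms (remove_p_rim_star p lam))"
    using star_chain[OF assms(1) b(1,2)] by metis
  have e: "star_eps (int p) R = int (mull_eps p (card (p_rim_star p lam)))"
    "even (int (card (p_rim_star p lam))) \<longleftrightarrow> int p dvd int (card (p_rim_star p lam))"
    using star_eps_eq[OF R(1) finite_arms arms_nonneg b(3)] unfolding R(2)[symmetric] chain_eps_nat by auto
  moreover have "2 * card (U_set p lam) = card (p_rim_star p lam) + mull_eps p (card (p_rim_star p lam))"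
    using R(3) unfolding e(1) R(2)[symmetric] by linarith
  moreover have "even (card (p_rim_star p lam)) \<longleftrightarrow> p dvd card (p_rim_star p lam)" using e(2) by simp
  ultimately show thesis using that[OF R(1,2)] R(4) by blast
qed

lemma BG_remove:
  assumes "2 \<le> p" "BG_partition p lam" "lam \<noteq> []"
  shows "BG_partition p (remove_p_rim_star p lam)"
proof -
  have b: "is_partition lam" "self_conjugate lam" "bg_free (int p) (arms lam)"
    using assms(2) unfolding BG_partition_iff by auto
  obtain R where "star_step (int p) (arms lam) R (arms (remove_p_rim_star p lam))"
    using BG_star_chain[OF assms(1,2)] assms(3) by metis
  then show ?thesis
    using star_step.bg_free_next b remove_p_rim_star_partition[OF assms(1) b(1,2) assms(3)]
    unfolding BG_partition_iff by blast
qed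

lemma star_link_remove:
  assumes p: "2 \<le> p" and lam: "BG_partition p lam" "lam \<noteq> []"
  shows "star_link p (card (p_rim_star p lam), card (U_set p lam))
    (card (p_rim_star p (remove_p_rim_star p lam)), card (U_set p (remove_p_rim_star p lam)))"
proof -
  obtain S where S: "int (card (p_rim_star p lam)) = star_size (int p) S"
    "2 * card (U_set p lam) = card (p_rim_star p lam) + mull_eps p (card (p_rim_star p lam))"
    "star_eps (int p) S = int (mull_eps p (card (p_rim_star p lam)))"
    "even (card (p_rim_star p lam)) \<longleftrightarrow> p dvd card (p_rim_star p lam)"
    "star_step (int p) (arms lam) S (arms (remove_p_rim_star p lam))"
    using BG_star_chain[OF p lam(1)] lam(2) by metis
  obtain R where R: "chain (int p) (arms (remove_p_rim_star p lam)) R"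
    "int (card (p_rim_star p (remove_p_rim_star p lam))) = star_size (int p) R"
    "star_eps (int p) R = int (mull_eps p (card (p_rim_star p (remove_p_rim_star p lam))))"
    using BG_star_chain[OF p BG_remove[OF p lam]] by metis
  have "1 \<le> card (p_rim_star p lam)" using star_step.size_pos[OF S(5)] S(1) by simp
  then show ?thesis using star_step.size_drop_bounds[OF S(5) R(1)] S(2,4)
    unfolding S(1)[symmetric] R(2)[symmetric] S(3) R(3) by simp
qed

lemma remove_p_rim_star_inj:
  assumes p: "2 \<le> p" and lam: "BG_partition p lam" "lam \<noteq> []" and mu: "BG_partition p mu" "mu \<noteq> []"
    and eq: "card (p_rim_star p lam) = card (p_rim_star p mu)" "remove_p_rim_star p lam = remove_p_rim_star p mu"
  shows "lam = mu"
proof -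
  obtain S where S: "int (card (p_rim_star p lam)) = star_size (int p) S"
    "star_step (int p) (arms lam) S (arms (remove_p_rim_star p lam))"
    using BG_star_chain[OF p lam(1)] lam(2) by metis
  obtain R where R: "int (card (p_rim_star p mu)) = star_size (int p) R"
    "star_step (int p) (arms mu) R (arms (remove_p_rim_star p mu))"
    using BG_star_chain[OF p mu(1)] mu(2) by metis
  have "arms lam = arms mu" using star_step_inj[OF S(2)] R S(1) eq by metis
  then show ?thesis using arms_inj lam mu unfolding BG_partition_iff by blast
qed

lemma remove_p_rim_star_surj:
  assumes p: "2 \<le> p" "odd p" and mu: "BG_partition p mu"
    and link: "star_link p (a, r) (card (p_rim_star p mu), card (U_set p mu))"
  shows "\<exists>lam. BG_partition p lam \<and> lam \<noteq> [] \<and> (card (p_rim_star p lam), card (U_set p lam)) = (a, r)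
    \<and> remove_p_rim_star p lam = mu"
proof -
  have m: "is_partition mu" "self_conjugate mu" "bg_free (int p) (arms mu)" using mu unfolding BG_partition_iff by auto
  have a: "even (int a) \<longleftrightarrow> int p dvd int a" using link by simp
  \<comment> \<open>Without arms \<open>mu\<close> is empty and the link forces
    \<open>a < 2 * p\<close>, but an even \<open>a\<close> is a positive multiple of
    \<open>2 * p\<close>.\<close>
  have ne: "arms mu \<noteq> {}" if "even (int a)"
  proof
    assume "arms mu = {}"
    then have "mu = []"
      using BG_star_chain[OF p(1) mu] star_step.axioms(1) removal.neX by metis
    moreover have "2 * p dvd a" using that a p(2) by (intro divides_mult) auto
    ultimately show False using link dvd_imp_le[of "2 * p" a] that a by (auto simp: mull_eps_def)
  qed
  obtain X S where XS: "star_step (int p) X S (arms mu)" "bg_free (int p) X"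
    "star_size (int p) S mod (2 * int p) = int a mod (2 * int p)"
    using star_step_exists[of "int p" "arms mu" "int a"] p m(3) a ne arms_nonneg finite_arms
    by (metis even_of_nat of_nat_le_iff of_nat_numeral)
  interpret M: star_step "int p" X S "arms mu" by (rule XS(1))
  obtain lam where lam: "is_partition lam" "self_conjugate lam" "arms lam = X"
    using arms_surj[OF M.finX M.nonnegX] .
  have lne: "lam \<noteq> []" using M.neX lam(3) by (auto simp: arms_def beads_def)
  have bg: "BG_partition p lam" using lam XS(2) unfolding BG_partition_iff by simp
  obtain S' where S': "chain (int p) (arms lam) S'" "int (card (p_rim_star p lam)) = star_size (int p) S'"
    "2 * card (U_set p lam) = card (p_rim_star p lam) + mull_eps p (card (p_rim_star p lam))"
    "even (card (p_rim_star p lam)) \<longleftrightarrow> p dvd card (p_rim_star p lam)"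
    "star_step (int p) (arms lam) S' (arms (remove_p_rim_star p lam))"
    using BG_star_chain[OF p(1) bg] lne by metis
  have SS: "S' = S" using chain_unique[OF S'(1) _ finite_arms] M.chainS lam(3) by simp
  have "arms (remove_p_rim_star p lam) = arms mu"
    using star_step.Z[OF S'(5)] M.Z SS lam(3) by simp
  then have rem: "remove_p_rim_star p lam = mu"
    using arms_inj remove_p_rim_star_partition[OF p(1) lam(1,2) lne] m(1,2) by blast
  let ?b = "card (p_rim_star p lam)" and ?a' = "card (p_rim_star p mu)"
  have mod: "int ?b mod (2 * int p) = int a mod (2 * int p)" using XS(3) S'(2) SS by simp
  \<comment> \<open>The interval for the true count depends on its own \<open>mull_eps\<close>.
    Parity survives reduction modulo \<open>2 * p\<close> and determines \<open>mull_eps\<close>, so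
    both counts lie in the same interval.\<close>
  then have "even (int ?b) \<longleftrightarrow> even (int a)" by (metis dvd_mod_iff dvd_triv_left)
  then have e: "mull_eps p ?b = mull_eps p a" using S'(4) link by (simp add: mull_eps_def)
  have "int ?b - int ?a' = int a - int ?a'"
  proof (rule mod_eq_window)
    show "(int ?b - int ?a') mod (2 * int p) = (int a - int ?a') mod (2 * int p)"
      using mod by (metis mod_diff_left_eq)
  next
    let ?c = "int (mull_eps p a) + int (mull_eps p ?a')"
    show "?c \<le> int ?b - int ?a'" "int ?b - int ?a' < ?c + 2 * int p"
      using star_link_remove[OF p(1) bg lne] unfolding rem star_link.simps e by linarith+
    show "?c \<le> int a - int ?a'" "int a - int ?a' < ?c + 2 * int p"
      using link by auto
  qed
  then have ba: "?b = a" by simp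
  then have "card (U_set p lam) = r" using S'(3) link by simp
  then show ?thesis using bg lne rem ba by blast
qed

lemma BG_peeling:
  assumes "2 \<le> p"
  shows "peeling (BG_partition p) (remove_p_rim_star p) (\<lambda>mu. (card (p_rim_star p mu), card (U_set p mu)))"
proof
  show "BG_partition p []"
    by (simp add: BG_partition_iff self_conjugate_def conj_part_def part_def arms_def beads_def bg_free_def)
  fix lam assume lam: "BG_partition p lam" "lam \<noteq> []"
  then have pt: "is_partition lam" "self_conjugate lam" by (auto simp: BG_partition_def)
  show "BG_partition p (remove_p_rim_star p lam)" using BG_remove[OF assms lam] .
  show "sum_list lam = fst (card (p_rim_star p lam), card (U_set p lam)) + sum_list (remove_p_rim_star p lam)"
    using remove_p_rim_star_partition[OF assms pt lam(2)] by simp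
  show "0 < fst (card (p_rim_star p lam), card (U_set p lam))"
    using star_link_remove[OF assms lam] by auto
qed simp

lemma BG_symbol_peeling:
  assumes "2 \<le> p"
  shows "BG_symbol p = peeling.symbol (remove_p_rim_star p) (\<lambda>mu. (card (p_rim_star p mu), card (U_set p mu)))"
  unfolding peeling.symbol_def[OF BG_peeling[OF assms]] BG_symbol_def Let_def ..

lemma BG_symbol_bij:
  assumes "2 \<le> p" "odd p"
  shows "bij_betw (BG_symbol p) {lam. BG_partition p lam} {xs. linked (star_link p) xs}"
  unfolding BG_symbol_peeling[OF assms(1)]
proof (rule peeling.symbol_bij[OF BG_peeling[OF assms(1)]])
  fix lam mu assume "BG_partition p lam" "BG_partition p mu" "lam \<noteq> []" "mu \<noteq> []"
    "(card (p_rim_star p lam), card (U_set p lam)) = (card (p_rim_star p mu), card (U_set p mu))"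
    "remove_p_rim_star p lam = remove_p_rim_star p mu"
  then show "lam = mu" using remove_p_rim_star_inj[OF assms(1), of lam mu] by simp
next
  fix x mu assume "BG_partition p mu" "star_link p x (card (p_rim_star p mu), card (U_set p mu))"
  then show "\<exists>lam. BG_partition p lam \<and> lam \<noteq> [] \<and> (card (p_rim_star p lam), card (U_set p lam)) = x
      \<and> remove_p_rim_star p lam = mu"
    using remove_p_rim_star_surj[OF assms, of mu "fst x" "snd x"] by simp
qed (rule star_link_remove[OF assms(1)])

lemma sum_BG_symbol:
  assumes "2 \<le> p" "BG_partition p lam" shows "sum_list (map fst (BG_symbol p lam)) = sum_list lam"
  unfolding BG_symbol_peeling[OF assms(1)] using peeling.sum_symbol[OF BG_peeling] assms by blast

section \<open>The Mullineux involution on linked arrays\<close>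

definition flip_column :: "nat \<Rightarrow> nat \<times> nat \<Rightarrow> nat \<times> nat" where
  "flip_column p = (\<lambda>(a, r). (a, a + mull_eps p a - r))"

lemma mull_eps_le: "mull_eps p a \<le> 1" by (simp add: mull_eps_def)

lemma symbol_head_map: "symbol_head (map (flip_column p) xs) = flip_column p (symbol_head xs)"
  by (cases xs) (auto simp: flip_column_def mull_eps_def)

lemma linked_flip_bounds:
  assumes "linked (mull_link p) xs" "xs \<noteq> []" "symbol_head xs = (a, r)"
  shows "r \<le> a" "1 \<le> a + mull_eps p a - r"
proof -
  have "r \<le> a \<and> 1 \<le> a + mull_eps p a - r"
    using assms
  proof (induction xs arbitrary: a r)
    case (Cons x xs)
    obtain a' r' where h: "symbol_head xs = (a', r')" by fastforce
    then have l: "mull_link p (a, r) (a', r')" using Cons.prems by simp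
    show ?case
    proof (cases "xs = []")
      case True
      then have "a' = 0" "r' = 0" using h by auto
      moreover have "p \<le> a" if "p dvd a" "0 < a" using that by (rule dvd_imp_le)
      ultimately show ?thesis using l by (auto simp: mull_eps_def split: if_splits)
    next
      case False
      then have "r' \<le> a'" "1 \<le> a' + mull_eps p a' - r'" using Cons.IH[OF _ False h] Cons.prems by auto
      then show ?thesis using l by auto
    qed
  qed simp
  then show "r \<le> a" "1 \<le> a + mull_eps p a - r" by auto
qed

text \<open>With \<open>s = a + mull_eps p a - r\<close>, and \<open>s'\<close> likewise, the bounds
  on \<open>a - a'\<close> are the bounds on \<open>s - s'\<close> and conversely: the flip
  exchanges the two pairs of inequalities. The preceding bounds keep the natural subtraction exact
  and the new entry positive.\<close>

lemma linked_flip: "linked (mull_link p) xs \<Longrightarrow> linked (mull_link p) (map (flip_column p) xs)"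
proof (induction xs)
  case (Cons x xs)
  obtain a r where x: "x = (a, r)" by fastforce
  obtain a' r' where h: "symbol_head xs = (a', r')" by fastforce
  have l: "mull_link p (a, r) (a', r')" using Cons.prems h x by simp
  have b: "r \<le> a" "1 \<le> a + mull_eps p a - r" using linked_flip_bounds[OF Cons.prems] x by auto
  have "r' \<le> a' + mull_eps p a'"
    using linked_flip_bounds(1)[of p xs a' r'] Cons.prems h by (cases "xs = []") auto
  then have "mull_link p (flip_column p (a, r)) (flip_column p (a', r'))"
    using l b by (auto simp: flip_column_def of_nat_diff)
  then show ?case using Cons x h by (simp add: symbol_head_map)
qed simp

text \<open>A fixed column satisfies \<open>2 * r = a + mull_eps p a\<close>. Substituting this for
  both columns turns each of the two pairs in \<open>mull_link\<close> into the single pair in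
  \<open>star_link\<close>; since \<open>p\<close> is odd, the parity clause follows from the same
  equation.\<close>

lemma star_link_iff:
  assumes "odd p" "2 * r' = a' + mull_eps p a'"
  shows "star_link p (a, r) (a', r') \<longleftrightarrow> mull_link p (a, r) (a', r') \<and> flip_column p (a, r) = (a, r)"
proof -
  have e: "mull_eps p a = 0 \<and> p dvd a \<or> mull_eps p a = 1 \<and> \<not> p dvd a" by (simp add: mull_eps_def)
  show ?thesis
  proof
    assume s: "star_link p (a, r) (a', r')"
    then have "2 * int r = int a + int (mull_eps p a)" "2 * int r' = int a' + int (mull_eps p a')"
      using assms(2) by auto
    then show "mull_link p (a, r) (a', r') \<and> flip_column p (a, r) = (a, r)"
      using s by (auto simp: flip_column_def)
  next
    assume m: "mull_link p (a, r) (a', r') \<and> flip_column p (a, r) = (a, r)"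
    then have r: "2 * r = a + mull_eps p a" "1 \<le> r" by (auto simp: flip_column_def)
    then have i: "2 * int r = int a + int (mull_eps p a)" "2 * int r' = int a' + int (mull_eps p a')"
      using assms(2) by auto
    have "even (a + mull_eps p a)" using r(1) by (metis dvd_triv_left)
    then have "even a \<longleftrightarrow> p dvd a" using e by auto
    moreover have "1 \<le> a" using r mull_eps_le[of p a] by linarith
    ultimately show "star_link p (a, r) (a', r')" using m r(1) i by auto
  qed
qed

lemma linked_star_iff:
  assumes "odd p"
  shows "linked (star_link p) xs \<longleftrightarrow> linked (mull_link p) xs \<and> map (flip_column p) xs = xs"
proof (induction xs)
  case (Cons x xs)
  obtain a r where x: "x = (a, r)" by fastforce
  obtain a' r' where h: "symbol_head xs = (a', r')" by fastforce
  \<comment> \<open>The next column is fixed by its own link, and the default \<open>(0, 0)\<close>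
    is fixed because \<open>p\<close> divides 0.\<close>
  have "2 * r' = a' + mull_eps p a'" if "linked (star_link p) xs"
  proof (cases xs)
    case Nil
    then show ?thesis using h by (simp add: mull_eps_def)
  next
    case (Cons y ys)
    then show ?thesis using h that by (cases "symbol_head ys") auto
  qed
  then show ?case using Cons.IH star_link_iff[OF assms, of r' a' a r] x h by auto
qed simp

text \<open>The flipped symbol is again linked, hence the symbol of exactly one p-regular partition,
  so the description in \<open>mullineux_map\<close> denotes. Injectivity turns a fixed partition
  into a symbol with fixed columns.\<close>

lemma self_mullineux_iff:
  assumes "2 \<le> p" "odd p"
  shows "self_mullineux p lam \<longleftrightarrow> p_regular p lam \<and> linked (star_link p) (mull_symbol p lam)"
proof (cases "p_regular p lam")
  case True
  note bij = mull_symbol_bij[OF assms(1)]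
  have l: "linked (mull_link p) (mull_symbol p lam)" using bij True by (auto simp: bij_betw_def)
  then have "linked (mull_link p) (map (flip_column p) (mull_symbol p lam))" by (rule linked_flip)
  then obtain mu where mu: "p_regular p mu" "mull_symbol p mu = map (flip_column p) (mull_symbol p lam)"
    using bij by (force simp: bij_betw_def image_iff set_eq_iff)
  then have "mullineux_map p lam = mu"
    unfolding mullineux_map_def flip_column_def[symmetric]
    using bij by (intro the_equality) (auto simp: bij_betw_def inj_on_def)
  then have "self_mullineux p lam \<longleftrightarrow> mu = lam" using True by (simp add: self_mullineux_def)
  also have "\<dots> \<longleftrightarrow> mull_symbol p mu = mull_symbol p lam"
    using bij mu True by (auto simp: bij_betw_def inj_on_def)
  finally show ?thesis using mu True l linked_star_iff[OF assms(2)] by simp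
qed (simp add: self_mullineux_def)

text \<open>Both symbol maps are bijections onto classes of linked arrays, and self-Mullineux
  partitions are cut out by the very class that BG-symbols fill. The first row of a symbol sums to
  the size of its partition, which gives the statement for each \<open>n\<close>.\<close>

theorem theorem3p15:
  fixes p :: nat
  assumes "prime p" and "odd p"
  shows "{BG_symbol p lam | lam. BG_partition p lam} = {mull_symbol p mu | mu. self_mullineux p mu}
    \<and> bij_betw (BG_to_mull p) {lam. BG_partition p lam} {mu. self_mullineux p mu}
    \<and> (\<forall>n. bij_betw (BG_to_mull p) {lam. BG_partition p lam \<and> sum_list lam = n}
                                   {mu. self_mullineux p mu \<and> sum_list mu = n})"
proof -
  have p: "2 \<le> p" using assms(1) by (rule prime_ge_2_nat)
  note mb = mull_symbol_bij[OF p] and bb = BG_symbol_bij[OF p assms(2)]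
  note sm = self_mullineux_iff[OF p assms(2)] and ls = linked_star_iff[OF assms(2)]
  have reg: "p_regular p mu" if "self_mullineux p mu" for mu using that sm by blast
  have mull_eqD: "lam = mu" if "p_regular p lam" "p_regular p mu" "mull_symbol p lam = mull_symbol p mu" for lam mu
    using mb that by (auto simp: bij_betw_def inj_on_def)
  have BG_eqD: "lam = mu" if "BG_partition p lam" "BG_partition p mu" "BG_symbol p lam = BG_symbol p mu" for lam mu
    using bb that by (auto simp: bij_betw_def inj_on_def)
  have to_SM: "\<exists>mu. self_mullineux p mu \<and> mull_symbol p mu = BG_symbol p lam" if "BG_partition p lam" for lam
  proof -
    have l: "linked (star_link p) (BG_symbol p lam)" using bb that by (auto simp: bij_betw_def)
    then have "BG_symbol p lam \<in> mull_symbol p ` {mu. p_regular p mu}" using mb ls by (simp add: bij_betw_def)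
    then show ?thesis using l sm by (metis (mono_tags, lifting) imageE mem_Collect_eq)
  qed
  have to_BG: "\<exists>lam. BG_partition p lam \<and> BG_symbol p lam = mull_symbol p mu" if "self_mullineux p mu" for mu
  proof -
    have "mull_symbol p mu \<in> BG_symbol p ` {lam. BG_partition p lam}" using bb that sm by (simp add: bij_betw_def)
    then show ?thesis by (metis (mono_tags, lifting) imageE mem_Collect_eq)
  qed
  have sets: "{BG_symbol p lam | lam. BG_partition p lam} = {mull_symbol p mu | mu. self_mullineux p mu}"
    using to_SM to_BG by (metis (mono_tags, lifting))
  have B: "self_mullineux p (BG_to_mull p lam) \<and> mull_symbol p (BG_to_mull p lam) = BG_symbol p lam"
    if "BG_partition p lam" for lam
  proof -
    obtain mu where mu: "self_mullineux p mu" "mull_symbol p mu = BG_symbol p lam" using to_SM[OF \<open>BG_partition p lam\<close>] by blast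
    then have "BG_to_mull p lam = mu" unfolding BG_to_mull_def
      using reg mull_eqD by (intro the_equality) auto
    then show ?thesis using mu by simp
  qed
  have size: "sum_list (BG_to_mull p lam) = sum_list lam" if "BG_partition p lam" for lam
    using B[OF that] reg sum_mull_symbol[OF p] sum_BG_symbol[OF p that] by metis
  have inj: "inj_on (BG_to_mull p) {lam. BG_partition p lam}"
    using B BG_eqD by (intro inj_onI) (metis mem_Collect_eq)
  have onto: "\<exists>lam. BG_partition p lam \<and> BG_to_mull p lam = mu" if "self_mullineux p mu" for mu
    using to_BG[OF that] B mull_eqD reg that by metis
  have "bij_betw (BG_to_mull p) {lam. BG_partition p lam} {mu. self_mullineux p mu}"
    unfolding bij_betw_def using inj B onto by blast
  moreover have "bij_betw (BG_to_mull p) {lam. BG_partition p lam \<and> sum_list lam = n}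
      {mu. self_mullineux p mu \<and> sum_list mu = n}" for n
    unfolding bij_betw_def
  proof
    show "inj_on (BG_to_mull p) {lam. BG_partition p lam \<and> sum_list lam = n}"
      using inj by (rule inj_on_subset) blast
    show "BG_to_mull p ` {lam. BG_partition p lam \<and> sum_list lam = n} = {mu. self_mullineux p mu \<and> sum_list mu = n}"
    proof (intro equalityI subsetI)
      fix mu assume "mu \<in> BG_to_mull p ` {lam. BG_partition p lam \<and> sum_list lam = n}"
      then show "mu \<in> {mu. self_mullineux p mu \<and> sum_list mu = n}" using B size by auto
    next
      fix mu assume mu: "mu \<in> {mu. self_mullineux p mu \<and> sum_list mu = n}"
      then obtain lam where "BG_partition p lam" "BG_to_mull p lam = mu" using onto by blast
      then show "mu \<in> BG_to_mull p ` {lam. BG_partition p lam \<and> sum_list lam = n}" using mu size by auto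
    qed
  qed
  ultimately show ?thesis using sets by blast
qed

end
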